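(* Let $\mathcal{C}$ be a sovereign category and $T$ be a Hopf monad on $\mathcal{C}$. Then sovereign elements of $T$ are in bijection with sovereign structures (considered up to equivalence) on the category $T\text{-}\mathcal{C}$ of $T$-modules.
   Context: Conventions: categories are small, monoidal categories $(\mathcal{C},\otimes,\mathbf 1)$ are strict; composition of $f$ followed by $g$ is written $gf$; "functorial morphism" means natural transformation. Monads: a monad on $\mathcal{C}$ is $(T,\mu\colon T^2\to T,\eta\colon 1_{\mathcal C}\to T)$ with $\mu_XT(\mu_X)=\mu_X\mu_{T(X)}$, $\mu_X\eta_{T(X)}=\mathrm{id}=\mu_XT(\eta_X)$. A $T$-module is $(M,r)$ with $r\colon T(M)\to M$, $rT(r)=r\mu_M$, $r\eta_M=\mathrm{id}_M$; morphisms $f\colon(M,r)\to(N,s)$ satisfy $fr=sT(f)$. $T\text{-}\mathcal{C}$ is the category of $T$-modules. Bimonads: a bimonad on a monoidal category $\mathcal{C}$ is a monad $T$ equipped with natural $T_2(X,Y)\colon T(X\otimes Y)\to T(X)\otimes T(Y)$ and $T_0\colon T(\mathbf 1)\to\mathbf 1$ with $(\mathrm{id}\otimes T_2(Y,Z))T_2(X,Y\otimes Z)=(T_2(X,Y)\otimes \mathrm{id})T_2(X\otimes Y,Z)$, $(\mathrm{id}\otimes T_0)T_2(X,\mathbf 1)=\mathrm{id}=(T_0\otimes\mathrm{id})T_2(\mathbf 1,X)$, $T_2(X,Y)\mu_{X\otimes Y}=(\mu_X\otimes\mu_Y)T_2(T(X),T(Y))T(T_2(X,Y))$, $T_0\mu_{\mathbf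 1}=T_0T(T_0)$, $T_2(X,Y)\eta_{X\otimes Y}=\eta_X\otimes\eta_Y$, $T_0\eta_{\mathbf 1}=\mathrm{id}_{\mathbf 1}$. Then $T\text{-}\mathcal{C}$ is monoidal with $(M,r)\otimes(N,s)=(M\otimes N,(r\otimes s)T_2(M,N))$ and unit $(\mathbf 1,T_0)$. Duals: left dual of $X$: $({}^\vee X,\mathrm{ev}_X\colon{}^\vee X\otimes X\to\mathbf 1,\mathrm{coev}_X\colon\mathbf 1\to X\otimes{}^\vee X)$; right dual: $(X^\vee,\widetilde{\mathrm{ev}}_X\colon X\otimes X^\vee\to\mathbf 1,\widetilde{\mathrm{coev}}_X\colon\mathbf 1\to X^\vee\otimes X)$. (Left) autonomous: all objects have (left) both duals. Hopf monads: a Hopf monad is a bimonad $T$ on an autonomous category admitting a left and a right antipode. A left antipode is a functorial family $s^l_X\colon T({}^\vee T(X))\to{}^\vee X$ with $T_0T(\mathrm{ev}_X)T({}^\vee\eta_X\otimes\mathrm{id}_X)=\mathrm{ev}_{T(X)}(s^l_{T(X)}T({}^\vee\mu_X)\otimes\mathrm{id}_{T(X)})T_2({}^\vee T(X),X)$ and $(\eta_X\otimes\mathrm{id}_{{}^\vee X})\mathrm{coev}_XT_0=(\mu_X\otimes s^l_X)T_2(T(X),{}^\vee T(X))T(\mathrm{coev}_{T(X)})$. A right antipode is a functorial family $s^r_X\colon T(T(X)^\vee)\to X^\vee$ with $T_0T(\widetilde{\mathrm{ev}}_X)T(\mathrm{id}_X\otimes\eta_X^\vee)=\widetilde{\mathrm{ev}}_{T(X)}(\mathrm{id}_{T(X)}\otimes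 s^r_{T(X)}T(\mu_X^\vee))T_2(X,T(X)^\vee)$ and $(\mathrm{id}_{X^\vee}\otimes\eta_X)\widetilde{\mathrm{coev}}_XT_0=(s^r_X\otimes\mu_X)T_2(T(X)^\vee,T(X))T(\widetilde{\mathrm{coev}}_{T(X)})$. Antipodes are unique when they exist, and $T\text{-}\mathcal{C}$ is then autonomous with ${}^\vee(M,r)=({}^\vee M,s^l_MT({}^\vee r))$, $(M,r)^\vee=(M^\vee,s^r_MT(r^\vee))$ and evaluations/coevaluations those of $\mathcal{C}$. Sovereign structures: a sovereign structure on a left autonomous category is a choice of left dual for each object, hence a strong monoidal double dual functor ${}^{\vee\vee}?$, together with a monoidal natural transformation $\phi\colon 1\to{}^{\vee\vee}?$ (automatically an isomorphism). Two sovereign structures are equivalent if the monoidal isomorphisms coincide via the canonical identification of the double dual functors. A sovereign category is a left autonomous category endowed with an equivalence class of sovereign structures; it is automatically autonomous. Sovereign elements: for functorial morphisms $a,b\colon1_{\mathcal C}\to T$, the convolution product is $(a*b)_X=\mu_Xa_{T(X)}b_X$, with unit $\eta$; $a^{*-1}$ is the inverse for $*$. Put $(L_a)_X=\mu_Xa_{T(X)}$, $(R_a)_X=\mu_XT(a_X)$, and, for $a$ $*$-invertible, $\mathrm{ad}_a=L_aR_{a^{*-1}}\colon T\to T$. The square of the antipode is $S^2\colon T\to T$, $S^2_X=\phi^{-1}_{T(X)}\,s^l_{{}^\vee T(X)}\,T({}^\vee(s^l_X))\,T(\phi_X)$, where $\phi$ is the sovereign structure of $\mathcal{C}$. A grouplike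 element of $T$ is a functorial morphism $g\colon1_{\mathcal C}\to T$ with $T_2(X,Y)g_{X\otimes Y}=g_X\otimes g_Y$ and $T_0g_{\mathbf 1}=\mathrm{id}_{\mathbf 1}$ (grouplike elements of a Hopf monad are $*$-invertible). A sovereign element of $T$ is a grouplike element $G$ with $S^2=\mathrm{ad}_G$. *)

theory Defs
  imports "HOL-Library.FuncSet"
begin

section \<open>Strict monoidal categories\<close>

text \<open>
  Composition is written in the usual order: \<open>g \<cdot> f\<close> is \<open>f\<close> followed by \<open>g\<close>.
  The tensor product is \<open>\<boxtimes>\<close> on objects and \<open>\<otimes>\<close> on arrows.
\<close>

record ('o, 'a) moncat =
  obj :: "'o set"
  arr :: "'a set"
  src :: "'a \<Rightarrow> 'o"
  trg :: "'a \<Rightarrow> 'o"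
  ident :: "'o \<Rightarrow> 'a"
  cmp :: "'a \<Rightarrow> 'a \<Rightarrow> 'a"  (infixr \<open>\<cdot>\<index>\<close> 70)
  tenso :: "'o \<Rightarrow> 'o \<Rightarrow> 'o"  (infixr \<open>\<boxtimes>\<index>\<close> 80)
  tensa :: "'a \<Rightarrow> 'a \<Rightarrow> 'a"  (infixr \<open>\<otimes>\<index>\<close> 80)
  munit :: "'o"  (\<open>\<one>\<index>\<close>)

definition hom :: "('o, 'a) moncat \<Rightarrow> 'o \<Rightarrow> 'o \<Rightarrow> 'a set" where
  "hom C X Y = {f \<in> arr C. src C f = X \<and> trg C f = Y}"

locale category =
  fixes C :: "('o, 'a) moncat" (structure)
  assumes src_obj: "f \<in> arr C \<Longrightarrow> src C f \<in> obj C"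
    and trg_obj: "f \<in> arr C \<Longrightarrow> trg C f \<in> obj C"
    and ident_hom: "X \<in> obj C \<Longrightarrow> ident C X \<in> hom C X X"
    and cmp_hom: "\<lbrakk>f \<in> hom C X Y; g \<in> hom C Y Z\<rbrakk> \<Longrightarrow> g \<cdot> f \<in> hom C X Z"
    and cmp_assoc: "\<lbrakk>f \<in> hom C W X; g \<in> hom C X Y; h \<in> hom C Y Z\<rbrakk> \<Longrightarrow> (h \<cdot> g) \<cdot> f = h \<cdot> (g \<cdot> f)"
    and ident_right: "f \<in> hom C X Y \<Longrightarrow> f \<cdot> ident C X = f"
    and ident_left: "f \<in> hom C X Y \<Longrightarrow> ident C Y \<cdot> f = f"

locale strict_monoidal_category = category +
  assumes munit_obj: "\<one> \<in> obj C"
    and tenso_obj: "\<lbrakk>X \<in> obj C; Y \<in> obj C\<rbrakk> \<Longrightarrow> X \<boxtimes> Y \<in> obj C"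
    and tensa_hom: "\<lbrakk>f \<in> hom C X X'; g \<in> hom C Y Y'\<rbrakk> \<Longrightarrow> f \<otimes> g \<in> hom C (X \<boxtimes> Y) (X' \<boxtimes> Y')"
    and tensa_ident: "\<lbrakk>X \<in> obj C; Y \<in> obj C\<rbrakk> \<Longrightarrow> ident C X \<otimes> ident C Y = ident C (X \<boxtimes> Y)"
    and interchange: "\<lbrakk>f \<in> hom C X X'; f' \<in> hom C X' X''; g \<in> hom C Y Y'; g' \<in> hom C Y' Y''\<rbrakk>
      \<Longrightarrow> (f' \<cdot> f) \<otimes> (g' \<cdot> g) = (f' \<otimes> g') \<cdot> (f \<otimes> g)"
    and tenso_assoc: "\<lbrakk>X \<in> obj C; Y \<in> obj C; Z \<in> obj C\<rbrakk> \<Longrightarrow> (X \<boxtimes> Y) \<boxtimes> Z = X \<boxtimes> (Y \<boxtimes> Z)"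
    and tensa_assoc: "\<lbrakk>f \<in> arr C; g \<in> arr C; h \<in> arr C\<rbrakk> \<Longrightarrow> (f \<otimes> g) \<otimes> h = f \<otimes> (g \<otimes> h)"
    and tenso_unit_left: "X \<in> obj C \<Longrightarrow> \<one> \<boxtimes> X = X"
    and tenso_unit_right: "X \<in> obj C \<Longrightarrow> X \<boxtimes> \<one> = X"
    and tensa_unit_left: "f \<in> arr C \<Longrightarrow> ident C \<one> \<otimes> f = f"
    and tensa_unit_right: "f \<in> arr C \<Longrightarrow> f \<otimes> ident C \<one> = f"

definition inv_arr :: "('o, 'a) moncat \<Rightarrow> 'a \<Rightarrow> 'a" where
  "inv_arr C f = (THE g. g \<in> hom C (trg C f) (src C f) \<and>
      g \<cdot>\<^bsub>C\<^esub> f = ident C (src C f) \<and> f \<cdot>\<^bsub>C\<^esub> g = ident C (trg C f))"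


section \<open>Functors and functorial morphisms\<close>

record ('o, 'a, 'p, 'b) functor_data =
  omap :: "'o \<Rightarrow> 'p"
  amap :: "'a \<Rightarrow> 'b"

definition is_functor ::
  "('o, 'a) moncat \<Rightarrow> ('p, 'b) moncat \<Rightarrow> ('o, 'a, 'p, 'b, 'z) functor_data_scheme \<Rightarrow> bool" where
  "is_functor C D F \<longleftrightarrow>
     (\<forall>X \<in> obj C. omap F X \<in> obj D) \<and>
     (\<forall>X Y. \<forall>f \<in> hom C X Y. amap F f \<in> hom D (omap F X) (omap F Y)) \<and>
     (\<forall>X \<in> obj C. amap F (ident C X) = ident D (omap F X)) \<and>
     (\<forall>X Y Z. \<forall>f \<in> hom C X Y. \<forall>g \<in> hom C Y Z.
        amap F (g \<cdot>\<^bsub>C\<^esub> f) = amap F g \<cdot>\<^bsub>D\<^esub> amap F f)"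

definition id_functor :: "('o, 'a, 'o, 'a) functor_data" where
  "id_functor = \<lparr>omap = \<lambda>X. X, amap = \<lambda>f. f\<rparr>"

definition comp_functor ::
  "('p, 'b, 'q, 'c, 'y) functor_data_scheme \<Rightarrow> ('o, 'a, 'p, 'b, 'z) functor_data_scheme
     \<Rightarrow> ('o, 'a, 'q, 'c) functor_data" where
  "comp_functor G F = \<lparr>omap = \<lambda>X. omap G (omap F X), amap = \<lambda>f. amap G (amap F f)\<rparr>"

text \<open>
  A functorial morphism is a family indexed by the objects of the source category. Requiring it to
  be \<^const>\<open>extensional\<close> makes equality of the HOL functions coincide with equality of the families,
  so that sets of functorial morphisms are not inflated by irrelevant values.
\<close>

definition nat_trans ::
  "('o, 'a) moncat \<Rightarrow> ('p, 'b) moncat \<Rightarrow> ('o, 'a, 'p, 'b, 'y) functor_data_scheme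
     \<Rightarrow> ('o, 'a, 'p, 'b, 'z) functor_data_scheme \<Rightarrow> ('o \<Rightarrow> 'b) \<Rightarrow> bool" where
  "nat_trans C D F G \<alpha> \<longleftrightarrow>
     \<alpha> \<in> extensional (obj C) \<and>
     (\<forall>X \<in> obj C. \<alpha> X \<in> hom D (omap F X) (omap G X)) \<and>
     (\<forall>X Y. \<forall>f \<in> hom C X Y. \<alpha> Y \<cdot>\<^bsub>D\<^esub> amap F f = amap G f \<cdot>\<^bsub>D\<^esub> \<alpha> X)"

text \<open>
  Monoidal functors: \<open>fmult F X Y : F(X) \<otimes> F(Y) \<rightarrow> F(X \<otimes> Y)\<close> and \<open>funit F : \<one> \<rightarrow> F(\<one>)\<close>.
\<close>

record ('o, 'a, 'p, 'b) monfunctor_data = "('o, 'a, 'p, 'b) functor_data" +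
  fmult :: "'o \<Rightarrow> 'o \<Rightarrow> 'b"
  funit :: "'b"

definition id_monfunctor :: "('o, 'a) moncat \<Rightarrow> ('o, 'a, 'o, 'a) monfunctor_data" where
  "id_monfunctor C = \<lparr>omap = \<lambda>X. X, amap = \<lambda>f. f,
     fmult = \<lambda>X Y. ident C (X \<boxtimes>\<^bsub>C\<^esub> Y), funit = ident C \<one>\<^bsub>C\<^esub>\<rparr>"

definition monoidal_nat_trans ::
  "('o, 'a) moncat \<Rightarrow> ('p, 'b) moncat \<Rightarrow> ('o, 'a, 'p, 'b) monfunctor_data
     \<Rightarrow> ('o, 'a, 'p, 'b) monfunctor_data \<Rightarrow> ('o \<Rightarrow> 'b) \<Rightarrow> bool" where
  "monoidal_nat_trans C D F G \<alpha> \<longleftrightarrow>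
     nat_trans C D F G \<alpha> \<and>
     (\<forall>X \<in> obj C. \<forall>Y \<in> obj C.
        \<alpha> (X \<boxtimes>\<^bsub>C\<^esub> Y) \<cdot>\<^bsub>D\<^esub> fmult F X Y = fmult G X Y \<cdot>\<^bsub>D\<^esub> (\<alpha> X \<otimes>\<^bsub>D\<^esub> \<alpha> Y)) \<and>
     \<alpha> \<one>\<^bsub>C\<^esub> \<cdot>\<^bsub>D\<^esub> funit F = funit G"


section \<open>Duals\<close>

text \<open>
  A choice of a dual, evaluation and coevaluation for every object. The same record serves for
  left duals, with \<open>ev X : dual X \<otimes> X \<rightarrow> \<one>\<close>, and right duals, with \<open>ev X : X \<otimes> dual X \<rightarrow> \<one>\<close>.
\<close>

record ('o, 'a) dual_data =
  dual :: "'o \<Rightarrow> 'o"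
  ev :: "'o \<Rightarrow> 'a"
  coev :: "'o \<Rightarrow> 'a"

definition left_duals :: "('o, 'a) moncat \<Rightarrow> ('o, 'a) dual_data \<Rightarrow> bool" where
  "left_duals C L \<longleftrightarrow> (\<forall>X \<in> obj C.
     dual L X \<in> obj C \<and>
     ev L X \<in> hom C (dual L X \<boxtimes>\<^bsub>C\<^esub> X) \<one>\<^bsub>C\<^esub> \<and>
     coev L X \<in> hom C \<one>\<^bsub>C\<^esub> (X \<boxtimes>\<^bsub>C\<^esub> dual L X) \<and>
     (ident C X \<otimes>\<^bsub>C\<^esub> ev L X) \<cdot>\<^bsub>C\<^esub> (coev L X \<otimes>\<^bsub>C\<^esub> ident C X) = ident C X \<and>
     (ev L X \<otimes>\<^bsub>C\<^esub> ident C (dual L X)) \<cdot>\<^bsub>C\<^esub> (ident C (dual L X) \<otimes>\<^bsub>C\<^esub> coev L X)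
       = ident C (dual L X))"

definition right_duals :: "('o, 'a) moncat \<Rightarrow> ('o, 'a) dual_data \<Rightarrow> bool" where
  "right_duals C R \<longleftrightarrow> (\<forall>X \<in> obj C.
     dual R X \<in> obj C \<and>
     ev R X \<in> hom C (X \<boxtimes>\<^bsub>C\<^esub> dual R X) \<one>\<^bsub>C\<^esub> \<and>
     coev R X \<in> hom C \<one>\<^bsub>C\<^esub> (dual R X \<boxtimes>\<^bsub>C\<^esub> X) \<and>
     (ev R X \<otimes>\<^bsub>C\<^esub> ident C X) \<cdot>\<^bsub>C\<^esub> (ident C X \<otimes>\<^bsub>C\<^esub> coev R X) = ident C X \<and>
     (ident C (dual R X) \<otimes>\<^bsub>C\<^esub> ev R X) \<cdot>\<^bsub>C\<^esub> (coev R X \<otimes>\<^bsub>C\<^esub> ident C (dual R X))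
       = ident C (dual R X))"

text \<open>For \<open>f : X \<rightarrow> Y\<close>, the dual arrows \<open>dual Y \<rightarrow> dual X\<close>.\<close>

definition ltr :: "('o, 'a) moncat \<Rightarrow> ('o, 'a) dual_data \<Rightarrow> 'a \<Rightarrow> 'a" where
  "ltr C L f = (let X = src C f; Y = trg C f in
     (ev L Y \<otimes>\<^bsub>C\<^esub> ident C (dual L X)) \<cdot>\<^bsub>C\<^esub>
     (ident C (dual L Y) \<otimes>\<^bsub>C\<^esub> f \<otimes>\<^bsub>C\<^esub> ident C (dual L X)) \<cdot>\<^bsub>C\<^esub>
     (ident C (dual L Y) \<otimes>\<^bsub>C\<^esub> coev L X))"

definition rtr :: "('o, 'a) moncat \<Rightarrow> ('o, 'a) dual_data \<Rightarrow> 'a \<Rightarrow> 'a" where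
  "rtr C R f = (let X = src C f; Y = trg C f in
     (ident C (dual R X) \<otimes>\<^bsub>C\<^esub> ev R Y) \<cdot>\<^bsub>C\<^esub>
     (ident C (dual R X) \<otimes>\<^bsub>C\<^esub> f \<otimes>\<^bsub>C\<^esub> ident C (dual R Y)) \<cdot>\<^bsub>C\<^esub>
     (coev R X \<otimes>\<^bsub>C\<^esub> ident C (dual R Y)))"

text \<open>
  The canonical isomorphism \<open>dual Y \<otimes> dual X \<rightarrow> dual (X \<otimes> Y)\<close> for left duals; its nullary
  companion \<open>\<one> \<rightarrow> dual \<one>\<close> is \<open>coev \<one>\<close>, since \<open>\<one> \<otimes> dual \<one> = dual \<one>\<close>.
\<close>

definition ldual_mult :: "('o, 'a) moncat \<Rightarrow> ('o, 'a) dual_data \<Rightarrow> 'o \<Rightarrow> 'o \<Rightarrow> 'a" where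
  "ldual_mult C L X Y =
     ((ev L Y \<cdot>\<^bsub>C\<^esub> (ident C (dual L Y) \<otimes>\<^bsub>C\<^esub> ev L X \<otimes>\<^bsub>C\<^esub> ident C Y))
        \<otimes>\<^bsub>C\<^esub> ident C (dual L (X \<boxtimes>\<^bsub>C\<^esub> Y))) \<cdot>\<^bsub>C\<^esub>
     (ident C (dual L Y \<boxtimes>\<^bsub>C\<^esub> dual L X) \<otimes>\<^bsub>C\<^esub> coev L (X \<boxtimes>\<^bsub>C\<^esub> Y))"

text \<open>
  The left dual functor is contravariant, so the structure maps of the double dual functor are
  those of the left dual functor followed by the duals of their inverses.
\<close>

definition double_dual :: "('o, 'a) moncat \<Rightarrow> ('o, 'a) dual_data \<Rightarrow> ('o, 'a, 'o, 'a) monfunctor_data" where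
  "double_dual C L = \<lparr>omap = \<lambda>X. dual L (dual L X), amap = \<lambda>f. ltr C L (ltr C L f),
     fmult = \<lambda>X Y. ltr C L (inv_arr C (ldual_mult C L X Y)) \<cdot>\<^bsub>C\<^esub> ldual_mult C L (dual L Y) (dual L X),
     funit = ltr C L (inv_arr C (coev L \<one>\<^bsub>C\<^esub>)) \<cdot>\<^bsub>C\<^esub> coev L \<one>\<^bsub>C\<^esub>\<rparr>"

text \<open>
  Canonical isomorphism \<open>dual L X \<rightarrow> dual L' X\<close> between two left duals of \<open>X\<close>, and the induced
  identification \<open>dual L (dual L X) \<rightarrow> dual L (dual L' X) \<rightarrow> dual L' (dual L' X)\<close> of double duals.
  Its first step is the dual of the canonical \<open>dual L' X \<rightarrow> dual L X\<close>.
\<close>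

definition dual_comparison ::
  "('o, 'a) moncat \<Rightarrow> ('o, 'a) dual_data \<Rightarrow> ('o, 'a) dual_data \<Rightarrow> 'o \<Rightarrow> 'a" where
  "dual_comparison C L L' X =
     (ev L X \<otimes>\<^bsub>C\<^esub> ident C (dual L' X)) \<cdot>\<^bsub>C\<^esub> (ident C (dual L X) \<otimes>\<^bsub>C\<^esub> coev L' X)"

definition double_dual_comparison ::
  "('o, 'a) moncat \<Rightarrow> ('o, 'a) dual_data \<Rightarrow> ('o, 'a) dual_data \<Rightarrow> 'o \<Rightarrow> 'a" where
  "double_dual_comparison C L L' X =
     dual_comparison C L L' (dual L' X) \<cdot>\<^bsub>C\<^esub> ltr C L (dual_comparison C L' L X)"


section \<open>Sovereign structures\<close>

definition sovereign_structures ::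
  "('o, 'a) moncat \<Rightarrow> (('o, 'a) dual_data \<times> ('o \<Rightarrow> 'a)) set" where
  "sovereign_structures C =
     {(L, \<phi>). left_duals C L \<and> monoidal_nat_trans C C (id_monfunctor C) (double_dual C L) \<phi>}"

definition sovereign_equiv ::
  "('o, 'a) moncat
     \<Rightarrow> ((('o, 'a) dual_data \<times> ('o \<Rightarrow> 'a)) \<times> (('o, 'a) dual_data \<times> ('o \<Rightarrow> 'a))) set" where
  "sovereign_equiv C =
     {((L, \<phi>), (L', \<phi>')). (L, \<phi>) \<in> sovereign_structures C \<and> (L', \<phi>') \<in> sovereign_structures C \<and>
        (\<forall>X \<in> obj C. \<phi>' X = double_dual_comparison C L L' X \<cdot>\<^bsub>C\<^esub> \<phi> X)}"

text \<open>
  Left autonomy is part of the next locale: a class in the quotient is nonempty, and each of its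
  members contains a choice of left duals.
\<close>

locale sovereign_category = strict_monoidal_category C
  for C :: "('o, 'a) moncat" (structure)
    and \<Sigma> :: "(('o, 'a) dual_data \<times> ('o \<Rightarrow> 'a)) set" +
  assumes sovereign_class: "\<Sigma> \<in> sovereign_structures C // sovereign_equiv C"


section \<open>Hopf monads\<close>

record ('o, 'a) bimonad_data = "('o, 'a, 'o, 'a) functor_data" +
  mu :: "'o \<Rightarrow> 'a"
  eta :: "'o \<Rightarrow> 'a"
  T2 :: "'o \<Rightarrow> 'o \<Rightarrow> 'a"
  T0 :: "'a"

definition is_monad :: "('o, 'a) moncat \<Rightarrow> ('o, 'a) bimonad_data \<Rightarrow> bool" where
  "is_monad C T \<longleftrightarrow>
     is_functor C C T \<and>
     nat_trans C C (comp_functor T T) T (mu T) \<and>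
     nat_trans C C id_functor T (eta T) \<and>
     (\<forall>X \<in> obj C. mu T X \<cdot>\<^bsub>C\<^esub> amap T (mu T X) = mu T X \<cdot>\<^bsub>C\<^esub> mu T (omap T X)) \<and>
     (\<forall>X \<in> obj C. mu T X \<cdot>\<^bsub>C\<^esub> eta T (omap T X) = ident C (omap T X)) \<and>
     (\<forall>X \<in> obj C. mu T X \<cdot>\<^bsub>C\<^esub> amap T (eta T X) = ident C (omap T X))"

locale bimonad = strict_monoidal_category C
  for C :: "('o, 'a) moncat" (structure) and T :: "('o, 'a) bimonad_data" +
  assumes monad: "is_monad C T"
    and T2_hom: "\<lbrakk>X \<in> obj C; Y \<in> obj C\<rbrakk>
      \<Longrightarrow> T2 T X Y \<in> hom C (omap T (X \<boxtimes> Y)) (omap T X \<boxtimes> omap T Y)"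
    and T2_natural: "\<lbrakk>f \<in> hom C X X'; g \<in> hom C Y Y'\<rbrakk>
      \<Longrightarrow> T2 T X' Y' \<cdot> amap T (f \<otimes> g) = (amap T f \<otimes> amap T g) \<cdot> T2 T X Y"
    and T0_hom: "T0 T \<in> hom C (omap T \<one>) \<one>"
    and T2_coassoc: "\<lbrakk>X \<in> obj C; Y \<in> obj C; Z \<in> obj C\<rbrakk>
      \<Longrightarrow> (ident C (omap T X) \<otimes> T2 T Y Z) \<cdot> T2 T X (Y \<boxtimes> Z)
        = (T2 T X Y \<otimes> ident C (omap T Z)) \<cdot> T2 T (X \<boxtimes> Y) Z"
    and T2_counit_right: "X \<in> obj C
      \<Longrightarrow> (ident C (omap T X) \<otimes> T0 T) \<cdot> T2 T X \<one> = ident C (omap T X)"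
    and T2_counit_left: "X \<in> obj C
      \<Longrightarrow> (T0 T \<otimes> ident C (omap T X)) \<cdot> T2 T \<one> X = ident C (omap T X)"
    and T2_mu: "\<lbrakk>X \<in> obj C; Y \<in> obj C\<rbrakk>
      \<Longrightarrow> T2 T X Y \<cdot> mu T (X \<boxtimes> Y)
        = (mu T X \<otimes> mu T Y) \<cdot> T2 T (omap T X) (omap T Y) \<cdot> amap T (T2 T X Y)"
    and T0_mu: "T0 T \<cdot> mu T \<one> = T0 T \<cdot> amap T (T0 T)"
    and T2_eta: "\<lbrakk>X \<in> obj C; Y \<in> obj C\<rbrakk> \<Longrightarrow> T2 T X Y \<cdot> eta T (X \<boxtimes> Y) = eta T X \<otimes> eta T Y"
    and T0_eta: "T0 T \<cdot> eta T \<one> = ident C \<one>"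

text \<open>Functoriality of an antipode in \<open>X\<close> is contravariant.\<close>

definition left_antipode ::
  "('o, 'a) moncat \<Rightarrow> ('o, 'a) dual_data \<Rightarrow> ('o, 'a) bimonad_data \<Rightarrow> ('o \<Rightarrow> 'a) \<Rightarrow> bool" where
  "left_antipode C L T s \<longleftrightarrow>
     (\<forall>X \<in> obj C. s X \<in> hom C (omap T (dual L (omap T X))) (dual L X)) \<and>
     (\<forall>X Y. \<forall>f \<in> hom C X Y.
        s X \<cdot>\<^bsub>C\<^esub> amap T (ltr C L (amap T f)) = ltr C L f \<cdot>\<^bsub>C\<^esub> s Y) \<and>
     (\<forall>X \<in> obj C.
        T0 T \<cdot>\<^bsub>C\<^esub> amap T (ev L X) \<cdot>\<^bsub>C\<^esub> amap T (ltr C L (eta T X) \<otimes>\<^bsub>C\<^esub> ident C X)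
        = ev L (omap T X) \<cdot>\<^bsub>C\<^esub>
          ((s (omap T X) \<cdot>\<^bsub>C\<^esub> amap T (ltr C L (mu T X))) \<otimes>\<^bsub>C\<^esub> ident C (omap T X)) \<cdot>\<^bsub>C\<^esub>
          T2 T (dual L (omap T X)) X) \<and>
     (\<forall>X \<in> obj C.
        (eta T X \<otimes>\<^bsub>C\<^esub> ident C (dual L X)) \<cdot>\<^bsub>C\<^esub> coev L X \<cdot>\<^bsub>C\<^esub> T0 T
        = (mu T X \<otimes>\<^bsub>C\<^esub> s X) \<cdot>\<^bsub>C\<^esub> T2 T (omap T X) (dual L (omap T X)) \<cdot>\<^bsub>C\<^esub>
          amap T (coev L (omap T X)))"

definition right_antipode ::
  "('o, 'a) moncat \<Rightarrow> ('o, 'a) dual_data \<Rightarrow> ('o, 'a) bimonad_data \<Rightarrow> ('o \<Rightarrow> 'a) \<Rightarrow> bool" where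
  "right_antipode C R T s \<longleftrightarrow>
     (\<forall>X \<in> obj C. s X \<in> hom C (omap T (dual R (omap T X))) (dual R X)) \<and>
     (\<forall>X Y. \<forall>f \<in> hom C X Y.
        s X \<cdot>\<^bsub>C\<^esub> amap T (rtr C R (amap T f)) = rtr C R f \<cdot>\<^bsub>C\<^esub> s Y) \<and>
     (\<forall>X \<in> obj C.
        T0 T \<cdot>\<^bsub>C\<^esub> amap T (ev R X) \<cdot>\<^bsub>C\<^esub> amap T (ident C X \<otimes>\<^bsub>C\<^esub> rtr C R (eta T X))
        = ev R (omap T X) \<cdot>\<^bsub>C\<^esub>
          (ident C (omap T X) \<otimes>\<^bsub>C\<^esub> (s (omap T X) \<cdot>\<^bsub>C\<^esub> amap T (rtr C R (mu T X)))) \<cdot>\<^bsub>C\<^esub>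
          T2 T X (dual R (omap T X))) \<and>
     (\<forall>X \<in> obj C.
        (ident C (dual R X) \<otimes>\<^bsub>C\<^esub> eta T X) \<cdot>\<^bsub>C\<^esub> coev R X \<cdot>\<^bsub>C\<^esub> T0 T
        = (s X \<otimes>\<^bsub>C\<^esub> mu T X) \<cdot>\<^bsub>C\<^esub> T2 T (dual R (omap T X)) (omap T X) \<cdot>\<^bsub>C\<^esub>
          amap T (coev R (omap T X)))"

text \<open>
  The antipodes are taken with respect to chosen left and right duals \<open>L\<close> and \<open>R\<close>. They are listed
  as parameters because the square of the antipode refers to \<open>sl\<close>; this adds no structure, since
  antipodes are unique when they exist.
\<close>

locale hopf_monad = bimonad C T
  for C :: "('o, 'a) moncat" (structure)
    and L :: "('o, 'a) dual_data" and R :: "('o, 'a) dual_data"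
    and T :: "('o, 'a) bimonad_data" and sl :: "'o \<Rightarrow> 'a" and sr :: "'o \<Rightarrow> 'a" +
  assumes left_duals: "left_duals C L"
    and right_duals: "right_duals C R"
    and left_antipode: "left_antipode C L T sl"
    and right_antipode: "right_antipode C R T sr"


section \<open>The category of modules\<close>

definition modules :: "('o, 'a) moncat \<Rightarrow> ('o, 'a) bimonad_data \<Rightarrow> ('o \<times> 'a) set" where
  "modules C T = {(M, r). M \<in> obj C \<and> r \<in> hom C (omap T M) M \<and>
     r \<cdot>\<^bsub>C\<^esub> amap T r = r \<cdot>\<^bsub>C\<^esub> mu T M \<and> r \<cdot>\<^bsub>C\<^esub> eta T M = ident C M}"

definition module_arrows ::
  "('o, 'a) moncat \<Rightarrow> ('o, 'a) bimonad_data \<Rightarrow> (('o \<times> 'a) \<times> 'a \<times> ('o \<times> 'a)) set" where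
  "module_arrows C T = {((M, r), f, (N, s)). (M, r) \<in> modules C T \<and> (N, s) \<in> modules C T \<and>
     f \<in> hom C M N \<and> f \<cdot>\<^bsub>C\<^esub> r = s \<cdot>\<^bsub>C\<^esub> amap T f}"

text \<open>A module morphism is stored together with its source and target modules.\<close>

definition module_category ::
  "('o, 'a) moncat \<Rightarrow> ('o, 'a) bimonad_data
     \<Rightarrow> ('o \<times> 'a, ('o \<times> 'a) \<times> 'a \<times> ('o \<times> 'a)) moncat" where
  "module_category C T = (let ten = (\<lambda>(M, r) (N, s). (M \<boxtimes>\<^bsub>C\<^esub> N, (r \<otimes>\<^bsub>C\<^esub> s) \<cdot>\<^bsub>C\<^esub> T2 T M N)) in
   \<lparr>obj = modules C T,
    arr = module_arrows C T,
    src = (\<lambda>(m, f, n). m),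
    trg = (\<lambda>(m, f, n). n),
    ident = (\<lambda>m. (m, ident C (fst m), m)),
    cmp = (\<lambda>(n', g, p) (m, f, n). (m, g \<cdot>\<^bsub>C\<^esub> f, p)),
    tenso = ten,
    tensa = (\<lambda>(m, f, n) (m', f', n'). (ten m m', f \<otimes>\<^bsub>C\<^esub> f', ten n n')),
    munit = (\<one>\<^bsub>C\<^esub>, T0 T)\<rparr>)"


section \<open>Sovereign elements\<close>

definition conv ::
  "('o, 'a) moncat \<Rightarrow> ('o, 'a) bimonad_data \<Rightarrow> ('o \<Rightarrow> 'a) \<Rightarrow> ('o \<Rightarrow> 'a) \<Rightarrow> 'o \<Rightarrow> 'a" where
  "conv C T a b = (\<lambda>X \<in> obj C. mu T X \<cdot>\<^bsub>C\<^esub> a (omap T X) \<cdot>\<^bsub>C\<^esub> b X)"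

definition conv_inv ::
  "('o, 'a) moncat \<Rightarrow> ('o, 'a) bimonad_data \<Rightarrow> ('o \<Rightarrow> 'a) \<Rightarrow> 'o \<Rightarrow> 'a" where
  "conv_inv C T a = (THE b. nat_trans C C id_functor T b \<and>
     conv C T a b = eta T \<and> conv C T b a = eta T)"

definition left_mult ::
  "('o, 'a) moncat \<Rightarrow> ('o, 'a) bimonad_data \<Rightarrow> ('o \<Rightarrow> 'a) \<Rightarrow> 'o \<Rightarrow> 'a" where
  "left_mult C T a = (\<lambda>X \<in> obj C. mu T X \<cdot>\<^bsub>C\<^esub> a (omap T X))"

definition right_mult ::
  "('o, 'a) moncat \<Rightarrow> ('o, 'a) bimonad_data \<Rightarrow> ('o \<Rightarrow> 'a) \<Rightarrow> 'o \<Rightarrow> 'a" where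
  "right_mult C T a = (\<lambda>X \<in> obj C. mu T X \<cdot>\<^bsub>C\<^esub> amap T (a X))"

definition ad ::
  "('o, 'a) moncat \<Rightarrow> ('o, 'a) bimonad_data \<Rightarrow> ('o \<Rightarrow> 'a) \<Rightarrow> 'o \<Rightarrow> 'a" where
  "ad C T a = (\<lambda>X \<in> obj C. left_mult C T a X \<cdot>\<^bsub>C\<^esub> right_mult C T (conv_inv C T a) X)"

definition antipode_square ::
  "('o, 'a) moncat \<Rightarrow> ('o, 'a) dual_data \<Rightarrow> ('o \<Rightarrow> 'a) \<Rightarrow> ('o, 'a) bimonad_data
     \<Rightarrow> ('o \<Rightarrow> 'a) \<Rightarrow> 'o \<Rightarrow> 'a" where
  "antipode_square C L \<phi> T sl = (\<lambda>X \<in> obj C.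
     inv_arr C (\<phi> (omap T X)) \<cdot>\<^bsub>C\<^esub> sl (dual L (omap T X)) \<cdot>\<^bsub>C\<^esub>
     amap T (ltr C L (sl X)) \<cdot>\<^bsub>C\<^esub> amap T (\<phi> X))"

definition grouplike_elements ::
  "('o, 'a) moncat \<Rightarrow> ('o, 'a) bimonad_data \<Rightarrow> ('o \<Rightarrow> 'a) set" where
  "grouplike_elements C T = {g. nat_trans C C id_functor T g \<and>
     (\<forall>X \<in> obj C. \<forall>Y \<in> obj C. T2 T X Y \<cdot>\<^bsub>C\<^esub> g (X \<boxtimes>\<^bsub>C\<^esub> Y) = g X \<otimes>\<^bsub>C\<^esub> g Y) \<and>
     T0 T \<cdot>\<^bsub>C\<^esub> g \<one>\<^bsub>C\<^esub> = ident C \<one>\<^bsub>C\<^esub>}"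

definition sovereign_elements ::
  "('o, 'a) moncat \<Rightarrow> ('o, 'a) dual_data \<Rightarrow> ('o \<Rightarrow> 'a) \<Rightarrow> ('o, 'a) bimonad_data
     \<Rightarrow> ('o \<Rightarrow> 'a) \<Rightarrow> ('o \<Rightarrow> 'a) set" where
  "sovereign_elements C L \<phi> T sl =
     {G \<in> grouplike_elements C T. antipode_square C L \<phi> T sl = ad C T G}"

end

theory Submission
  imports Defs
begin

text \<open>
  The double dual of a \<open>T\<close>-module has underlying object the double dual of the underlying object, so
  composing a sovereign structure of \<open>T\<close>-modules with the inverse of \<open>\<phi>\<close> yields a monoidal
  endomorphism of the forgetful functor. By the universal property of free modules, such
  endomorphisms are of the form \<open>r \<cdot> g M\<close> on a module \<open>(M, r)\<close>, for a unique grouplike element \<open>g\<close>.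
  The action of \<open>T\<close> on double duals is given by the square of the antipode, whence the arrows
  \<open>\<phi> M \<cdot> r \<cdot> g M\<close> are \<open>T\<close>-linear precisely when \<open>S\<^sup>2 = ad g\<close>. Finally, every equivalence class of
  sovereign structures has exactly one representative on any fixed choice of duals.
\<close>

section \<open>Calculus in strict monoidal categories\<close>

text \<open>Two inverses enter only through definite descriptions: \<open>inv_arr\<close> of
  \<open>\<phi>\<close> inside the square of the antipode, and \<open>conv_inv\<close> of
  \<open>g\<close> inside \<open>ad\<close>. Neither is assumed to exist. Both come from duality: a
  monoidal transformation is inverted at an object by its component at the dual object. For
  \<open>\<phi>\<close> this rests on naturality at evaluations and coevaluations; for
  \<open>g\<close> it rests on the action of \<open>g\<close> on dual modules. Dual modules are the
  other obstacle. The antipode axioms make evaluation and coevaluation linear, but associativity of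
  the dual action is not among them. It follows from a uniqueness argument for the comonoidal
  functor \<open>T \<circ> T\<close>: of two candidates for the dual action, one is compatible with
  evaluation and the other with coevaluation, and such arrows agree. The link between linearity and
  \<open>ad\<close> is conjugation: linearity reads g x = S^2(x) g in terms of left and right
  multiplication on free modules, while ad sends x to g x g^-1.\<close>

context category begin

lemma in_hom: "f \<in> hom C X Y \<longleftrightarrow> f \<in> arr C \<and> src C f = X \<and> trg C f = Y"
  by (simp add: hom_def)

lemma homI: "f \<in> arr C \<Longrightarrow> src C f = X \<Longrightarrow> trg C f = Y \<Longrightarrow> f \<in> hom C X Y"
  by (simp add: hom_def)

lemma obj_src_trg [simp]: "f \<in> arr C \<Longrightarrow> src C f \<in> obj C" "f \<in> arr C \<Longrightarrow> trg C f \<in> obj C"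
  by (auto intro: src_obj trg_obj)

lemma ident_arr [simp]:
  assumes "X \<in> obj C"
  shows "ident C X \<in> arr C" "src C (ident C X) = X" "trg C (ident C X) = X"
  using ident_hom[OF assms] by (auto simp: hom_def)

lemma cmp_arr [simp]:
  assumes "f \<in> arr C" "g \<in> arr C" "src C g = trg C f"
  shows "g \<cdot> f \<in> arr C" "src C (g \<cdot> f) = src C f" "trg C (g \<cdot> f) = trg C g"
  using cmp_hom[of f "src C f" "trg C f" g "trg C g"] assms by (auto simp: hom_def)

lemma cmp_assoc' [simp]:
  assumes "f \<in> arr C" "g \<in> arr C" "h \<in> arr C" "src C g = trg C f" "src C h = trg C g"
  shows "(h \<cdot> g) \<cdot> f = h \<cdot> (g \<cdot> f)"
  using cmp_assoc[of f "src C f" "trg C f" g "trg C g" h "trg C h"] assms by (auto simp: hom_def)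

lemma ident_cmp [simp]:
  assumes "f \<in> arr C"
  shows "src C f = X \<Longrightarrow> f \<cdot> ident C X = f" "trg C f = X \<Longrightarrow> ident C X \<cdot> f = f"
  using ident_right[of f] ident_left[of f] assms by (auto simp: hom_def)

lemma inv_arr_eqI:
  assumes f: "f \<in> arr C" and g: "g \<in> arr C" "src C g = trg C f" "trg C g = src C f"
    and "g \<cdot> f = ident C (src C f)" "f \<cdot> g = ident C (trg C f)"
  shows "inv_arr C f = g"
  unfolding inv_arr_def
proof (rule the_equality)
  show "g \<in> hom C (trg C f) (src C f) \<and> g \<cdot> f = ident C (src C f) \<and> f \<cdot> g = ident C (trg C f)"
    using assms by (simp add: hom_def)
next
  fix h
  assume h: "h \<in> hom C (trg C f) (src C f) \<and> h \<cdot> f = ident C (src C f) \<and> f \<cdot> h = ident C (trg C f)"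
  then have "h \<in> arr C" "src C h = trg C f" "trg C h = src C f" by (auto simp: hom_def)
  then have "(h \<cdot> f) \<cdot> g = h \<cdot> (f \<cdot> g)" using f g by (intro cmp_assoc') simp_all
  moreover have "(h \<cdot> f) \<cdot> g = g" "h \<cdot> (f \<cdot> g) = h"
    using \<open>h \<in> arr C\<close> \<open>src C h = trg C f\<close> h assms by simp_all
  ultimately show "h = g" by simp
qed

end

context strict_monoidal_category begin

declare munit_obj [simp] tenso_obj [simp] tenso_assoc [simp] tensa_assoc [simp]
  tenso_unit_left [simp] tenso_unit_right [simp] tensa_unit_left [simp] tensa_unit_right [simp]

lemma tensa_arr [simp]:
  assumes "f \<in> arr C" "g \<in> arr C"
  shows "f \<otimes> g \<in> arr C" "src C (f \<otimes> g) = src C f \<boxtimes> src C g" "trg C (f \<otimes> g) = trg C f \<boxtimes> trg C g"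
  using tensa_hom[of f "src C f" "trg C f" g "src C g" "trg C g"] assms by (auto simp: hom_def)

text \<open>As a simp rule this splits identities so that interchange can act on each tensor factor.
  The identity laws are then restated for split identities in \<open>ident2_cmp\<close> and
  \<open>ident3_cmp\<close>.\<close>

lemma ident_tenso [simp]:
  "X \<in> obj C \<Longrightarrow> Y \<in> obj C \<Longrightarrow> ident C (X \<boxtimes> Y) = ident C X \<otimes> ident C Y"
  by (simp add: tensa_ident)

lemma fuse:
  assumes "f \<in> arr C" "f' \<in> arr C" "g \<in> arr C" "g' \<in> arr C" "src C f' = trg C f"
      "src C g' = trg C g"
  shows "(f' \<otimes> g') \<cdot> (f \<otimes> g) = (f' \<cdot> f) \<otimes> (g' \<cdot> g)"
  using interchange[of f "src C f" "trg C f" f' "trg C f'" g "src C g" "trg C g" g'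
      "trg C g'"] assms
  by (simp add: hom_def)

text \<open>Composites are kept nested to the right, so interchange must also apply when a further
  arrow \<open>h\<close> comes first.\<close>

lemma fuse_assoc:
  assumes "f \<in> arr C" "f' \<in> arr C" "g \<in> arr C" "g' \<in> arr C" "src C f' = trg C f"
      "src C g' = trg C g"
    "h \<in> arr C" "trg C h = src C f \<boxtimes> src C g"
  shows "(f' \<otimes> g') \<cdot> (f \<otimes> g) \<cdot> h = ((f' \<cdot> f) \<otimes> (g' \<cdot> g)) \<cdot> h"
  using assms by (simp flip: fuse cmp_assoc')

lemmas fuses = fuse fuse_assoc

lemma ident2_cmp [simp]:
  assumes "f \<in> arr C" "X \<in> obj C" "Y \<in> obj C"
  shows "src C f = X \<boxtimes> Y \<Longrightarrow> f \<cdot> (ident C X \<otimes> ident C Y) = f"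
    "trg C f = X \<boxtimes> Y \<Longrightarrow> (ident C X \<otimes> ident C Y) \<cdot> f = f"
  using assms by (simp_all flip: ident_tenso)

lemma ident3_cmp [simp]:
  assumes "f \<in> arr C" "X \<in> obj C" "Y \<in> obj C" "Z \<in> obj C"
  shows "src C f = X \<boxtimes> Y \<boxtimes> Z \<Longrightarrow> f \<cdot> (ident C X \<otimes> ident C Y \<otimes> ident C Z) = f"
    "trg C f = X \<boxtimes> Y \<boxtimes> Z \<Longrightarrow> (ident C X \<otimes> ident C Y \<otimes> ident C Z) \<cdot> f = f"
  using assms by (simp_all flip: ident_tenso)

text \<open>Strictness identifies \<open>f \<otimes> ident C \<one>\<close> with \<open>f\<close>,
  so an arrow into the unit can be split off from a tensor product.\<close>

lemma scalar_slide:
  assumes "f \<in> arr C" "g \<in> arr C" "trg C g = \<one>"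
  shows "f \<cdot> (ident C (src C f) \<otimes> g) = f \<otimes> g" "f \<cdot> (g \<otimes> ident C (src C f)) = g \<otimes> f"
  using fuse[of "ident C (src C f)" f g "ident C \<one>"] fuse[of g "ident C \<one>"
      "ident C (src C f)" f] assms
  by simp_all

lemma coscalar_slide:
  assumes "f \<in> arr C" "g \<in> arr C" "src C g = \<one>"
  shows "(ident C (trg C f) \<otimes> g) \<cdot> f = f \<otimes> g" "(g \<otimes> ident C (trg C f)) \<cdot> f = g \<otimes> f"
  using fuse[of f "ident C (trg C f)" "ident C \<one>" g] fuse[of "ident C \<one>" g f
      "ident C (trg C f)"] assms
  by simp_all

end

section \<open>Left duals: mates, transposes, and duals of tensor products\<close>

locale left_autonomous_category = strict_monoidal_category +
  fixes L :: "('o, 'a) dual_data"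
  assumes duals: "left_duals C L"
begin

lemma dual_simps [simp]:
  assumes "X \<in> obj C"
  shows "dual L X \<in> obj C"
    "ev L X \<in> arr C" "src C (ev L X) = dual L X \<boxtimes> X" "trg C (ev L X) = \<one>"
    "coev L X \<in> arr C" "src C (coev L X) = \<one>" "trg C (coev L X) = X \<boxtimes> dual L X"
    "(ident C X \<otimes> ev L X) \<cdot> (coev L X \<otimes> ident C X) = ident C X"
    "(ev L X \<otimes> ident C (dual L X)) \<cdot> (ident C (dual L X) \<otimes> coev L X) = ident C (dual L X)"
  using duals assms by (auto simp: left_duals_def hom_def)

text \<open>The two directions of the bijection \<open>hom (Z \<boxtimes> W) A \<cong> hom Z (A \<boxtimes> dual W)\<close>.\<close>

definition mate :: "'o \<Rightarrow> 'o \<Rightarrow> 'a \<Rightarrow> 'a" where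
  "mate Z W h = (h \<otimes> ident C (dual L W)) \<cdot> (ident C Z \<otimes> coev L W)"

definition unmate :: "'o \<Rightarrow> 'o \<Rightarrow> 'a \<Rightarrow> 'a" where
  "unmate A W f = (ident C A \<otimes> ev L W) \<cdot> (f \<otimes> ident C W)"

lemma mate_arr [simp]:
  assumes "Z \<in> obj C" "W \<in> obj C" "h \<in> arr C" "src C h = Z \<boxtimes> W"
  shows "mate Z W h \<in> arr C" "src C (mate Z W h) = Z" "trg C (mate Z W h) = trg C h \<boxtimes> dual L W"
  using assms by (simp_all add: mate_def)

text \<open>The evaluation slides past \<open>h\<close>, and the zigzag identity of \<open>W\<close>
  remains. In \<open>mate_unmate\<close> the coevaluation slides past \<open>f\<close>, and the
  zigzag identity of \<open>dual L W\<close> remains.\<close>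

lemma unmate_mate [simp]:
  assumes "Z \<in> obj C" "W \<in> obj C" "h \<in> arr C" "src C h = Z \<boxtimes> W" "trg C h = A"
  shows "unmate A W (mate Z W h) = h"
proof -
  have [simp]: "A \<in> obj C" using assms by auto
  have "mate Z W h \<otimes> ident C W
      = (h \<otimes> ident C (dual L W) \<otimes> ident C W) \<cdot> (ident C Z \<otimes> coev L W \<otimes> ident C W)"
    using fuse[of "ident C Z \<otimes> coev L W" "h \<otimes> ident C (dual L W)" "ident C W" "ident C W"] assms
    by (simp add: mate_def)
  then have "unmate A W (mate Z W h)
     = ((ident C A \<otimes> ev L W) \<cdot> (h \<otimes> ident C (dual L W) \<otimes> ident C W)) \<cdot> (ident C Z \<otimes> coev L W \<otimes>
         ident C W)"
    using assms by (simp add: unmate_def)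
  also have "(ident C A \<otimes> ev L W) \<cdot> (h \<otimes> ident C (dual L W) \<otimes> ident C W) = h \<otimes> ev L W"
    using fuse[of h "ident C A" "ident C (dual L W) \<otimes> ident C W" "ev L W"] assms by simp
  also have "\<dots> = h \<cdot> (ident C Z \<otimes> ident C W \<otimes> ev L W)"
    using scalar_slide(1)[of h "ev L W"] assms by simp
  finally show ?thesis using assms by (simp add: fuses)
qed

lemma mate_unmate [simp]:
  assumes "A \<in> obj C" "W \<in> obj C" "f \<in> arr C" "src C f = Z" "trg C f = A \<boxtimes> dual L W"
  shows "mate Z W (unmate A W f) = f"
proof -
  have [simp]: "Z \<in> obj C" using assms by auto
  have "unmate A W f \<otimes> ident C (dual L W)
      = (ident C A \<otimes> ev L W \<otimes> ident C (dual L W)) \<cdot> (f \<otimes> ident C W \<otimes> ident C (dual L W))"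
    using fuse[of "f \<otimes> ident C W" "ident C A \<otimes> ev L W" "ident C (dual L W)"
        "ident C (dual L W)"] assms
    by (simp add: unmate_def)
  then have "mate Z W (unmate A W f)
     = (ident C A \<otimes> ev L W \<otimes> ident C (dual L W)) \<cdot> ((f \<otimes> ident C W \<otimes> ident C (dual L W)) \<cdot>
         (ident C Z \<otimes> coev L W))"
    using assms by (simp add: mate_def)
  also have "(f \<otimes> ident C W \<otimes> ident C (dual L W)) \<cdot> (ident C Z \<otimes> coev L W) = f \<otimes> coev L W"
    using fuse[of "ident C Z" f "coev L W" "ident C W \<otimes> ident C (dual L W)"] assms by simp
  also have "\<dots> = (ident C A \<otimes> ident C (dual L W) \<otimes> coev L W) \<cdot> f"
    using coscalar_slide(1)[of f "coev L W"] assms by simp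
  finally show ?thesis using assms by (simp add: fuses)
qed

lemma unmate_arr [simp]:
  assumes "A \<in> obj C" "W \<in> obj C" "f \<in> arr C" "trg C f = A \<boxtimes> dual L W"
  shows "unmate A W f \<in> arr C" "src C (unmate A W f) = src C f \<boxtimes> W" "trg C (unmate A W f) = A"
  using assms by (simp_all add: unmate_def)

lemma unmate_inj:
  assumes "A \<in> obj C" "W \<in> obj C"
    and "f \<in> arr C" "trg C f = A \<boxtimes> dual L W" "g \<in> arr C" "trg C g = A \<boxtimes> dual L W"
        "src C f = src C g"
    and "unmate A W f = unmate A W g"
  shows "f = g"
proof -
  have "f = mate (src C f) W (unmate A W f)" using assms(1-4) by simp
  also have "\<dots> = mate (src C g) W (unmate A W g)" by (simp only: assms(7,8))
  also have "\<dots> = g" using assms(1,2,5,6) by simp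
  finally show ?thesis .
qed

text \<open>The case of the unit in \<open>unmate_inj\<close>, and the main proof principle from
  here on: arrows into a dual are compared after pairing them with \<open>W\<close>.\<close>

lemma ev_inj:
  assumes "W \<in> obj C" "f \<in> arr C" "g \<in> arr C" "trg C f = dual L W" "trg C g = dual L W"
      "src C f = src C g"
    and "ev L W \<cdot> (f \<otimes> ident C W) = ev L W \<cdot> (g \<otimes> ident C W)"
  shows "f = g"
  using unmate_inj[of \<one> W f g] assms by (simp add: unmate_def)

lemma ev_mate [simp]:
  assumes "Z \<in> obj C" "W \<in> obj C" "h \<in> arr C" "src C h = Z \<boxtimes> W" "trg C h = \<one>"
  shows "ev L W \<cdot> (mate Z W h \<otimes> ident C W) = h"
  using unmate_mate[of Z W h \<one>] assms by (simp add: unmate_def)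

text \<open>Recasting the zigzag formula as a mate yields the characterization
  \<open>ev_ltr\<close>, from which functoriality of the transpose follows by evaluation.\<close>

lemma ltr_eq_mate:
  assumes "f \<in> arr C"
  shows "ltr C L f = mate (dual L (trg C f)) (src C f) (ev L (trg C f)
      \<cdot> (ident C (dual L (trg C f)) \<otimes> f))"
  using assms
    fuse_assoc[of "ident C (dual L (trg C f)) \<otimes> f" "ev L (trg C f)" "ident C (dual L (src C f))"
        "ident C (dual L (src C f))"
      "ident C (dual L (trg C f)) \<otimes> coev L (src C f)"]
  by (simp add: ltr_def mate_def Let_def)

lemma ltr_arr [simp]:
  assumes "f \<in> arr C"
  shows "ltr C L f \<in> arr C" "src C (ltr C L f) = dual L (trg C f)" "trg C (ltr C L f)
      = dual L (src C f)"
  using assms by (simp_all add: ltr_eq_mate)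

lemma ev_ltr:
  assumes "f \<in> arr C" "src C f = X"
  shows "ev L X \<cdot> (ltr C L f \<otimes> ident C X) = ev L (trg C f) \<cdot> (ident C (dual L (trg C f)) \<otimes> f)"
  using assms by (auto simp: ltr_eq_mate)

lemma ev_ltr_cmp:
  assumes "f \<in> arr C" "src C f = X" "k \<in> arr C" "trg C k = dual L (trg C f)"
  shows "ev L X \<cdot> ((ltr C L f \<cdot> k) \<otimes> ident C X) = ev L (trg C f) \<cdot> (k \<otimes> f)"
proof -
  have [simp]: "X \<in> obj C" using assms by auto
  have "(ltr C L f \<cdot> k) \<otimes> ident C X = (ltr C L f \<otimes> ident C X) \<cdot> (k \<otimes> ident C X)"
    using assms by (simp add: fuse)
  then have "ev L X \<cdot> ((ltr C L f \<cdot> k) \<otimes> ident C X) = (ev L X \<cdot> (ltr C L f \<otimes> ident C X))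
      \<cdot> (k \<otimes> ident C X)"
    using assms by simp
  also have "\<dots> = ev L (trg C f) \<cdot> (k \<otimes> f)"
    using assms by (simp add: ev_ltr fuse)
  finally show ?thesis .
qed

lemma ltr_ident [simp]: "X \<in> obj C \<Longrightarrow> ltr C L (ident C X) = ident C (dual L X)"
  by (rule ev_inj[of X]) (simp_all add: ev_ltr)

lemma ltr_cmp:
  assumes "f \<in> arr C" "g \<in> arr C" "src C g = trg C f"
  shows "ltr C L (g \<cdot> f) = ltr C L f \<cdot> ltr C L g"
proof (rule ev_inj[of "src C f"])
  have "ev L (trg C f) \<cdot> (ltr C L g \<otimes> f) = (ev L (trg C f) \<cdot> (ltr C L g \<otimes> ident C (trg C f)))
      \<cdot> (ident C (dual L (trg C g)) \<otimes> f)"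
    using assms by (simp add: fuse)
  then show "ev L (src C f) \<cdot> (ltr C L (g \<cdot> f) \<otimes> ident C (src C f))
      = ev L (src C f) \<cdot> ((ltr C L f \<cdot> ltr C L g) \<otimes> ident C (src C f))"
    using assms by (simp add: ev_ltr_cmp ev_ltr fuse)
qed (use assms in simp_all)

text \<open>Both sides have mate \<open>f\<close>: the left one by the zigzag identity at
  \<open>X\<close>, the right one by \<open>ev_ltr\<close> and the zigzag identity at
  \<open>Y\<close>.\<close>

lemma coev_ltr:
  assumes "f \<in> arr C" "src C f = X" "trg C f = Y"
  shows "(f \<otimes> ident C (dual L X)) \<cdot> coev L X = (ident C Y \<otimes> ltr C L f) \<cdot> coev L Y"
proof (rule unmate_inj[of Y X])
  have [simp]: "X \<in> obj C" "Y \<in> obj C" using assms by auto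
  note [simp] = assms
  have "unmate Y X ((f \<otimes> ident C (dual L X)) \<cdot> coev L X)
     = ((ident C Y \<otimes> ev L X) \<cdot> (f \<otimes> ident C (dual L X) \<otimes> ident C X)) \<cdot> (coev L X \<otimes> ident C X)"
    using fuse[of "coev L X" "f \<otimes> ident C (dual L X)" "ident C X" "ident C X"] by (simp add:
        unmate_def)
  also have "(ident C Y \<otimes> ev L X) \<cdot> (f \<otimes> ident C (dual L X) \<otimes> ident C X) = f \<cdot> (ident C X \<otimes> ev L X)"
    using fuse[of f "ident C Y" "ident C (dual L X) \<otimes> ident C X" "ev L X"] scalar_slide(1)[of f
        "ev L X"] by simp
  also have "(f \<cdot> (ident C X \<otimes> ev L X)) \<cdot> (coev L X \<otimes> ident C X) = f" by simp
  finally have 1: "unmate Y X ((f \<otimes> ident C (dual L X)) \<cdot> coev L X) = f" .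
  have "unmate Y X ((ident C Y \<otimes> ltr C L f) \<cdot> coev L Y)
     = ((ident C Y \<otimes> ev L X) \<cdot> (ident C Y \<otimes> ltr C L f \<otimes> ident C X)) \<cdot> (coev L Y \<otimes> ident C X)"
    using fuse[of "coev L Y" "ident C Y \<otimes> ltr C L f" "ident C X" "ident C X"] by (simp add:
        unmate_def)
  also have "(ident C Y \<otimes> ev L X) \<cdot> (ident C Y \<otimes> ltr C L f \<otimes> ident C X)
      = (ident C Y \<otimes> ev L Y) \<cdot> (ident C Y \<otimes> ident C (dual L Y) \<otimes> f)"
    by (simp add: fuse ev_ltr)
  also have "((ident C Y \<otimes> ev L Y) \<cdot> (ident C Y \<otimes> ident C (dual L Y) \<otimes> f)) \<cdot> (coev L Y \<otimes> ident C X)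
      = (ident C Y \<otimes> ev L Y) \<cdot> (coev L Y \<otimes> f)"
    using fuse[of "coev L Y" "ident C Y \<otimes> ident C (dual L Y)" "ident C X" f] by simp
  also have "coev L Y \<otimes> f = (coev L Y \<otimes> ident C Y) \<cdot> f"
    using coscalar_slide(2)[of f "coev L Y"] by simp
  also have "(ident C Y \<otimes> ev L Y) \<cdot> (coev L Y \<otimes> ident C Y) \<cdot> f
      = ((ident C Y \<otimes> ev L Y) \<cdot> (coev L Y \<otimes> ident C Y)) \<cdot> f"
    by (rule cmp_assoc'[symmetric]) simp_all
  finally show "unmate Y X ((f \<otimes> ident C (dual L X)) \<cdot> coev L X)
      = unmate Y X ((ident C Y \<otimes> ltr C L f) \<cdot> coev L Y)"
    using 1 by simp
qed (use assms in \<open>auto\<close>)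

text \<open>The evaluation that makes \<open>dual L Y \<boxtimes> dual L X\<close> a second left
  dual of \<open>X \<boxtimes> Y\<close>; \<open>ldual_mult\<close> compares the two duals.\<close>

abbreviation ev2 :: "'o \<Rightarrow> 'o \<Rightarrow> 'a" where
  "ev2 X Y \<equiv> ev L Y \<cdot> (ident C (dual L Y) \<otimes> ev L X \<otimes> ident C Y)"

lemma ldual_mult_eq_mate:
  assumes "X \<in> obj C" "Y \<in> obj C"
  shows "ldual_mult C L X Y = mate (dual L Y \<boxtimes> dual L X) (X \<boxtimes> Y) (ev2 X Y)"
  using assms by (simp add: ldual_mult_def mate_def)

lemma ldual_mult_arr [simp]:
  assumes "X \<in> obj C" "Y \<in> obj C"
  shows "ldual_mult C L X Y \<in> arr C" "src C (ldual_mult C L X Y) = dual L Y \<boxtimes> dual L X"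
    "trg C (ldual_mult C L X Y) = dual L (X \<boxtimes> Y)"
  using assms by (simp_all add: ldual_mult_eq_mate)

lemma ev_ldual_mult:
  assumes "X \<in> obj C" "Y \<in> obj C"
  shows "ev L (X \<boxtimes> Y) \<cdot> (ldual_mult C L X Y \<otimes> ident C X \<otimes> ident C Y) = ev2 X Y"
  using ev_mate[of "dual L Y \<boxtimes> dual L X" "X \<boxtimes> Y" "ev2 X Y"] assms
  by (simp add: ldual_mult_eq_mate)

lemma ev_ldual_mult_cmp:
  assumes "X \<in> obj C" "Y \<in> obj C" "f \<in> arr C" "trg C f = dual L Y \<boxtimes> dual L X"
  shows "ev L (X \<boxtimes> Y) \<cdot> ((ldual_mult C L X Y \<cdot> f) \<otimes> ident C X \<otimes> ident C Y)
      = ev2 X Y \<cdot> (f \<otimes> ident C X \<otimes> ident C Y)"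
proof -
  have "(ldual_mult C L X Y \<cdot> f) \<otimes> ident C X \<otimes> ident C Y
      = (ldual_mult C L X Y \<otimes> ident C X \<otimes> ident C Y) \<cdot> (f \<otimes> ident C X \<otimes> ident C Y)"
    using assms by (simp add: fuse)
  then have "ev L (X \<boxtimes> Y) \<cdot> ((ldual_mult C L X Y \<cdot> f) \<otimes> ident C X \<otimes> ident C Y)
      = (ev L (X \<boxtimes> Y) \<cdot> (ldual_mult C L X Y \<otimes> ident C X \<otimes> ident C Y)) \<cdot> (f \<otimes> ident C X \<otimes> ident C Y)"
    using assms by simp
  then show ?thesis using assms by (simp only: ev_ldual_mult)
qed

lemma ev2_eq_unmate:
  assumes "X \<in> obj C" "Y \<in> obj C" "f \<in> arr C" "trg C f = dual L Y \<boxtimes> dual L X"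
  shows "ev2 X Y \<cdot> (f \<otimes> ident C X \<otimes> ident C Y) = unmate \<one> Y (unmate (dual L Y) X f)"
  using assms fuse[of "f \<otimes> ident C X" "ident C (dual L Y) \<otimes> ev L X" "ident C Y" "ident C Y"]
  by (simp add: unmate_def)

lemma ev2_inj:
  assumes "X \<in> obj C" "Y \<in> obj C" "f \<in> arr C" "trg C f = dual L Y \<boxtimes> dual L X"
    "g \<in> arr C" "trg C g = dual L Y \<boxtimes> dual L X" "src C f = src C g"
    and eq: "ev2 X Y \<cdot> (f \<otimes> ident C X \<otimes> ident C Y) = ev2 X Y \<cdot> (g \<otimes> ident C X \<otimes> ident C Y)"
  shows "f = g"
proof (rule unmate_inj[of "dual L Y" X])
  show "unmate (dual L Y) X f = unmate (dual L Y) X g"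
    by (rule unmate_inj[of \<one> Y])
      (use assms eq[unfolded ev2_eq_unmate[OF assms(1-4)] ev2_eq_unmate[OF assms(1,2,5,6)]]
          in simp_all)
qed (use assms in simp_all)

lemma ldual_mult_inverse:
  assumes [simp]: "X \<in> obj C" "Y \<in> obj C"
  obtains n where "n \<in> arr C" "src C n = dual L (X \<boxtimes> Y)" "trg C n = dual L Y \<boxtimes> dual L X"
    "n \<cdot> ldual_mult C L X Y = ident C (dual L Y) \<otimes> ident C (dual L X)"
    "ldual_mult C L X Y \<cdot> n = ident C (dual L (X \<boxtimes> Y))"
proof -
  \<comment> \<open>The inverse is the arrow whose nested pairing is the evaluation of
    \<open>X \<boxtimes> Y\<close>: first \<open>Y\<close>, then \<open>X\<close>, is moved to the
    other side.\<close>
  define n where "n = mate (dual L (X \<boxtimes> Y)) X (mate (dual L (X \<boxtimes> Y) \<boxtimes> X) Y (ev L (X \<boxtimes> Y)))"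
  have [simp]: "n \<in> arr C" "src C n = dual L (X \<boxtimes> Y)" "trg C n = dual L Y \<boxtimes> dual L X"
    by (simp_all add: n_def)
  have n: "ev2 X Y \<cdot> (n \<otimes> ident C X \<otimes> ident C Y) = ev L (X \<boxtimes> Y)"
    using ev2_eq_unmate[of X Y n] by (simp add: n_def)
  have mn: "ldual_mult C L X Y \<cdot> n = ident C (dual L (X \<boxtimes> Y))"
  proof (rule ev_inj[of "X \<boxtimes> Y"])
    show "ev L (X \<boxtimes> Y) \<cdot> ((ldual_mult C L X Y \<cdot> n) \<otimes> ident C (X \<boxtimes> Y))
        = ev L (X \<boxtimes> Y) \<cdot> (ident C (dual L (X \<boxtimes> Y)) \<otimes> ident C (X \<boxtimes> Y))"
      using ev_ldual_mult_cmp[of X Y n] n by simp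
  qed simp_all
  have nm: "n \<cdot> ldual_mult C L X Y = ident C (dual L Y) \<otimes> ident C (dual L X)"
  proof (rule ev2_inj[of X Y])
    have "ev2 X Y \<cdot> ((n \<cdot> ldual_mult C L X Y) \<otimes> ident C X \<otimes> ident C Y)
        = (ev2 X Y \<cdot> (n \<otimes> ident C X \<otimes> ident C Y)) \<cdot> (ldual_mult C L X Y \<otimes> ident C X \<otimes> ident C Y)"
      by (simp add: fuse)
    also have "\<dots> = ev2 X Y" by (simp only: n ev_ldual_mult assms)
    finally show "ev2 X Y \<cdot> ((n \<cdot> ldual_mult C L X Y) \<otimes> ident C X \<otimes> ident C Y)
        = ev2 X Y \<cdot> ((ident C (dual L Y) \<otimes> ident C (dual L X)) \<otimes> ident C X \<otimes> ident C Y)"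
      by (simp add: fuse)
  qed simp_all
  show thesis by (rule that[OF _ _ _ nm mn]) simp_all
qed

text \<open>At the unit, strictness collapses the two zigzag identities to these equations. They
  identify the inverse that occurs in \<open>funit\<close> of the double dual.\<close>

lemma coev_unit_inverse:
  "coev L \<one> \<cdot> ev L \<one> = ident C (dual L \<one>)" "ev L \<one> \<cdot> coev L \<one> = ident C \<one>"
  using dual_simps(8,9)[of \<one>] scalar_slide(2)[of "coev L \<one>" "ev L \<one>"]
    fuse[of "ident C (dual L \<one>)" "ev L \<one>" "coev L \<one>" "ident C (dual L \<one>)"]
  by simp_all

section \<open>Sovereign structures as pairings\<close>

text \<open>
  A family \<open>\<psi>\<close> is encoded by pairings \<open>X \<boxtimes> dual X \<rightarrow> \<one>\<close>. In these terms the monoidality of \<open>\<psi>\<close> involves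
  no inverse of \<^const>\<open>ldual_mult\<close>, and a change of duals is precomposition with a comparison arrow.
\<close>

definition tev :: "('o \<Rightarrow> 'a) \<Rightarrow> 'o \<Rightarrow> 'a" where
  "tev \<psi> X = ev L (dual L X) \<cdot> (\<psi> X \<otimes> ident C (dual L X))"

definition pivotal :: "('o \<Rightarrow> 'a) \<Rightarrow> bool" where
  "pivotal \<psi> \<longleftrightarrow>
     (\<forall>X \<in> obj C. \<psi> X \<in> hom C X (dual L (dual L X))) \<and>
     (\<forall>f \<in> arr C. tev \<psi> (trg C f) \<cdot> (f \<otimes> ident C (dual L (trg C f))) = tev \<psi> (src C f) \<cdot> (ident C
         (src C f) \<otimes> ltr C L f)) \<and>
     (\<forall>X \<in> obj C. \<forall>Y \<in> obj C. tev \<psi> (X \<boxtimes> Y) \<cdot> (ident C (X \<boxtimes> Y) \<otimes> ldual_mult C L X Y)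
        = tev \<psi> X \<cdot> (ident C X \<otimes> tev \<psi> Y \<otimes> ident C (dual L X))) \<and>
     tev \<psi> \<one> = ev L \<one>"

lemma tev_arr:
  assumes "X \<in> obj C" "\<psi> X \<in> hom C X (dual L (dual L X))"
  shows "\<psi> X \<in> arr C" "src C (\<psi> X) = X" "trg C (\<psi> X) = dual L (dual L X)"
    "tev \<psi> X \<in> arr C" "src C (tev \<psi> X) = X \<boxtimes> dual L X" "trg C (tev \<psi> X) = \<one>"
proof -
  show *[simp]: "\<psi> X \<in> arr C" "src C (\<psi> X) = X" "trg C (\<psi> X) = dual L (dual L X)"
    using assms by (auto simp: hom_def)
  show "tev \<psi> X \<in> arr C" "src C (tev \<psi> X) = X \<boxtimes> dual L X" "trg C (tev \<psi> X) = \<one>"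
    using assms(1) by (simp_all add: tev_def)
qed

text \<open>Both sides of the naturality square are arrows into a dual, so they may be paired with
  \<open>dual L Y\<close>. The outer transpose then crosses the evaluation and leaves
  \<open>ltr C L f\<close> in the second slot.\<close>

lemma tev_natural_iff:
  assumes \<psi>: "\<And>X. X \<in> obj C \<Longrightarrow> \<psi> X \<in> hom C X (dual L (dual L X))"
    and f: "f \<in> arr C" and [simp]: "src C f = X" "trg C f = Y"
  shows "\<psi> Y \<cdot> f = ltr C L (ltr C L f) \<cdot> \<psi> X \<longleftrightarrow>
    tev \<psi> Y \<cdot> (f \<otimes> ident C (dual L Y)) = tev \<psi> X \<cdot> (ident C X \<otimes> ltr C L f)"
proof -
  note [simp] = f
  have [simp]: "X \<in> obj C" "Y \<in> obj C" using obj_src_trg[OF f] by simp_all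
  note [simp] = tev_arr[where \<psi>=\<psi>, OF _ \<psi>]
  have 1: "ev L (dual L Y) \<cdot> ((\<psi> Y \<cdot> f) \<otimes> ident C (dual L Y)) = tev \<psi> Y \<cdot> (f \<otimes> ident C (dual L Y))"
    by (simp add: tev_def fuse)
  have 2: "ev L (dual L Y) \<cdot> ((ltr C L (ltr C L f) \<cdot> \<psi> X) \<otimes> ident C (dual L Y))
      = tev \<psi> X \<cdot> (ident C X \<otimes> ltr C L f)"
    by (simp add: tev_def fuse ev_ltr_cmp)
  show ?thesis
    using ev_inj[of "dual L Y" "\<psi> Y \<cdot> f" "ltr C L (ltr C L f) \<cdot> \<psi> X"]
    unfolding 1[symmetric] 2[symmetric] by auto
qed

text \<open>The structure map of the double dual contains the transpose of the inverse of
  \<open>ldual_mult C L X Y\<close>. Composing with the transpose of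
  \<open>ldual_mult C L X Y\<close> removes it, and what remains is an equation between arrows into
  a dual, to be tested by evaluation.\<close>

lemma tev_mult_iff:
  assumes \<psi>: "\<And>X. X \<in> obj C \<Longrightarrow> \<psi> X \<in> hom C X (dual L (dual L X))"
    and [simp]: "X \<in> obj C" "Y \<in> obj C"
  shows "\<psi> (X \<boxtimes> Y) \<cdot> fmult (id_monfunctor C) X Y = fmult (double_dual C L) X Y \<cdot> (\<psi> X \<otimes> \<psi> Y) \<longleftrightarrow>
    tev \<psi> (X \<boxtimes> Y) \<cdot> (ident C (X \<boxtimes> Y) \<otimes> ldual_mult C L X Y)
        = tev \<psi> X \<cdot> (ident C X \<otimes> tev \<psi> Y \<otimes> ident C (dual L X))"
proof -
  note [simp] = tev_arr[where \<psi>=\<psi>, OF _ \<psi>]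
  obtain n where n [simp]: "n \<in> arr C" "src C n = dual L (X \<boxtimes> Y)" "trg C n = dual L Y \<boxtimes> dual L X"
    and nm: "n \<cdot> ldual_mult C L X Y = ident C (dual L Y) \<otimes> ident C (dual L X)"
    and mn: "ldual_mult C L X Y \<cdot> n = ident C (dual L (X \<boxtimes> Y))"
    using ldual_mult_inverse[of X Y] by auto
  let ?m = "ldual_mult C L X Y" and ?m' = "ldual_mult C L (dual L Y) (dual L X)"
  have [simp]: "inv_arr C ?m = n"
    using nm mn by (intro inv_arr_eqI) simp_all
  have l: "ltr C L ?m \<cdot> ltr C L n = ident C (dual L (dual L Y \<boxtimes> dual L X))"
    "ltr C L n \<cdot> ltr C L ?m = ident C (dual L (dual L (X \<boxtimes> Y)))"
    using ltr_cmp[of ?m n] ltr_cmp[of n ?m] nm mn by (simp_all flip: ident_tenso)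
  let ?g = "?m' \<cdot> (\<psi> X \<otimes> \<psi> Y)"
  have a: "\<psi> (X \<boxtimes> Y) \<cdot> fmult (id_monfunctor C) X Y = \<psi> (X \<boxtimes> Y)"
    "fmult (double_dual C L) X Y \<cdot> (\<psi> X \<otimes> \<psi> Y) = ltr C L n \<cdot> ?g"
    by (simp_all add: id_monfunctor_def double_dual_def)
  have b: "\<psi> (X \<boxtimes> Y) = ltr C L n \<cdot> ?g \<longleftrightarrow> ltr C L ?m \<cdot> \<psi> (X \<boxtimes> Y) = ?g"
  proof
    assume "\<psi> (X \<boxtimes> Y) = ltr C L n \<cdot> ?g"
    then have "ltr C L ?m \<cdot> \<psi> (X \<boxtimes> Y) = (ltr C L ?m \<cdot> ltr C L n) \<cdot> ?g" by simp
    then show "ltr C L ?m \<cdot> \<psi> (X \<boxtimes> Y) = ?g" by (simp add: l(1))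
  next
    assume "ltr C L ?m \<cdot> \<psi> (X \<boxtimes> Y) = ?g"
    then have "ltr C L n \<cdot> ?g = (ltr C L n \<cdot> ltr C L ?m) \<cdot> \<psi> (X \<boxtimes> Y)" by simp
    then show "\<psi> (X \<boxtimes> Y) = ltr C L n \<cdot> ?g" by (simp add: l(2))
  qed
  have c: "ev L (dual L Y \<boxtimes> dual L X) \<cdot> ((ltr C L ?m \<cdot> \<psi> (X \<boxtimes> Y)) \<otimes> ident C (dual L Y \<boxtimes> dual L X))
      = tev \<psi> (X \<boxtimes> Y) \<cdot> (ident C (X \<boxtimes> Y) \<otimes> ?m)"
    using ev_ltr_cmp[of ?m "dual L Y \<boxtimes> dual L X" "\<psi> (X \<boxtimes> Y)"]
      fuse[of "ident C X \<otimes> ident C Y" "\<psi> (X \<boxtimes> Y)" ?m "ident C (dual L (X \<boxtimes> Y))"]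
    by (simp add: tev_def)
  have e: "(ident C (dual L (dual L X)) \<otimes> ev L (dual L Y) \<otimes> ident C (dual L X))
       \<cdot> ((\<psi> X \<otimes> \<psi> Y) \<otimes> ident C (dual L Y) \<otimes> ident C (dual L X))
      = (\<psi> X \<otimes> ident C (dual L X)) \<cdot> (ident C X \<otimes> tev \<psi> Y \<otimes> ident C (dual L X))"
    using fuse[of "ident C X" "\<psi> X" "tev \<psi> Y \<otimes> ident C (dual L X)" "ident C (dual L X)"]
      fuse[of "\<psi> X" "ident C (dual L (dual L X))" "\<psi> Y \<otimes> ident C (dual L Y) \<otimes> ident C (dual L X)"
          "ev L (dual L Y) \<otimes> ident C (dual L X)"]
      fuse[of "\<psi> Y \<otimes> ident C (dual L Y)" "ev L (dual L Y)" "ident C (dual L X)"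
          "ident C (dual L X)"]
    by (simp add: tev_def)
  have d: "ev L (dual L Y \<boxtimes> dual L X) \<cdot> (?g \<otimes> ident C (dual L Y \<boxtimes> dual L X))
      = tev \<psi> X \<cdot> (ident C X \<otimes> tev \<psi> Y \<otimes> ident C (dual L X))"
    using ev_ldual_mult_cmp[of "dual L Y" "dual L X" "\<psi> X \<otimes> \<psi> Y"] e
    by (simp add: tev_def[of \<psi> X])
  show ?thesis
    unfolding a b c[symmetric] d[symmetric]
    using ev_inj[of "dual L Y \<boxtimes> dual L X" "ltr C L ?m \<cdot> \<psi> (X \<boxtimes> Y)" ?g] by auto
qed

lemma tev_unit_iff:
  assumes \<psi>: "\<And>X. X \<in> obj C \<Longrightarrow> \<psi> X \<in> hom C X (dual L (dual L X))"
  shows "\<psi> \<one> \<cdot> funit (id_monfunctor C) = funit (double_dual C L) \<longleftrightarrow> tev \<psi> \<one> = ev L \<one>"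
proof -
  note [simp] = tev_arr[where \<psi>=\<psi>, OF _ \<psi>]
  have [simp]: "inv_arr C (coev L \<one>) = ev L \<one>"
    by (rule inv_arr_eqI) (simp_all add: coev_unit_inverse)
  have "ev L (dual L \<one>) \<cdot> ((ltr C L (ev L \<one>) \<cdot> coev L \<one>) \<otimes> ident C (dual L \<one>))
      = ev L \<one> \<cdot> (coev L \<one> \<otimes> ev L \<one>)"
    using ev_ltr_cmp[of "ev L \<one>" "dual L \<one>" "coev L \<one>"] by simp
  also have "coev L \<one> \<otimes> ev L \<one> = coev L \<one> \<cdot> ev L \<one>"
    using scalar_slide(1)[of "coev L \<one>" "ev L \<one>"] by simp
  finally have "ev L (dual L \<one>) \<cdot> ((ltr C L (ev L \<one>) \<cdot> coev L \<one>) \<otimes> ident C (dual L \<one>)) = ev L \<one>"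
    by (simp add: coev_unit_inverse)
  then show ?thesis
    using ev_inj[of "dual L \<one>" "\<psi> \<one>" "ltr C L (ev L \<one>) \<cdot> coev L \<one>"]
    by (auto simp: id_monfunctor_def double_dual_def tev_def)
qed

lemma sovereign_structures_iff:
  "(L, \<psi>) \<in> sovereign_structures C \<longleftrightarrow> \<psi> \<in> extensional (obj C) \<and> pivotal \<psi>"
\<comment> \<open>The pairing equivalences hold only for well-typed families. Typing is a conjunct
  of both sides, so a badly typed family falsifies both.\<close>
proof (cases "\<forall>X \<in> obj C. \<psi> X \<in> hom C X (dual L (dual L X))")
  case True
  then have \<psi>: "\<psi> X \<in> hom C X (dual L (dual L X))" if "X \<in> obj C" for X using that by blast
  have "(\<forall>X Y. \<forall>f \<in> hom C X Y. \<psi> Y \<cdot> f = ltr C L (ltr C L f) \<cdot> \<psi> X) \<longleftrightarrow>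
    (\<forall>f \<in> arr C. tev \<psi> (trg C f) \<cdot> (f \<otimes> ident C (dual L (trg C f))) = tev \<psi> (src C f) \<cdot> (ident C
        (src C f) \<otimes> ltr C L f))"
    using tev_natural_iff[OF \<psi>] by (auto simp: hom_def)
  then show ?thesis
    using True duals tev_mult_iff[OF \<psi>] tev_unit_iff[OF \<psi>]
    unfolding sovereign_structures_def monoidal_nat_trans_def nat_trans_def pivotal_def
    by (simp add: id_monfunctor_def double_dual_def)
next
  case False
  then show ?thesis
    by (auto simp: sovereign_structures_def monoidal_nat_trans_def nat_trans_def pivotal_def
        id_monfunctor_def double_dual_def)
qed

lemma pivotalD:
  assumes "pivotal \<psi>"
  shows "X \<in> obj C \<Longrightarrow> \<psi> X \<in> hom C X (dual L (dual L X))"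
    "f \<in> arr C \<Longrightarrow> src C f = X \<Longrightarrow> trg C f = Y \<Longrightarrow>
      tev \<psi> Y \<cdot> (f \<otimes> ident C (dual L Y)) = tev \<psi> X \<cdot> (ident C X \<otimes> ltr C L f)"
    "X \<in> obj C \<Longrightarrow> Y \<in> obj C \<Longrightarrow> tev \<psi> (X \<boxtimes> Y) \<cdot> (ident C (X \<boxtimes> Y) \<otimes> ldual_mult C L X Y)
        = tev \<psi> X \<cdot> (ident C X \<otimes> tev \<psi> Y \<otimes> ident C (dual L X))"
    "tev \<psi> \<one> = ev L \<one>"
  using assms by (auto simp: pivotal_def)

text \<open>Monoidality forces invertibility. The component at \<open>dual L X\<close>, read as a
  pairing of \<open>dual L X\<close> with its own dual, is bent by \<open>coev L X\<close> into an
  arrow back to \<open>X\<close>. Naturality at \<open>ev L X\<close> makes it a left inverse,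
  naturality at \<open>coev L X\<close> a right inverse.\<close>

lemma pivotal_inverse:
  assumes \<psi>: "pivotal \<psi>" and [simp]: "X \<in> obj C"
  obtains \<beta> where "\<beta> \<in> arr C" "src C \<beta> = dual L (dual L X)" "trg C \<beta> = X"
    "\<beta> \<cdot> \<psi> X = ident C X" "\<psi> X \<cdot> \<beta> = ident C (dual L (dual L X))"
proof -
  note [simp] = tev_arr[where \<psi>=\<psi>, OF _ pivotalD(1)[OF \<psi>]]
  let ?A = "dual L X"
  let ?B = "dual L ?A"
  define \<beta> where "\<beta> = (ident C X \<otimes> tev \<psi> ?A) \<cdot> (coev L X \<otimes> ident C ?B)"
  have [simp]: "\<beta> \<in> arr C" "src C \<beta> = ?B" "trg C \<beta> = X" by (simp_all add: \<beta>_def)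
  have psi: "(tev \<psi> X \<otimes> ident C ?B) \<cdot> (ident C X \<otimes> coev L ?A) = \<psi> X"
    using mate_unmate[of \<one> ?A "\<psi> X" X] by (simp add: unmate_def mate_def tev_def)
  have 1: "tev \<psi> ?A \<cdot> (ident C ?A \<otimes> \<psi> X) = ev L X"
  proof -
    let ?m = "ldual_mult C L ?A X"
    \<comment> \<open>The transpose of an evaluation is a coevaluation, up to the identifications of
      the duals of the unit and of a tensor product.\<close>
    have mc: "ltr C L (ev L X) \<cdot> coev L \<one> = ?m \<cdot> coev L ?A"
    proof (rule ev_inj[of "?A \<boxtimes> X"])
      have "ev L (?A \<boxtimes> X) \<cdot> ((ltr C L (ev L X) \<cdot> coev L \<one>) \<otimes> ident C (?A \<boxtimes> X))
          = ev L \<one> \<cdot> (coev L \<one> \<otimes> ev L X)"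
        using ev_ltr_cmp[of "ev L X" "?A \<boxtimes> X" "coev L \<one>"] by simp
      also have "coev L \<one> \<otimes> ev L X = coev L \<one> \<cdot> ev L X"
        using scalar_slide(1)[of "coev L \<one>" "ev L X"] by simp
      also have "ev L \<one> \<cdot> coev L \<one> \<cdot> ev L X = (ev L \<one> \<cdot> coev L \<one>) \<cdot> ev L X"
        by (rule cmp_assoc'[symmetric]) simp_all
      also have "\<dots> = ev L X" by (simp add: coev_unit_inverse)
      also have "\<dots> = ev2 ?A X \<cdot> (coev L ?A \<otimes> ident C ?A \<otimes> ident C X)"
        using fuse[of "coev L ?A \<otimes> ident C ?A" "ident C ?A \<otimes> ev L ?A" "ident C X" "ident C X"]
            by simp
      also have "\<dots> = ev L (?A \<boxtimes> X) \<cdot> ((?m \<cdot> coev L ?A) \<otimes> ident C (?A \<boxtimes> X))"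
        using ev_ldual_mult_cmp[of ?A X "coev L ?A"] by simp
      finally show "ev L (?A \<boxtimes> X) \<cdot> ((ltr C L (ev L X) \<cdot> coev L \<one>) \<otimes> ident C (?A \<boxtimes> X))
        = ev L (?A \<boxtimes> X) \<cdot> ((?m \<cdot> coev L ?A) \<otimes> ident C (?A \<boxtimes> X))" .
    qed simp_all
    \<comment> \<open>The pairing of the unit is inserted so that naturality can be applied to
      \<open>ev L X\<close>, an arrow from \<open>dual L X \<boxtimes> X\<close> to the
      unit.\<close>
    have "ev L X = ev L \<one> \<cdot> (ev L X \<otimes> coev L \<one>)"
    proof -
      have "ev L X \<otimes> coev L \<one> = coev L \<one> \<cdot> ev L X"
        using coscalar_slide(1)[of "ev L X" "coev L \<one>"] by simp
      then have "ev L \<one> \<cdot> (ev L X \<otimes> coev L \<one>) = (ev L \<one> \<cdot> coev L \<one>) \<cdot> ev L X" by simp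
      then show ?thesis by (simp add: coev_unit_inverse)
    qed
    also have "\<dots> = (tev \<psi> \<one> \<cdot> (ev L X \<otimes> ident C (dual L \<one>))) \<cdot> (ident C ?A \<otimes> ident C X \<otimes> coev L \<one>)"
      using fuse[of "ident C ?A \<otimes> ident C X" "ev L X" "coev L \<one>" "ident C (dual L \<one>)"]
      by (simp add: pivotalD(4)[OF \<psi>])
    also have "\<dots> = (tev \<psi> (?A \<boxtimes> X) \<cdot> (ident C ?A \<otimes> ident C X \<otimes> ltr C L (ev L X)))
        \<cdot> (ident C ?A \<otimes> ident C X \<otimes> coev L \<one>)"
      using pivotalD(2)[OF \<psi>, of "ev L X"] by simp
    also have "\<dots> = tev \<psi> (?A \<boxtimes> X) \<cdot> (ident C ?A \<otimes> ident C X \<otimes> (ltr C L (ev L X) \<cdot> coev L \<one>))"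
      by (simp add: fuse)
    also have "\<dots> = (tev \<psi> (?A \<boxtimes> X) \<cdot> (ident C (?A \<boxtimes> X) \<otimes> ?m))
        \<cdot> (ident C ?A \<otimes> ident C X \<otimes> coev L ?A)"
      by (simp add: fuse mc)
    also have "\<dots> = tev \<psi> ?A \<cdot> (ident C ?A \<otimes> ((tev \<psi> X \<otimes> ident C ?B) \<cdot> (ident C X \<otimes> coev L ?A)))"
      by (subst pivotalD(3)[OF \<psi>]) (simp_all add: fuse)
    finally show ?thesis by (simp only: psi)
  qed
  have "\<beta> \<cdot> \<psi> X = (ident C X \<otimes> tev \<psi> ?A) \<cdot> (coev L X \<otimes> \<psi> X)"
    using fuse[of "ident C \<one>" "coev L X" "\<psi> X" "ident C ?B"] by (simp add: \<beta>_def)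
  also have "\<dots> = ((ident C X \<otimes> tev \<psi> ?A) \<cdot> (ident C X \<otimes> ident C ?A \<otimes> \<psi> X)) \<cdot> (coev L X \<otimes> ident C X)"
    using fuse[of "coev L X" "ident C X \<otimes> ident C ?A" "ident C X" "\<psi> X"] by simp
  also have "\<dots> = ident C X" by (simp add: fuse 1)
  finally have \<beta>1: "\<beta> \<cdot> \<psi> X = ident C X" .
  have \<beta>2: "\<psi> X \<cdot> \<beta> = ident C ?B"
  proof (rule ev_inj[of ?A])
    let ?m = "ldual_mult C L X ?A"
    have "ev L ?A \<cdot> ((\<psi> X \<cdot> \<beta>) \<otimes> ident C ?A) = tev \<psi> X \<cdot> (\<beta> \<otimes> ident C ?A)"
      by (simp add: tev_def fuse)
    also have "\<beta> \<otimes> ident C ?A = (ident C X \<otimes> tev \<psi> ?A \<otimes> ident C ?A)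
        \<cdot> (coev L X \<otimes> ident C ?B \<otimes> ident C ?A)"
      using fuse[of "coev L X \<otimes> ident C ?B" "ident C X \<otimes> tev \<psi> ?A" "ident C ?A" "ident C ?A"]
      by (simp add: \<beta>_def)
    also have "tev \<psi> X \<cdot> \<dots> = (tev \<psi> X \<cdot> (ident C X \<otimes> tev \<psi> ?A \<otimes> ident C ?A))
        \<cdot> (coev L X \<otimes> ident C ?B \<otimes> ident C ?A)"
      by simp
    also have "\<dots> = (tev \<psi> (X \<boxtimes> ?A) \<cdot> (ident C (X \<boxtimes> ?A) \<otimes> ?m))
        \<cdot> (coev L X \<otimes> ident C ?B \<otimes> ident C ?A)"
      by (subst pivotalD(3)[OF \<psi>]) simp_all
    also have "\<dots> = tev \<psi> (X \<boxtimes> ?A) \<cdot> (coev L X \<otimes> ?m)"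
      using fuse[of "coev L X" "ident C X \<otimes> ident C ?A" "ident C ?B \<otimes> ident C ?A" ?m] by simp
    also have "coev L X \<otimes> ?m = (coev L X \<otimes> ident C (dual L (X \<boxtimes> ?A))) \<cdot> ?m"
      using coscalar_slide(2)[of ?m "coev L X"] by simp
    also have "tev \<psi> (X \<boxtimes> ?A) \<cdot> \<dots> = (tev \<psi> (X \<boxtimes> ?A) \<cdot> (coev L X \<otimes> ident C (dual L (X \<boxtimes> ?A)))) \<cdot> ?m"
      by simp
    \<comment> \<open>Naturality at \<open>coev L X\<close> replaces the pairing of
      \<open>X \<boxtimes> dual L X\<close> by that of the unit, mirroring the use of
      \<open>ev L X\<close> in the other half.\<close>
    also have "\<dots> = (ev L \<one> \<cdot> ltr C L (coev L X)) \<cdot> ?m"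
      using pivotalD(2)[OF \<psi>, of "coev L X"] by (simp add: pivotalD(4)[OF \<psi>])
    also have "ev L \<one> \<cdot> ltr C L (coev L X) = ev L (X \<boxtimes> ?A) \<cdot> (ident C (dual L (X \<boxtimes> ?A)) \<otimes> coev L X)"
      using ev_ltr[of "coev L X" \<one>] by simp
    also have "\<dots> \<cdot> ?m = ev L (X \<boxtimes> ?A) \<cdot> (?m \<otimes> coev L X)"
      using coscalar_slide(1)[of ?m "coev L X"] by simp
    also have "\<dots> = (ev L (X \<boxtimes> ?A) \<cdot> (?m \<otimes> ident C X \<otimes> ident C ?A))
        \<cdot> (ident C ?B \<otimes> ident C ?A \<otimes> coev L X)"
      using fuse[of "ident C ?B \<otimes> ident C ?A" ?m "coev L X" "ident C X \<otimes> ident C ?A"] by simp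
    also have "\<dots> = ev L ?A \<cdot> ((ident C ?B \<otimes> ev L X \<otimes> ident C ?A)
        \<cdot> (ident C ?B \<otimes> ident C ?A \<otimes> coev L X))"
      by (subst ev_ldual_mult) simp_all
    also have "\<dots> = ev L ?A \<cdot> (ident C ?B \<otimes> ident C ?A)"
      by (simp add: fuse)
    finally show "ev L ?A \<cdot> ((\<psi> X \<cdot> \<beta>) \<otimes> ident C ?A) = ev L ?A \<cdot> (ident C ?B \<otimes> ident C ?A)" .
  qed simp_all
  show thesis by (rule that[OF _ _ _ \<beta>1 \<beta>2]) simp_all
qed

section \<open>Change of duals\<close>

lemma dual_comparison_arr:
  assumes "left_duals C K" "X \<in> obj C"
  shows "dual_comparison C K L X \<in> arr C" "src C (dual_comparison C K L X) = dual K X"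
    "trg C (dual_comparison C K L X) = dual L X"
proof -
  interpret K: left_autonomous_category C K by unfold_locales fact
  show "dual_comparison C K L X \<in> arr C" "src C (dual_comparison C K L X) = dual K X"
    "trg C (dual_comparison C K L X) = dual L X"
    using assms(2) by (simp_all add: dual_comparison_def)
qed

text \<open>The comparison is the mate of \<open>ev K X\<close>, hence the only arrow that respects
  the two evaluations. Transitivity, naturality and compatibility with tensor products all reduce to
  this by \<open>ev_inj\<close>.\<close>

lemma ev_dual_comparison:
  assumes "left_duals C K" "X \<in> obj C"
  shows "ev L X \<cdot> (dual_comparison C K L X \<otimes> ident C X) = ev K X"
proof -
  interpret K: left_autonomous_category C K by unfold_locales fact
  have "dual_comparison C K L X = mate (dual K X) X (ev K X)"
    by (simp add: dual_comparison_def mate_def)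
  then show ?thesis using assms(2) by simp
qed

lemma ev_dual_comparison_cmp:
  assumes K: "left_duals C K" and X: "X \<in> obj C"
    and f: "f \<in> arr C" "trg C f = dual K X" and g: "g \<in> arr C" "trg C g = X"
  shows "ev L X \<cdot> ((dual_comparison C K L X \<cdot> f) \<otimes> g) = ev K X \<cdot> (f \<otimes> g)"
proof -
  note [simp] = dual_comparison_arr[OF K] X f g
  interpret K: left_autonomous_category C K by unfold_locales fact
  have "(dual_comparison C K L X \<cdot> f) \<otimes> g = (dual_comparison C K L X \<otimes> ident C X) \<cdot> (f \<otimes> g)"
    by (simp add: fuse)
  then have "ev L X \<cdot> ((dual_comparison C K L X \<cdot> f) \<otimes> g)
      = (ev L X \<cdot> (dual_comparison C K L X \<otimes> ident C X)) \<cdot> (f \<otimes> g)" by simp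
  then show ?thesis by (simp only: ev_dual_comparison[OF K X])
qed

lemma dual_comparison_self: "X \<in> obj C \<Longrightarrow> dual_comparison C L L X = ident C (dual L X)"
  by (simp add: dual_comparison_def)

lemma dual_comparison_trans:
  assumes J: "left_duals C J" and K: "left_duals C K" and [simp]: "X \<in> obj C"
  shows "dual_comparison C K L X \<cdot> dual_comparison C J K X = dual_comparison C J L X"
proof -
  interpret J: left_autonomous_category C J by unfold_locales fact
  interpret K: left_autonomous_category C K by unfold_locales fact
  note [simp] = dual_comparison_arr[OF J] dual_comparison_arr[OF K] K.dual_comparison_arr[OF J]
  show ?thesis
    by (rule ev_inj[of X])
      (simp_all add: ev_dual_comparison_cmp[OF K]
          ev_dual_comparison[OF J] K.ev_dual_comparison[OF J])
qed

lemma dual_comparison_natural: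
  assumes K: "left_duals C K" and f [simp]: "f \<in> arr C"
  shows "dual_comparison C K L (src C f) \<cdot> ltr C K f = ltr C L f \<cdot> dual_comparison C K L (trg C f)"
proof -
  interpret K: left_autonomous_category C K by unfold_locales fact
  note [simp] = dual_comparison_arr[OF K]
  show ?thesis
  proof (rule ev_inj[of "src C f"])
    have "ev L (src C f) \<cdot> ((ltr C L f \<cdot> dual_comparison C K L (trg C f)) \<otimes> ident C (src C f))
        = ev L (trg C f) \<cdot> (dual_comparison C K L (trg C f) \<otimes> f)"
      by (simp add: ev_ltr_cmp)
    also have "\<dots> = ev K (trg C f) \<cdot> (ident C (dual K (trg C f)) \<otimes> f)"
      using ev_dual_comparison_cmp[OF K, of "trg C f" "ident C (dual K (trg C f))" f] by simp
    finally show "ev L (src C f) \<cdot> ((dual_comparison C K L (src C f)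
        \<cdot> ltr C K f) \<otimes> ident C (src C f))
        = ev L (src C f) \<cdot> ((ltr C L f \<cdot> dual_comparison C K L (trg C f)) \<otimes> ident C (src C f))"
      by (simp add: ev_dual_comparison_cmp[OF K] K.ev_ltr)
  qed simp_all
qed

text \<open>Paired with \<open>X \<boxtimes> Y\<close>, both sides become the nested evaluation
  built from the duals in \<open>K\<close>.\<close>

lemma dual_comparison_mult:
  assumes K: "left_duals C K" and [simp]: "X \<in> obj C" "Y \<in> obj C"
  shows "dual_comparison C K L (X \<boxtimes> Y) \<cdot> ldual_mult C K X Y
     = ldual_mult C L X Y \<cdot> (dual_comparison C K L Y \<otimes> dual_comparison C K L X)"
proof -
  interpret K: left_autonomous_category C K by unfold_locales fact
  note [simp] = dual_comparison_arr[OF K]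
  let ?x = "dual_comparison C K L X" and ?y = "dual_comparison C K L Y"
  show ?thesis
  proof (rule ev_inj[of "X \<boxtimes> Y"])
    have "ev L (X \<boxtimes> Y) \<cdot> ((ldual_mult C L X Y \<cdot> (?y \<otimes> ?x)) \<otimes> ident C (X \<boxtimes> Y))
      = ev2 X Y \<cdot> (?y \<otimes> ?x \<otimes> ident C X \<otimes> ident C Y)"
      using ev_ldual_mult_cmp[of X Y "?y \<otimes> ?x"] by simp
    also have "\<dots> = ev L Y \<cdot> (?y \<otimes> ev K X \<otimes> ident C Y)"
    proof -
      have "(ev L X \<otimes> ident C Y) \<cdot> (?x \<otimes> ident C X \<otimes> ident C Y) = ev K X \<otimes> ident C Y"
        using fuse[of "?x \<otimes> ident C X" "ev L X" "ident C Y" "ident C Y"]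
        by (simp add: ev_dual_comparison[OF K])
      then have "(ident C (dual L Y) \<otimes> ev L X \<otimes> ident C Y) \<cdot> (?y \<otimes> ?x \<otimes> ident C X \<otimes> ident C Y)
          = ?y \<otimes> ev K X \<otimes> ident C Y"
        using fuse[of ?y "ident C (dual L Y)" "?x \<otimes> ident C X \<otimes> ident C Y" "ev L X \<otimes> ident C Y"]
            by simp
      then show ?thesis by simp
    qed
    also have "\<dots> = K.ev2 X Y"
      using ev_dual_comparison_cmp[OF K, of Y "ident C (dual K Y)" "ev K X \<otimes> ident C Y"] by simp
    also have "\<dots> = ev L (X \<boxtimes> Y) \<cdot> ((dual_comparison C K L (X \<boxtimes> Y) \<cdot> ldual_mult C K X Y) \<otimes> ident C
        (X \<boxtimes> Y))"
      using ev_dual_comparison_cmp[OF K, of "X \<boxtimes> Y" "ldual_mult C K X Y" "ident C (X \<boxtimes> Y)"]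
        K.ev_ldual_mult[of X Y] by simp
    finally show "ev L (X \<boxtimes> Y) \<cdot> ((dual_comparison C K L (X \<boxtimes> Y) \<cdot> ldual_mult C K X Y) \<otimes> ident C
        (X \<boxtimes> Y))
       = ev L (X \<boxtimes> Y) \<cdot> ((ldual_mult C L X Y \<cdot> (?y \<otimes> ?x)) \<otimes> ident C (X \<boxtimes> Y))" by simp
  qed simp_all
qed

lemma double_dual_comparison_arr:
  assumes K: "left_duals C K" and [simp]: "X \<in> obj C"
  shows "double_dual_comparison C K L X \<in> arr C" "src C (double_dual_comparison C K L X)
      = dual K (dual K X)"
    "trg C (double_dual_comparison C K L X) = dual L (dual L X)"
proof -
  interpret K: left_autonomous_category C K by unfold_locales fact
  note [simp] = dual_comparison_arr[OF K] K.dual_comparison_arr[OF duals]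
  show "double_dual_comparison C K L X \<in> arr C" "src C (double_dual_comparison C K L X)
      = dual K (dual K X)"
    "trg C (double_dual_comparison C K L X) = dual L (dual L X)"
    by (simp_all add: double_dual_comparison_def)
qed

text \<open>On pairings, the two steps that identify the double duals collapse to a single
  comparison, in the direction from \<open>L\<close> to \<open>K\<close>, placed in the second
  slot.\<close>

lemma ev_double_dual_comparison:
  assumes K: "left_duals C K" and [simp]: "X \<in> obj C"
    and [simp]: "f \<in> arr C" "trg C f = dual K (dual K X)"
  shows "ev L (dual L X) \<cdot> ((double_dual_comparison C K L X \<cdot> f) \<otimes> ident C (dual L X))
    = ev K (dual K X) \<cdot> (f \<otimes> dual_comparison C L K X)"
proof -
  interpret K: left_autonomous_category C K by unfold_locales fact
  note [simp] = dual_comparison_arr[OF K] K.dual_comparison_arr[OF duals]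
  have "ev L (dual L X) \<cdot> ((double_dual_comparison C K L X \<cdot> f) \<otimes> ident C (dual L X))
     = ev K (dual L X) \<cdot> ((ltr C K (dual_comparison C L K X) \<cdot> f) \<otimes> ident C (dual L X))"
    using ev_dual_comparison_cmp[OF K, of "dual L X" "ltr C K (dual_comparison C L K X) \<cdot> f"
        "ident C (dual L X)"]
    by (simp add: double_dual_comparison_def)
  then show ?thesis
    using K.ev_ltr_cmp[of "dual_comparison C L K X" "dual L X" f] by simp
qed

end

section \<open>Transport of sovereign structures between two choices of duals\<close>

locale two_left_duals = left_autonomous_category C L + K: left_autonomous_category C K
  for C :: "('o, 'a) moncat" (structure) and L K
begin

lemmas dc_arr [simp] = dual_comparison_arr[OF K.duals] K.dual_comparison_arr[OF duals]
  double_dual_comparison_arr[OF K.duals]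

lemma dc_inverse:
  assumes "X \<in> obj C"
  shows "dual_comparison C K L X \<cdot> dual_comparison C L K X = ident C (dual L X)"
  using dual_comparison_trans[OF duals K.duals] assms by (simp add: dual_comparison_self)

lemma comparison_iff:
  assumes [simp]: "X \<in> obj C" and \<phi>: "\<phi> X \<in> hom C X (dual K (dual K X))"
    and \<psi>: "\<psi> X \<in> hom C X (dual L (dual L X))"
  shows "\<psi> X = double_dual_comparison C K L X \<cdot> \<phi> X
    \<longleftrightarrow> tev \<psi> X = K.tev \<phi> X \<cdot> (ident C X \<otimes> dual_comparison C L K X)"
proof -
  note [simp] = tev_arr[where \<psi>=\<psi>, OF _ \<psi>] K.tev_arr[where \<psi>=\<phi>, OF _ \<phi>]
  have "ev L (dual L X) \<cdot> ((double_dual_comparison C K L X \<cdot> \<phi> X) \<otimes> ident C (dual L X))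
      = K.tev \<phi> X \<cdot> (ident C X \<otimes> dual_comparison C L K X)"
    using ev_double_dual_comparison[OF K.duals, of X "\<phi> X"] by (simp add: K.tev_def fuse)
  then show ?thesis
    using ev_inj[of "dual L X" "\<psi> X" "double_dual_comparison C K L X \<cdot> \<phi> X"]
    by (auto simp: tev_def)
qed

text \<open>The new pairing is the old one precomposed with the comparison from the duals of
  \<open>L\<close> to those of \<open>K\<close>. Since the comparison is natural, multiplicative and
  respects evaluations, every clause of \<open>pivotal\<close> is inherited.\<close>

lemma pivotal_transport:
  assumes \<phi>: "K.pivotal \<phi>"
    and \<psi>: "\<And>X. X \<in> obj C \<Longrightarrow> \<psi> X = double_dual_comparison C K L X \<cdot> \<phi> X"
  shows "pivotal \<psi>"
proof -
  note [simp] = K.tev_arr[where \<psi>=\<phi>, OF _ K.pivotalD(1)[OF \<phi>]]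
  have h: "\<psi> X \<in> hom C X (dual L (dual L X))" if "X \<in> obj C" for X
    unfolding \<psi>[OF that] by (rule homI) (use that in simp_all)
  note [simp] = tev_arr[where \<psi>=\<psi>, OF _ h]
  have t: "tev \<psi> X = K.tev \<phi> X \<cdot> (ident C X \<otimes> dual_comparison C L K X)" if "X \<in> obj C" for X
    using comparison_iff[of X \<phi> \<psi>] \<psi>[OF that] h[OF that] K.pivotalD(1)[OF \<phi> that] that by simp
  show ?thesis
    unfolding pivotal_def
  proof (intro conjI ballI)
    fix f assume [simp]: "f \<in> arr C"
    let ?X = "src C f" and ?Y = "trg C f"
    let ?d = "dual_comparison C L K ?Y"
    have e: "K.tev \<phi> ?Y \<cdot> (f \<otimes> ident C (dual K ?Y)) = K.tev \<phi> ?X \<cdot> (ident C ?X \<otimes> ltr C K f)"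
      by (rule K.pivotalD(2)[OF \<phi>]) simp_all
    have "tev \<psi> ?Y \<cdot> (f \<otimes> ident C (dual L ?Y)) = K.tev \<phi> ?Y \<cdot> (f \<otimes> ?d)"
      by (simp add: t fuse)
    also have "\<dots> = (K.tev \<phi> ?Y \<cdot> (f \<otimes> ident C (dual K ?Y))) \<cdot> (ident C ?X \<otimes> ?d)"
      by (simp add: fuse)
    also have "\<dots> = (K.tev \<phi> ?X \<cdot> (ident C ?X \<otimes> ltr C K f)) \<cdot> (ident C ?X \<otimes> ?d)"
      by (simp only: e)
    also have "\<dots> = K.tev \<phi> ?X \<cdot> (ident C ?X \<otimes> (ltr C K f \<cdot> ?d))"
      by (simp add: fuse)
    also have "\<dots> = tev \<psi> ?X \<cdot> (ident C ?X \<otimes> ltr C L f)"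
      by (simp add: t fuse flip: K.dual_comparison_natural[OF duals])
    finally show "tev \<psi> ?Y \<cdot> (f \<otimes> ident C (dual L ?Y)) = tev \<psi> ?X \<cdot> (ident C ?X \<otimes> ltr C L f)" .
  next
    fix X Y assume [simp]: "X \<in> obj C" "Y \<in> obj C"
    let ?x = "dual_comparison C L K X" and ?y = "dual_comparison C L K Y"
    have "tev \<psi> (X \<boxtimes> Y) \<cdot> (ident C (X \<boxtimes> Y) \<otimes> ldual_mult C L X Y)
        = K.tev \<phi> (X \<boxtimes> Y) \<cdot> (ident C (X \<boxtimes> Y) \<otimes> (ldual_mult C K X Y \<cdot> (?y \<otimes> ?x)))"
      by (simp add: t fuse K.dual_comparison_mult[OF duals])
    also have "\<dots> = (K.tev \<phi> (X \<boxtimes> Y) \<cdot> (ident C (X \<boxtimes> Y) \<otimes> ldual_mult C K X Y))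
        \<cdot> (ident C (X \<boxtimes> Y) \<otimes> ?y \<otimes> ?x)"
      by (simp add: fuse)
    also have "\<dots> = K.tev \<phi> X \<cdot> ((ident C X \<otimes> K.tev \<phi> Y \<otimes> ident C (dual K X))
        \<cdot> (ident C X \<otimes> ident C Y \<otimes> ?y \<otimes> ?x))"
      by (subst K.pivotalD(3)[OF \<phi>]) simp_all
    also have "(ident C X \<otimes> K.tev \<phi> Y \<otimes> ident C (dual K X)) \<cdot> (ident C X \<otimes> ident C Y \<otimes> ?y \<otimes> ?x)
        = ident C X \<otimes> tev \<psi> Y \<otimes> ?x"
      using fuse[of "ident C Y \<otimes> ?y" "K.tev \<phi> Y" ?x "ident C (dual K X)"] by (simp add: t fuse)
    also have "\<dots> = (ident C X \<otimes> ?x) \<cdot> (ident C X \<otimes> tev \<psi> Y \<otimes> ident C (dual L X))"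
      using fuse[of "tev \<psi> Y" "ident C \<one>" "ident C (dual L X)" ?x] by (simp add: fuse)
    also have "K.tev \<phi> X \<cdot> \<dots> = tev \<psi> X \<cdot> (ident C X \<otimes> tev \<psi> Y \<otimes> ident C (dual L X))"
      by (simp add: t[of X])
    finally show "tev \<psi> (X \<boxtimes> Y) \<cdot> (ident C (X \<boxtimes> Y) \<otimes> ldual_mult C L X Y)
        = tev \<psi> X \<cdot> (ident C X \<otimes> tev \<psi> Y \<otimes> ident C (dual L X))" .
  next
    show "tev \<psi> \<one> = ev L \<one>"
      using K.ev_dual_comparison[OF duals, of \<one>] by (simp add: t K.pivotalD(4)[OF \<phi>])
  qed (rule h)
qed

end

section \<open>The equivalence relation on sovereign structures\<close>

context strict_monoidal_category begin

text \<open>In this form reflexivity, symmetry and transitivity of the relation become the facts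
  that comparisons of duals are identities, are invertible, and compose.\<close>

lemma sovereign_equiv_iff:
  assumes K: "left_duals C K" and L: "left_duals C L"
  shows "((K, \<phi>), (L, \<psi>)) \<in> sovereign_equiv C \<longleftrightarrow>
    (K, \<phi>) \<in> sovereign_structures C \<and> (L, \<psi>) \<in> sovereign_structures C \<and>
    (\<forall>X \<in> obj C. left_autonomous_category.tev C L \<psi> X
      = left_autonomous_category.tev C K \<phi> X \<cdot> (ident C X \<otimes> dual_comparison C L K X))"
proof -
  interpret two_left_duals C L K by unfold_locales fact+
  show ?thesis
  proof (cases "(K, \<phi>) \<in> sovereign_structures C \<and> (L, \<psi>) \<in> sovereign_structures C")
    case True
    then have p: "K.pivotal \<phi>" "pivotal \<psi>"
      by (simp_all add: K.sovereign_structures_iff sovereign_structures_iff)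
    show ?thesis
      using True comparison_iff[of _ \<phi> \<psi>, OF _ K.pivotalD(1)[OF p(1)] pivotalD(1)[OF p(2)]]
      by (simp add: sovereign_equiv_def)
  qed (auto simp: sovereign_equiv_def)
qed

lemma equiv_sovereign_equiv: "equiv (sovereign_structures C) (sovereign_equiv C)"
proof (rule equivI)
  have left: "left_duals C K" if "(K, \<phi>) \<in> sovereign_structures C" for K \<phi>
    using that by (simp add: sovereign_structures_def)
  show "sovereign_equiv C \<subseteq> sovereign_structures C \<times> sovereign_structures C"
    by (auto simp: sovereign_equiv_def)
  show "refl_on (sovereign_structures C) (sovereign_equiv C)"
  proof (rule refl_onI)
    fix x assume "x \<in> sovereign_structures C"
    moreover obtain K \<phi> where x: "x = (K, \<phi>)" by (cases x)
    ultimately have S: "(K, \<phi>) \<in> sovereign_structures C" by simp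
    interpret K: left_autonomous_category C K by unfold_locales (rule left[OF S])
    have "K.pivotal \<phi>" using S by (simp add: K.sovereign_structures_iff)
    note [simp] = K.tev_arr[where \<psi>=\<phi>, OF _ K.pivotalD(1)[OF this]]
    show "(x, x) \<in> sovereign_equiv C"
      using S by (simp add: x sovereign_equiv_iff K.duals K.dual_comparison_self)
  qed
  show "sym (sovereign_equiv C)"
  proof (rule symI)
    fix x y assume xy: "(x, y) \<in> sovereign_equiv C"
    obtain K \<phi> L \<psi> where x: "x = (K, \<phi>)" "y = (L, \<psi>)" by (cases x, cases y)
    from xy have S: "(K, \<phi>) \<in> sovereign_structures C" "(L, \<psi>) \<in> sovereign_structures C"
      by (auto simp: sovereign_equiv_def x)
    interpret L: left_autonomous_category C L by unfold_locales (rule left[OF S(2)])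
    interpret two_left_duals C K L by unfold_locales (rule left[OF S(1)])
    have p: "pivotal \<phi>" using S by (simp add: sovereign_structures_iff)
    note [simp] = tev_arr[where \<psi>=\<phi>, OF _ pivotalD(1)[OF p]]
    have "L.tev \<psi> X \<cdot> (ident C X \<otimes> dual_comparison C K L X) = tev \<phi> X" if [simp]: "X \<in> obj C" for X
    proof -
      have "L.tev \<psi> X = tev \<phi> X \<cdot> (ident C X \<otimes> dual_comparison C L K X)"
        using xy that by (simp add: x sovereign_equiv_iff duals L.duals)
      then show ?thesis
        by (simp add: fuse dc_inverse)
    qed
    then show "(y, x) \<in> sovereign_equiv C"
      using S by (simp add: x sovereign_equiv_iff duals L.duals)
  qed
  show "trans (sovereign_equiv C)"
  proof (rule transI)
    fix x y z assume xy: "(x, y) \<in> sovereign_equiv C" and yz: "(y, z) \<in> sovereign_equiv C"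
    obtain K \<phi> L \<psi> M \<chi> where x: "x = (K, \<phi>)" "y = (L, \<psi>)" "z = (M, \<chi>)" by (cases x, cases y, cases
        z)
    from xy yz have S: "(K, \<phi>) \<in> sovereign_structures C" "(L, \<psi>) \<in> sovereign_structures C"
      "(M, \<chi>) \<in> sovereign_structures C"
      by (auto simp: sovereign_equiv_def x)
    interpret K: left_autonomous_category C K by unfold_locales (rule left[OF S(1)])
    interpret L: left_autonomous_category C L by unfold_locales (rule left[OF S(2)])
    interpret M: left_autonomous_category C M by unfold_locales (rule left[OF S(3)])
    have p: "K.pivotal \<phi>" using S by (simp add: K.sovereign_structures_iff)
    note [simp] = K.tev_arr[where \<psi>=\<phi>, OF _ K.pivotalD(1)[OF p]]
      K.dual_comparison_arr[OF L.duals] L.dual_comparison_arr[OF M.duals]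
    have "M.tev \<chi> X = K.tev \<phi> X \<cdot> (ident C X \<otimes> dual_comparison C M K X)" if [simp]:
        "X \<in> obj C" for X
    proof -
      have "L.tev \<psi> X = K.tev \<phi> X \<cdot> (ident C X \<otimes> dual_comparison C L K X)"
        "M.tev \<chi> X = L.tev \<psi> X \<cdot> (ident C X \<otimes> dual_comparison C M L X)"
        using xy yz that by (simp_all add: x sovereign_equiv_iff K.duals L.duals M.duals)
      then show ?thesis
        by (simp add: fuse K.dual_comparison_trans[OF M.duals L.duals])
    qed
    then show "(x, z) \<in> sovereign_equiv C"
      using S by (simp add: x sovereign_equiv_iff K.duals M.duals)
  qed
qed

end

section \<open>Representatives on a fixed choice of duals\<close>

context left_autonomous_category begin

text \<open>Surjectivity is transport along the comparison of double duals. For injectivity, the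
  comparison of \<open>L\<close> with itself is the identity, so equivalent structures on
  \<open>L\<close> have equal pairings, and pairings determine the components.\<close>

lemma bij_betw_sovereign_classes:
  "bij_betw (\<lambda>\<psi>. sovereign_equiv C `` {(L, \<psi>)}) {\<psi> \<in> extensional (obj C). pivotal \<psi>}
     (sovereign_structures C // sovereign_equiv C)"
proof (rule bij_betw_imageI)
  show "inj_on (\<lambda>\<psi>. sovereign_equiv C `` {(L, \<psi>)}) {\<psi> \<in> extensional (obj C). pivotal \<psi>}"
  proof (rule inj_onI, clarify)
    fix \<phi> \<psi> assume e: "\<phi> \<in> extensional (obj C)" "\<psi> \<in> extensional (obj C)" and p: "pivotal \<phi>"
        "pivotal \<psi>"
      and eq: "sovereign_equiv C `` {(L, \<phi>)} = sovereign_equiv C `` {(L, \<psi>)}"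
    have S: "(L, \<phi>) \<in> sovereign_structures C" "(L, \<psi>) \<in> sovereign_structures C"
      using e p by (simp_all add: sovereign_structures_iff)
    then have "((L, \<phi>), (L, \<psi>)) \<in> sovereign_equiv C"
      using eq_equiv_class_iff[OF equiv_sovereign_equiv S] eq by simp
    then have t: "tev \<psi> X = tev \<phi> X" if "X \<in> obj C" for X
      using that tev_arr[where \<psi>=\<phi>, OF that pivotalD(1)[OF p(1) that]]
      by (simp add: sovereign_equiv_iff duals dual_comparison_self)
    show "\<phi> = \<psi>"
    proof (rule extensionalityI[OF e])
      fix X assume X [simp]: "X \<in> obj C"
      show "\<phi> X = \<psi> X"
        using ev_inj[of "dual L X" "\<phi> X" "\<psi> X"] t[OF X]
          tev_arr[where \<psi>=\<phi>, OF X pivotalD(1)[OF p(1) X]] tev_arr[where \<psi>=\<psi>, OF X pivotalD(1)[OF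
              p(2) X]]
        by (simp add: tev_def)
    qed
  qed
  have S: "(L, \<psi>) \<in> sovereign_structures C" if "\<psi> \<in> extensional (obj C)" "pivotal \<psi>" for \<psi>
    using that by (simp add: sovereign_structures_iff)
  show "(\<lambda>\<psi>. sovereign_equiv C `` {(L, \<psi>)}) ` {\<psi> \<in> extensional (obj C). pivotal \<psi>}
     = sovereign_structures C // sovereign_equiv C"
  proof (intro equalityI subsetI)
    fix Q assume "Q \<in> (\<lambda>\<psi>. sovereign_equiv C `` {(L, \<psi>)}) ` {\<psi> \<in> extensional (obj C). pivotal \<psi>}"
    then show "Q \<in> sovereign_structures C // sovereign_equiv C"
      using S by (auto intro: quotientI)
  next
    fix Q assume "Q \<in> sovereign_structures C // sovereign_equiv C"
    then obtain K \<phi> where K: "(K, \<phi>) \<in> sovereign_structures C" and Q: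
        "Q = sovereign_equiv C `` {(K, \<phi>)}"
      by (auto elim!: quotientE)
    interpret two_left_duals C L K
      using K by unfold_locales (simp add: sovereign_structures_def)
    have p: "K.pivotal \<phi>" using K by (simp add: K.sovereign_structures_iff)
    \<comment> \<open>The restriction selects the extensional representative;
      \<open>pivotal_transport\<close> asks only for the values on objects.\<close>
    define \<psi> where "\<psi> = (\<lambda>X \<in> obj C. double_dual_comparison C K L X \<cdot> \<phi> X)"
    have "pivotal \<psi>"
      by (rule pivotal_transport[OF p]) (simp add: \<psi>_def)
    moreover have "\<psi> \<in> extensional (obj C)" by (simp add: \<psi>_def)
    ultimately have "(L, \<psi>) \<in> sovereign_structures C" and m:
        "\<psi> \<in> {\<psi> \<in> extensional (obj C). pivotal \<psi>}"
      using S by auto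
    then have "((K, \<phi>), (L, \<psi>)) \<in> sovereign_equiv C"
      using K by (simp add: sovereign_equiv_def \<psi>_def)
    then have "Q = sovereign_equiv C `` {(L, \<psi>)}"
      unfolding Q by (rule equiv_class_eq[OF equiv_sovereign_equiv])
    then show "Q \<in> (\<lambda>\<psi>. sovereign_equiv C `` {(L, \<psi>)}) ` {\<psi> \<in> extensional (obj C). pivotal \<psi>}"
      using m by auto
  qed
qed

end

section \<open>Monads and modules\<close>

text \<open>Isolated from \<open>bimonad\<close> because it is instantiated both with
  \<open>T\<close> and with its square, the latter for \<open>dual_action_unique\<close>. The record
  scheme admits the bimonad record as well as the bare \<open>comp_functor T T\<close>.\<close>

locale comonoidal_functor = strict_monoidal_category C
  for C :: "('o, 'a) moncat" (structure)
    and H :: "('o, 'a, 'o, 'a, 'z) functor_data_scheme" and H2 :: "'o \<Rightarrow> 'o \<Rightarrow> 'a" and H0 :: 'a +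
  assumes endofunctor: "is_functor C C H"
    and H2_arr [simp]: "\<lbrakk>X \<in> obj C; Y \<in> obj C\<rbrakk> \<Longrightarrow> H2 X Y \<in> arr C"
      "\<lbrakk>X \<in> obj C; Y \<in> obj C\<rbrakk> \<Longrightarrow> src C (H2 X Y) = omap H (X \<boxtimes> Y)"
      "\<lbrakk>X \<in> obj C; Y \<in> obj C\<rbrakk> \<Longrightarrow> trg C (H2 X Y) = omap H X \<boxtimes> omap H Y"
    and H0_arr [simp]: "H0 \<in> arr C" "src C H0 = omap H \<one>" "trg C H0 = \<one>"
    and H2_nat: "\<lbrakk>f \<in> arr C; g \<in> arr C\<rbrakk>
      \<Longrightarrow> H2 (trg C f) (trg C g) \<cdot> amap H (f \<otimes> g) = (amap H f \<otimes> amap H g) \<cdot> H2 (src C f) (src C g)"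
    and H2_assoc: "\<lbrakk>X \<in> obj C; Y \<in> obj C; Z \<in> obj C\<rbrakk>
      \<Longrightarrow> (ident C (omap H X) \<otimes> H2 Y Z) \<cdot> H2 X (Y \<boxtimes> Z) = (H2 X Y \<otimes> ident C (omap H Z)) \<cdot> H2 (X \<boxtimes> Y) Z"
    and H2_H0: "X \<in> obj C \<Longrightarrow> (ident C (omap H X) \<otimes> H0) \<cdot> H2 X \<one> = ident C (omap H X)"
      "X \<in> obj C \<Longrightarrow> (H0 \<otimes> ident C (omap H X)) \<cdot> H2 \<one> X = ident C (omap H X)"
begin

lemma functor_obj [simp]: "X \<in> obj C \<Longrightarrow> omap H X \<in> obj C"
  using endofunctor by (simp add: is_functor_def)

lemma functor_arr [simp]:
  assumes "f \<in> arr C"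
  shows "amap H f \<in> arr C" "src C (amap H f) = omap H (src C f)" "trg C (amap H f)
      = omap H (trg C f)"
proof -
  have "f \<in> hom C (src C f) (trg C f)" using assms by (simp add: in_hom)
  then have "amap H f \<in> hom C (omap H (src C f)) (omap H (trg C f))"
    using endofunctor unfolding is_functor_def by blast
  then show "amap H f \<in> arr C" "src C (amap H f) = omap H (src C f)" "trg C (amap H f)
      = omap H (trg C f)"
    by (simp_all add: in_hom)
qed

lemma functor_ident [simp]: "X \<in> obj C \<Longrightarrow> amap H (ident C X) = ident C (omap H X)"
  using endofunctor by (simp add: is_functor_def)

lemma functor_ident_tensor [simp]:
  "\<lbrakk>X \<in> obj C; Y \<in> obj C\<rbrakk> \<Longrightarrow> amap H (ident C X \<otimes> ident C Y) = ident C (omap H (X \<boxtimes> Y))"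
  using functor_ident[of "X \<boxtimes> Y"] by simp

lemma functor_cmp:
  assumes "f \<in> arr C" "g \<in> arr C" "src C g = trg C f"
  shows "amap H (g \<cdot> f) = amap H g \<cdot> amap H f"
proof -
  have "f \<in> hom C (src C f) (trg C f)" "g \<in> hom C (trg C f) (trg C g)" using assms by (simp_all add:
      in_hom)
  then show ?thesis using endofunctor unfolding is_functor_def by blast
qed

text \<open>
  In the convolution-like algebra of arrows out of \<open>H\<close>, the hypotheses make \<open>x\<close> a left and \<open>y\<close> a
  right inverse of \<open>R\<close>.
\<close>

lemma dual_action_unique:
  assumes L: "left_duals C L" and M [simp]: "M \<in> obj C"
    and [simp]: "R \<in> arr C" "src C R = omap H M" "trg C R = M"
    and [simp]: "x \<in> arr C" "src C x = omap H (dual L M)" "trg C x = dual L M"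
    and [simp]: "y \<in> arr C" "src C y = omap H (dual L M)" "trg C y = dual L M"
    and x: "ev L M \<cdot> (x \<otimes> R) \<cdot> H2 (dual L M) M = H0 \<cdot> amap H (ev L M)"
    and y: "(R \<otimes> y) \<cdot> H2 M (dual L M) \<cdot> amap H (coev L M) = coev L M \<cdot> H0"
  shows "x = y"
proof -
  interpret L: left_autonomous_category C L by unfold_locales fact
  let ?A = "dual L M"
  let ?H = "omap H ?A"
  let ?w = "amap H (ident C ?A \<otimes> coev L M)"
  \<comment> \<open>One composite of \<open>x\<close>, \<open>R\<close> and \<open>y\<close> is
    computed in two ways. Bracketed to the right, hypothesis \<open>y\<close> absorbs
    \<open>R\<close> together with \<open>y\<close> and leaves \<open>x\<close>.\<close>
  have "(x \<otimes> R \<otimes> y) \<cdot> (ident C ?H \<otimes> H2 M ?A) \<cdot> H2 ?A (M \<boxtimes> ?A) \<cdot> ?w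
      = (x \<otimes> R \<otimes> y) \<cdot> (ident C ?H \<otimes> H2 M ?A) \<cdot> (ident C ?H \<otimes> amap H (coev L M)) \<cdot> H2 ?A \<one>"
    using H2_nat[of "ident C ?A" "coev L M"] by simp
  also have "\<dots> = (x \<otimes> ((R \<otimes> y) \<cdot> H2 M ?A \<cdot> amap H (coev L M))) \<cdot> H2 ?A \<one>"
    by (simp add: fuses)
  also have "\<dots> = (x \<otimes> coev L M) \<cdot> (ident C ?H \<otimes> H0) \<cdot> H2 ?A \<one>"
    unfolding y by (simp add: fuses)
  also have "\<dots> = (ident C ?A \<otimes> coev L M) \<cdot> x"
    using H2_H0(1)[of ?A] coscalar_slide(1)[of x "coev L M"] by simp
  finally have 1: "(x \<otimes> R \<otimes> y) \<cdot> (ident C ?H \<otimes> H2 M ?A) \<cdot> H2 ?A (M \<boxtimes> ?A) \<cdot> ?w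
      = (ident C ?A \<otimes> coev L M) \<cdot> x" .
  \<comment> \<open>Coassociativity gives the bracketing to the left. After evaluation, hypothesis
    \<open>x\<close> absorbs \<open>x\<close> together with \<open>R\<close> and leaves
    \<open>y\<close>; the zigzag identity then finishes the comparison.\<close>
  have "(ident C ?H \<otimes> H2 M ?A) \<cdot> H2 ?A (M \<boxtimes> ?A) \<cdot> ?w
      = (H2 ?A M \<otimes> ident C ?H) \<cdot> H2 (?A \<boxtimes> M) ?A \<cdot> ?w"
    using arg_cong[OF H2_assoc[of ?A M ?A], of "\<lambda>k. k \<cdot> ?w"] by simp
  then have "(ev L M \<otimes> ident C ?A) \<cdot> (x \<otimes> R \<otimes> y) \<cdot> (ident C ?H \<otimes> H2 M ?A) \<cdot> H2 ?A (M \<boxtimes> ?A) \<cdot> ?w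
      = (ev L M \<otimes> ident C ?A) \<cdot> ((x \<otimes> R) \<otimes> y) \<cdot> (H2 ?A M \<otimes> ident C ?H) \<cdot> H2 (?A \<boxtimes> M) ?A \<cdot> ?w"
    by simp
  also have "\<dots> = ((ev L M \<otimes> ident C ?A) \<cdot> ((x \<otimes> R) \<otimes> y) \<cdot> (H2 ?A M \<otimes> ident C ?H)) \<cdot> H2 (?A \<boxtimes> M) ?A
      \<cdot> ?w"
    by simp
  also have "(ev L M \<otimes> ident C ?A) \<cdot> ((x \<otimes> R) \<otimes> y) \<cdot> (H2 ?A M \<otimes> ident C ?H)
      = (ev L M \<cdot> (x \<otimes> R) \<cdot> H2 ?A M) \<otimes> y"
    using fuse[of "H2 ?A M" "x \<otimes> R" "ident C ?H" y]
      fuse[of "(x \<otimes> R) \<cdot> H2 ?A M" "ev L M" y "ident C ?A"] by simp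
  also have "\<dots> = (H0 \<otimes> y) \<cdot> (amap H (ev L M) \<otimes> ident C ?H)"
    unfolding x by (simp add: fuse)
  also have "(\<dots>) \<cdot> H2 (?A \<boxtimes> M) ?A \<cdot> ?w = (H0 \<otimes> y) \<cdot> ((amap H (ev L M) \<otimes> ident C ?H)
      \<cdot> H2 (?A \<boxtimes> M) ?A) \<cdot> ?w"
    by simp
  also have "(amap H (ev L M) \<otimes> ident C ?H) \<cdot> H2 (?A \<boxtimes> M) ?A
      = H2 \<one> ?A \<cdot> amap H (ev L M \<otimes> ident C ?A)"
    using H2_nat[of "ev L M" "ident C ?A"] by simp
  also have "(H0 \<otimes> y) \<cdot> (H2 \<one> ?A \<cdot> amap H (ev L M \<otimes> ident C ?A)) \<cdot> ?w
      = (H0 \<otimes> y) \<cdot> H2 \<one> ?A \<cdot> (amap H (ev L M \<otimes> ident C ?A) \<cdot> ?w)"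
    by simp
  also have "amap H (ev L M \<otimes> ident C ?A) \<cdot> ?w = ident C ?H"
    by (subst functor_cmp[symmetric]) simp_all
  also have "(H0 \<otimes> y) \<cdot> H2 \<one> ?A \<cdot> ident C ?H = (H0 \<otimes> y) \<cdot> H2 \<one> ?A" by simp
  also have "H0 \<otimes> y = y \<cdot> (H0 \<otimes> ident C ?H)"
    using scalar_slide(2)[of y H0] by simp
  also have "\<dots> \<cdot> H2 \<one> ?A = y \<cdot> (H0 \<otimes> ident C ?H) \<cdot> H2 \<one> ?A" by simp
  also have "\<dots> = y" by (simp add: H2_H0)
  finally have "(ev L M \<otimes> ident C ?A) \<cdot> (ident C ?A \<otimes> coev L M) \<cdot> x = y"
    unfolding 1 .
  moreover have "(ev L M \<otimes> ident C ?A) \<cdot> (ident C ?A \<otimes> coev L M) \<cdot> x = ((ev L M \<otimes> ident C ?A)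
      \<cdot> (ident C ?A \<otimes> coev L M)) \<cdot> x"
    by (rule cmp_assoc'[symmetric]) simp_all
  ultimately show ?thesis by simp
qed

end

sublocale bimonad \<subseteq> T: comonoidal_functor C T "T2 T" "T0 T"
proof
  show "is_functor C C T" using monad by (simp add: is_monad_def)
  show "T0 T \<in> arr C" "src C (T0 T) = omap T \<one>" "trg C (T0 T) = \<one>"
    using T0_hom by (simp_all add: in_hom)
next
  fix X Y assume "X \<in> obj C" "Y \<in> obj C"
  from T2_hom[OF this] show "T2 T X Y \<in> arr C" "src C (T2 T X Y) = omap T (X \<boxtimes> Y)"
    "trg C (T2 T X Y) = omap T X \<boxtimes> omap T Y"
    by (simp_all add: in_hom)
next
  fix f g assume "f \<in> arr C" "g \<in> arr C"
  then show "T2 T (trg C f) (trg C g) \<cdot> amap T (f \<otimes> g)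
      = (amap T f \<otimes> amap T g) \<cdot> T2 T (src C f) (src C g)"
    by (intro T2_natural) (simp_all add: in_hom)
qed (fact T2_coassoc T2_counit_right T2_counit_left)+

context bimonad begin

lemma mu_arr [simp]:
  assumes "X \<in> obj C"
  shows "mu T X \<in> arr C" "src C (mu T X) = omap T (omap T X)" "trg C (mu T X) = omap T X"
  using monad assms by (auto simp: is_monad_def nat_trans_def comp_functor_def in_hom)

lemma eta_arr [simp]:
  assumes "X \<in> obj C"
  shows "eta T X \<in> arr C" "src C (eta T X) = X" "trg C (eta T X) = omap T X"
  using monad assms by (auto simp: is_monad_def nat_trans_def id_functor_def in_hom)

lemma mu_natural: "f \<in> arr C \<Longrightarrow> mu T (trg C f) \<cdot> amap T (amap T f) = amap T f \<cdot> mu T (src C f)"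
  using monad unfolding is_monad_def nat_trans_def comp_functor_def by (auto simp: in_hom)

lemma eta_natural: "f \<in> arr C \<Longrightarrow> eta T (trg C f) \<cdot> f = amap T f \<cdot> eta T (src C f)"
  using monad unfolding is_monad_def nat_trans_def id_functor_def by (auto simp: in_hom)

lemma mu_laws:
  assumes "X \<in> obj C"
  shows "mu T X \<cdot> amap T (mu T X) = mu T X \<cdot> mu T (omap T X)"
    "mu T X \<cdot> eta T (omap T X) = ident C (omap T X)"
    "mu T X \<cdot> amap T (eta T X) = ident C (omap T X)"
  using monad assms by (auto simp: is_monad_def)

text \<open>With this structure on the square, the laws \<open>T2_mu\<close> and
  \<open>T0_mu\<close> say that \<open>mu T\<close> is comonoidal from the square to
  \<open>T\<close>. This is how the uniqueness of dual actions yields associativity in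
  \<open>dual_module\<close>.\<close>

lemma comonoidal_square:
  "comonoidal_functor C (comp_functor T T) (\<lambda>X Y. T2 T (omap T X) (omap T Y) \<cdot> amap T (T2 T X Y))
     (T0 T \<cdot> amap T (T0 T))"
proof
  show "is_functor C C (comp_functor T T)"
    using T.endofunctor unfolding is_functor_def comp_functor_def by (simp add: in_hom) 
next
  fix f g assume [simp]: "f \<in> arr C" "g \<in> arr C"
  let ?X = "src C f" and ?X' = "trg C f" and ?Y = "src C g" and ?Y' = "trg C g"
  have "(T2 T (omap T ?X') (omap T ?Y') \<cdot> amap T (T2 T ?X' ?Y')) \<cdot> amap T (amap T (f \<otimes> g))
     = T2 T (omap T ?X') (omap T ?Y') \<cdot> amap T (T2 T ?X' ?Y' \<cdot> amap T (f \<otimes> g))"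
    by (simp add: T.functor_cmp)
  also have "\<dots> = (T2 T (omap T ?X') (omap T ?Y') \<cdot> amap T (amap T f \<otimes> amap T g))
      \<cdot> amap T (T2 T ?X ?Y)"
    by (simp add: T.functor_cmp T.H2_nat)
  also have "T2 T (omap T ?X') (omap T ?Y') \<cdot> amap T (amap T f \<otimes> amap T g)
     = (amap T (amap T f) \<otimes> amap T (amap T g)) \<cdot> T2 T (omap T ?X) (omap T ?Y)"
    using T.H2_nat[of "amap T f" "amap T g"] by simp
  finally show "(T2 T (omap T ?X') (omap T ?Y') \<cdot> amap T (T2 T ?X' ?Y')) \<cdot> amap (comp_functor T T)
      (f \<otimes> g)
     = (amap (comp_functor T T) f \<otimes> amap (comp_functor T T) g) \<cdot> (T2 T (omap T ?X) (omap T ?Y) \<cdot>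
         amap T (T2 T ?X ?Y))"
    by (simp add: comp_functor_def)
next
  fix X Y Z assume [simp]: "X \<in> obj C" "Y \<in> obj C" "Z \<in> obj C"
  let ?X = "omap T X" and ?Y = "omap T Y" and ?Z = "omap T Z"
  have 1: "(ident C (omap T ?X) \<otimes> amap T (T2 T Y Z)) \<cdot> T2 T ?X (omap T (Y \<boxtimes> Z))
      = T2 T ?X (?Y \<boxtimes> ?Z) \<cdot> amap T (ident C ?X \<otimes> T2 T Y Z)"
    using T.H2_nat[of "ident C ?X" "T2 T Y Z"] by simp
  have 2: "(amap T (T2 T X Y) \<otimes> ident C (omap T ?Z)) \<cdot> T2 T (omap T (X \<boxtimes> Y)) ?Z
      = T2 T (?X \<boxtimes> ?Y) ?Z \<cdot> amap T (T2 T X Y \<otimes> ident C ?Z)"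
    using T.H2_nat[of "T2 T X Y" "ident C ?Z"] by simp
  have "(ident C (omap T ?X) \<otimes> (T2 T ?Y ?Z \<cdot> amap T (T2 T Y Z))) \<cdot> (T2 T ?X (omap T (Y \<boxtimes> Z))
      \<cdot> amap T (T2 T X (Y \<boxtimes> Z)))
     = (ident C (omap T ?X) \<otimes> T2 T ?Y ?Z) \<cdot> ((ident C (omap T ?X) \<otimes> amap T (T2 T Y Z)) \<cdot> T2 T ?X
         (omap T (Y \<boxtimes> Z))) \<cdot> amap T (T2 T X (Y \<boxtimes> Z))"
    by (simp add: fuses)
  also have "\<dots> = ((ident C (omap T ?X) \<otimes> T2 T ?Y ?Z) \<cdot> T2 T ?X (?Y \<boxtimes> ?Z))
      \<cdot> amap T ((ident C ?X \<otimes> T2 T Y Z) \<cdot> T2 T X (Y \<boxtimes> Z))"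
    unfolding 1 by (simp add: T.functor_cmp)
  also have "\<dots> = ((T2 T ?X ?Y \<otimes> ident C (omap T ?Z)) \<cdot> T2 T (?X \<boxtimes> ?Y) ?Z)
      \<cdot> amap T ((T2 T X Y \<otimes> ident C ?Z) \<cdot> T2 T (X \<boxtimes> Y) Z)"
    by (simp only: T.H2_assoc[of ?X ?Y ?Z] T.H2_assoc[of X Y Z] T.functor_obj \<open>X \<in> obj C\<close> \<open>Y \<in>
        obj C\<close> \<open>Z \<in> obj C\<close>)
  also have "\<dots> = (T2 T ?X ?Y \<otimes> ident C (omap T ?Z)) \<cdot> ((amap T (T2 T X Y) \<otimes> ident C (omap T ?Z))
      \<cdot> T2 T (omap T (X \<boxtimes> Y)) ?Z) \<cdot> amap T (T2 T (X \<boxtimes> Y) Z)"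
    unfolding 2 by (simp add: T.functor_cmp)
  also have "\<dots> = ((T2 T ?X ?Y \<cdot> amap T (T2 T X Y)) \<otimes> ident C (omap T ?Z))
      \<cdot> (T2 T (omap T (X \<boxtimes> Y)) ?Z \<cdot> amap T (T2 T (X \<boxtimes> Y) Z))"
    by (simp add: fuses)
  finally show "(ident C (omap (comp_functor T T) X) \<otimes> (T2 T ?Y ?Z \<cdot> amap T (T2 T Y Z))) \<cdot>
      (T2 T ?X (omap T (Y \<boxtimes> Z)) \<cdot> amap T (T2 T X (Y \<boxtimes> Z)))
    = ((T2 T ?X ?Y \<cdot> amap T (T2 T X Y)) \<otimes> ident C (omap (comp_functor T T) Z)) \<cdot>
      (T2 T (omap T (X \<boxtimes> Y)) ?Z \<cdot> amap T (T2 T (X \<boxtimes> Y) Z))"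
    by (simp add: comp_functor_def)
next
  fix X assume [simp]: "X \<in> obj C"
  let ?X = "omap T X"
  have "(ident C (omap T ?X) \<otimes> (T0 T \<cdot> amap T (T0 T))) \<cdot> (T2 T ?X (omap T \<one>) \<cdot> amap T (T2 T X \<one>))
     = (ident C (omap T ?X) \<otimes> T0 T) \<cdot> ((ident C (omap T ?X) \<otimes> amap T (T0 T)) \<cdot> T2 T ?X (omap T \<one>)) \<cdot>
         amap T (T2 T X \<one>)"
    by (simp add: fuses)
  also have "(ident C (omap T ?X) \<otimes> amap T (T0 T)) \<cdot> T2 T ?X (omap T \<one>)
      = T2 T ?X \<one> \<cdot> amap T (ident C ?X \<otimes> T0 T)"
    using T.H2_nat[of "ident C ?X" "T0 T"] by simp
  also have "(ident C (omap T ?X) \<otimes> T0 T) \<cdot> (T2 T ?X \<one> \<cdot> amap T (ident C ?X \<otimes> T0 T))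
      \<cdot> amap T (T2 T X \<one>)
     = ((ident C (omap T ?X) \<otimes> T0 T) \<cdot> T2 T ?X \<one>) \<cdot> amap T ((ident C ?X \<otimes> T0 T) \<cdot> T2 T X \<one>)"
    by (simp add: T.functor_cmp)
  also have "\<dots> = ident C (omap T ?X)"
    by (simp add: T.H2_H0)
  finally show "(ident C (omap (comp_functor T T) X) \<otimes> (T0 T \<cdot> amap T (T0 T))) \<cdot> (T2 T ?X (omap T \<one>)
      \<cdot> amap T (T2 T X \<one>))
     = ident C (omap (comp_functor T T) X)"
    by (simp add: comp_functor_def)
  have "((T0 T \<cdot> amap T (T0 T)) \<otimes> ident C (omap T ?X)) \<cdot> (T2 T (omap T \<one>) ?X \<cdot> amap T (T2 T \<one> X))
     = (T0 T \<otimes> ident C (omap T ?X)) \<cdot> ((amap T (T0 T) \<otimes> ident C (omap T ?X)) \<cdot> T2 T (omap T \<one>) ?X) \<cdot>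
         amap T (T2 T \<one> X)"
    by (simp add: fuses)
  also have "(amap T (T0 T) \<otimes> ident C (omap T ?X)) \<cdot> T2 T (omap T \<one>) ?X
      = T2 T \<one> ?X \<cdot> amap T (T0 T \<otimes> ident C ?X)"
    using T.H2_nat[of "T0 T" "ident C ?X"] by simp
  also have "(T0 T \<otimes> ident C (omap T ?X)) \<cdot> (T2 T \<one> ?X \<cdot> amap T (T0 T \<otimes> ident C ?X))
      \<cdot> amap T (T2 T \<one> X)
     = ((T0 T \<otimes> ident C (omap T ?X)) \<cdot> T2 T \<one> ?X) \<cdot> amap T ((T0 T \<otimes> ident C ?X) \<cdot> T2 T \<one> X)"
    by (simp add: T.functor_cmp)
  also have "\<dots> = ident C (omap T ?X)"
    by (simp add: T.H2_H0)
  finally show "((T0 T \<cdot> amap T (T0 T)) \<otimes> ident C (omap (comp_functor T T) X)) \<cdot> (T2 T (omap T \<one>) ?X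
      \<cdot> amap T (T2 T \<one> X))
     = ident C (omap (comp_functor T T) X)"
    by (simp add: comp_functor_def)
qed (simp_all add: comp_functor_def)

section \<open>The strict monoidal category of modules\<close>

abbreviation TC where "TC \<equiv> module_category C T"

text \<open>Written with projections rather than by matching on pairs, so that it also rewrites when
  the modules are variables.\<close>

abbreviation mtens where "mtens m n \<equiv> (fst m \<boxtimes> fst n, (snd m \<otimes> snd n) \<cdot> T2 T (fst m) (fst n))"

lemma TC_simps:
  "obj TC = modules C T" "arr TC = module_arrows C T" "src TC f = fst f" "trg TC f = snd (snd f)"
  "ident TC m = (m, ident C (fst m), m)" "\<one>\<^bsub>TC\<^esub> = (\<one>, T0 T)"
  "g \<cdot>\<^bsub>TC\<^esub> f = (fst f, fst (snd g) \<cdot> fst (snd f), snd (snd g))"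
  "m \<boxtimes>\<^bsub>TC\<^esub> n = mtens m n"
  "f \<otimes>\<^bsub>TC\<^esub> g = (mtens (fst f) (fst g), fst (snd f) \<otimes> fst (snd g), mtens (snd (snd f)) (snd
      (snd g)))"
  by (simp_all add: module_category_def Let_def split_beta)

lemma module_arrows_iff:
  "(m, f, n) \<in> module_arrows C T \<longleftrightarrow> m \<in> modules C T \<and> n \<in> modules C T \<and> f \<in> arr C \<and> src C f
      = fst m \<and> trg C f = fst n
    \<and> f \<cdot> snd m = snd n \<cdot> amap T f"
  by (cases m, cases n) (auto simp: module_arrows_def in_hom)

lemma module_simps [simp]:
  assumes "m \<in> modules C T"
  shows "fst m \<in> obj C" "snd m \<in> arr C" "src C (snd m) = omap T (fst m)" "trg C (snd m) = fst m"
  using assms by (cases m; simp add: modules_def in_hom)+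

lemma module_laws:
  assumes "m \<in> modules C T"
  shows "snd m \<cdot> amap T (snd m) = snd m \<cdot> mu T (fst m)" "snd m \<cdot> eta T (fst m) = ident C (fst m)"
  using assms by (cases m; simp add: modules_def)+

lemma modulesI:
  assumes "fst m \<in> obj C" "snd m \<in> arr C" "src C (snd m) = omap T (fst m)" "trg C (snd m) = fst m"
    and "snd m \<cdot> amap T (snd m) = snd m \<cdot> mu T (fst m)" "snd m \<cdot> eta T (fst m) = ident C (fst m)"
  shows "m \<in> modules C T"
  using assms by (cases m) (simp add: modules_def in_hom)

lemma mtens_module:
  assumes m: "m \<in> modules C T" and n: "n \<in> modules C T"
  shows "mtens m n \<in> modules C T"
proof -
  note [simp] = m n
  let ?M = "fst m" and ?N = "fst n" and ?r = "snd m" and ?s = "snd n"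
  let ?a = "(?r \<otimes> ?s) \<cdot> T2 T ?M ?N"
  have r: "?r \<cdot> amap T ?r = ?r \<cdot> mu T ?M" "?s \<cdot> amap T ?s = ?s \<cdot> mu T ?N"
    "?r \<cdot> eta T ?M = ident C ?M" "?s \<cdot> eta T ?N = ident C ?N"
    by (simp_all add: module_laws)
  have "?a \<cdot> amap T ?a = (?r \<otimes> ?s) \<cdot> (T2 T ?M ?N \<cdot> amap T (?r \<otimes> ?s)) \<cdot> amap T (T2 T ?M ?N)"
    by (simp add: T.functor_cmp)
  also have "T2 T ?M ?N \<cdot> amap T (?r \<otimes> ?s) = (amap T ?r \<otimes> amap T ?s) \<cdot> T2 T (omap T ?M) (omap T ?N)"
    using T.H2_nat[of ?r ?s] by simp
  also have "(?r \<otimes> ?s) \<cdot> ((amap T ?r \<otimes> amap T ?s) \<cdot> T2 T (omap T ?M) (omap T ?N))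
      \<cdot> amap T (T2 T ?M ?N)
     = (?r \<otimes> ?s) \<cdot> (mu T ?M \<otimes> mu T ?N) \<cdot> T2 T (omap T ?M) (omap T ?N) \<cdot> amap T (T2 T ?M ?N)"
    by (simp add: fuses r)
  also have "\<dots> = ?a \<cdot> mu T (?M \<boxtimes> ?N)"
    by (simp add: T2_mu)
  finally have 1: "?a \<cdot> amap T ?a = ?a \<cdot> mu T (?M \<boxtimes> ?N)" .
  have "?a \<cdot> eta T (?M \<boxtimes> ?N) = ident C (?M \<boxtimes> ?N)"
    by (simp add: T2_eta fuse r)
  with 1 show ?thesis
    by (intro modulesI) simp_all
qed

lemma unit_module: "(\<one>, T0 T) \<in> modules C T"
  by (rule modulesI) (simp_all add: T0_mu T0_eta)

lemma mtens_arrow: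
  assumes f: "(m, f, n) \<in> module_arrows C T" and g: "(m', g, n') \<in> module_arrows C T"
  shows "(mtens m m', f \<otimes> g, mtens n n') \<in> module_arrows C T"
proof -
  have [simp]: "m \<in> modules C T" "n \<in> modules C T" "m' \<in> modules C T" "n' \<in> modules C T"
    "f \<in> arr C" "src C f = fst m" "trg C f = fst n" "g \<in> arr C" "src C g = fst m'"
        "trg C g = fst n'"
    and l: "f \<cdot> snd m = snd n \<cdot> amap T f" "g \<cdot> snd m' = snd n' \<cdot> amap T g"
    using f g by (auto simp: module_arrows_iff)
  have "(f \<otimes> g) \<cdot> (snd m \<otimes> snd m') \<cdot> T2 T (fst m) (fst m')
     = (snd n \<otimes> snd n') \<cdot> (amap T f \<otimes> amap T g) \<cdot> T2 T (fst m) (fst m')"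
    by (simp add: fuses l)
  also have "(amap T f \<otimes> amap T g) \<cdot> T2 T (fst m) (fst m') = T2 T (fst n) (fst n') \<cdot> amap T (f \<otimes> g)"
    using T.H2_nat[of f g] by simp
  finally show ?thesis
    by (simp add: module_arrows_iff mtens_module)
qed

text \<open>Equality of the actions is the coassociativity of \<open>T2\<close>. In the same way
  \<open>mtens_unit\<close> is the counit law of \<open>T0\<close>.\<close>

lemma mtens_assoc:
  assumes [simp]: "m \<in> modules C T" "n \<in> modules C T" "p \<in> modules C T"
  shows "mtens (mtens m n) p = mtens m (mtens n p)"
proof -
  let ?M = "fst m" and ?N = "fst n" and ?P = "fst p"
  have e: "((snd m \<otimes> snd n) \<cdot> T2 T ?M ?N) \<otimes> snd p = (snd m \<otimes> snd n \<otimes> snd p)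
      \<cdot> (T2 T ?M ?N \<otimes> ident C (omap T ?P))"
    using fuse[of "T2 T ?M ?N" "snd m \<otimes> snd n" "ident C (omap T ?P)" "snd p"] by simp
  have "(((snd m \<otimes> snd n) \<cdot> T2 T ?M ?N) \<otimes> snd p) \<cdot> T2 T (?M \<boxtimes> ?N) ?P
     = (snd m \<otimes> snd n \<otimes> snd p) \<cdot> ((T2 T ?M ?N \<otimes> ident C (omap T ?P)) \<cdot> T2 T (?M \<boxtimes> ?N) ?P)"
    unfolding e by simp
  also have "(T2 T ?M ?N \<otimes> ident C (omap T ?P)) \<cdot> T2 T (?M \<boxtimes> ?N) ?P
      = (ident C (omap T ?M) \<otimes> T2 T ?N ?P) \<cdot> T2 T ?M (?N \<boxtimes> ?P)"
    by (rule T.H2_assoc[symmetric]) simp_all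
  also have "(snd m \<otimes> snd n \<otimes> snd p) \<cdot> \<dots> = (snd m \<otimes> ((snd n \<otimes> snd p) \<cdot> T2 T ?N ?P))
      \<cdot> T2 T ?M (?N \<boxtimes> ?P)"
    by (simp add: fuses)
  finally show ?thesis by simp
qed

lemma mtens_unit:
  assumes [simp]: "m \<in> modules C T"
  shows "mtens (\<one>, T0 T) m = m" "mtens m (\<one>, T0 T) = m"
proof -
  have "T0 T \<otimes> snd m = snd m \<cdot> (T0 T \<otimes> ident C (omap T (fst m)))" "snd m \<otimes> T0 T
      = snd m \<cdot> (ident C (omap T (fst m)) \<otimes> T0 T)"
    using scalar_slide[of "snd m" "T0 T"] by simp_all
  then show "mtens (\<one>, T0 T) m = m" "mtens m (\<one>, T0 T) = m"
    by (simp_all add: T.H2_H0)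
qed

lemma linear_ident: "m \<in> modules C T \<Longrightarrow> (m, ident C (fst m), m) \<in> module_arrows C T"
  by (simp add: module_arrows_iff)

lemma linear_cmp:
  assumes f: "(m, f, n) \<in> module_arrows C T" and g: "(n, g, p) \<in> module_arrows C T"
  shows "(m, g \<cdot> f, p) \<in> module_arrows C T"
proof -
  have [simp]: "m \<in> modules C T" "n \<in> modules C T" "p \<in> modules C T"
    "f \<in> arr C" "src C f = fst m" "trg C f = fst n" "g \<in> arr C" "src C g = fst n" "trg C g = fst p"
    and l: "f \<cdot> snd m = snd n \<cdot> amap T f" "g \<cdot> snd n = snd p \<cdot> amap T g"
    using f g by (auto simp: module_arrows_iff)
  have "g \<cdot> f \<cdot> snd m = (g \<cdot> snd n) \<cdot> amap T f" using l(1) by simp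
  then show ?thesis by (simp add: module_arrows_iff T.functor_cmp l(2))
qed

lemma hom_TC: "f \<in> hom TC m n \<longleftrightarrow> f \<in> module_arrows C T \<and> fst f = m \<and> snd (snd f) = n"
  by (simp add: hom_def TC_simps)

lemma in_module_arrowsE:
  assumes "f \<in> module_arrows C T"
  obtains m k n where "f = (m, k, n)" "m \<in> modules C T" "n \<in> modules C T" "k \<in> arr C"
      "src C k = fst m" "trg C k = fst n"
  using assms by (cases f) (auto simp: module_arrows_iff)

lemma strict_monoidal_TC: "strict_monoidal_category TC"
proof
  fix f assume "f \<in> arr TC"
  then show "src TC f \<in> obj TC" "trg TC f \<in> obj TC"
    by (auto simp: TC_simps elim: in_module_arrowsE)
next
  fix m assume "m \<in> obj TC"
  then show "ident TC m \<in> hom TC m m" by (simp add: TC_simps hom_TC linear_ident)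
next
  fix f g m n p assume fg: "f \<in> hom TC m n" "g \<in> hom TC n p"
  obtain f' g' where "f = (m, f', n)" "g = (n, g', p)"
    using fg by (cases f, cases g) (auto simp: hom_TC)
  with fg show "g \<cdot>\<^bsub>TC\<^esub> f \<in> hom TC m p"
    using linear_cmp[of m f' n g' p] by (simp add: TC_simps hom_TC)
next
  fix f g h m n p q assume "f \<in> hom TC m n" "g \<in> hom TC n p" "h \<in> hom TC p q"
  then show "(h \<cdot>\<^bsub>TC\<^esub> g) \<cdot>\<^bsub>TC\<^esub> f = h \<cdot>\<^bsub>TC\<^esub> (g \<cdot>\<^bsub>TC\<^esub> f)"
    by (auto simp: TC_simps hom_TC elim!: in_module_arrowsE)
next
  fix f m n assume "f \<in> hom TC m n"
  then show "f \<cdot>\<^bsub>TC\<^esub> ident TC m = f" "ident TC n \<cdot>\<^bsub>TC\<^esub> f = f"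
    by (auto simp: TC_simps hom_TC elim!: in_module_arrowsE)
next
  show "\<one>\<^bsub>TC\<^esub> \<in> obj TC" by (simp add: TC_simps unit_module)
next
  fix m n assume "m \<in> obj TC" "n \<in> obj TC"
  then show "m \<boxtimes>\<^bsub>TC\<^esub> n \<in> obj TC" "ident TC m \<otimes>\<^bsub>TC\<^esub> ident TC n = ident TC (m \<boxtimes>\<^bsub>TC\<^esub> n)"
    using mtens_module[of m n] by (simp_all add: TC_simps)
next
  fix f g m n m' n' assume fg: "f \<in> hom TC m m'" "g \<in> hom TC n n'"
  obtain f' g' where "f = (m, f', m')" "g = (n, g', n')"
    using fg by (cases f, cases g) (auto simp: hom_TC)
  with fg show "f \<otimes>\<^bsub>TC\<^esub> g \<in> hom TC (m \<boxtimes>\<^bsub>TC\<^esub> n) (m' \<boxtimes>\<^bsub>TC\<^esub> n')"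
    using mtens_arrow[of m f' m' n g' n'] by (simp add: TC_simps hom_TC)
next
  fix f f' g g' m m' m'' n n' n''
  assume "f \<in> hom TC m m'" "f' \<in> hom TC m' m''" "g \<in> hom TC n n'" "g' \<in> hom TC n' n''"
  then show "(f' \<cdot>\<^bsub>TC\<^esub> f) \<otimes>\<^bsub>TC\<^esub> (g' \<cdot>\<^bsub>TC\<^esub> g) = (f' \<otimes>\<^bsub>TC\<^esub> g') \<cdot>\<^bsub>TC\<^esub> (f \<otimes>\<^bsub>TC\<^esub> g)"
    by (auto simp: TC_simps hom_TC fuse elim!: in_module_arrowsE)
next
  fix m n p assume "m \<in> obj TC" "n \<in> obj TC" "p \<in> obj TC"
  then show "(m \<boxtimes>\<^bsub>TC\<^esub> n) \<boxtimes>\<^bsub>TC\<^esub> p = m \<boxtimes>\<^bsub>TC\<^esub> (n \<boxtimes>\<^bsub>TC\<^esub> p)"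
    using mtens_assoc by (simp only: TC_simps)
next
  fix f g h assume "f \<in> arr TC" "g \<in> arr TC" "h \<in> arr TC"
  then have m: "fst k \<in> modules C T" "snd (snd k) \<in> modules C T" "fst (snd k) \<in> arr C" if
      "k \<in> {f, g, h}" for k
    using that by (auto simp: TC_simps elim!: in_module_arrowsE)
  \<comment> \<open>Tensor products of modules stay folded in \<open>t\<close> and \<open>a\<close>;
    unfolding them would expose the nested actions, while only an equation between modules is
    wanted.\<close>
  have t: "k \<otimes>\<^bsub>TC\<^esub> k' = (fst k \<boxtimes>\<^bsub>TC\<^esub> fst k', fst (snd k) \<otimes> fst (snd k'), snd (snd k) \<boxtimes>\<^bsub>TC\<^esub> snd
      (snd k'))" for k k'
    by (simp add: TC_simps)
  have a: "(m \<boxtimes>\<^bsub>TC\<^esub> n) \<boxtimes>\<^bsub>TC\<^esub> p = m \<boxtimes>\<^bsub>TC\<^esub> (n \<boxtimes>\<^bsub>TC\<^esub> p)"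
    if "m \<in> modules C T" "n \<in> modules C T" "p \<in> modules C T" for m n p
    using mtens_assoc[OF that] by (simp only: TC_simps)
  show "(f \<otimes>\<^bsub>TC\<^esub> g) \<otimes>\<^bsub>TC\<^esub> h = f \<otimes>\<^bsub>TC\<^esub> (g \<otimes>\<^bsub>TC\<^esub> h)"
    by (simp add: t a m)
next
  fix m assume "m \<in> obj TC"
  then show "\<one>\<^bsub>TC\<^esub> \<boxtimes>\<^bsub>TC\<^esub> m = m" "m \<boxtimes>\<^bsub>TC\<^esub> \<one>\<^bsub>TC\<^esub> = m"
    using mtens_unit by (simp_all only: TC_simps)
next
  fix f assume "f \<in> arr TC"
  then have m: "fst f \<in> modules C T" "snd (snd f) \<in> modules C T" "fst (snd f) \<in> arr C"
    by (auto simp: TC_simps elim!: in_module_arrowsE)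
  show "ident TC \<one>\<^bsub>TC\<^esub> \<otimes>\<^bsub>TC\<^esub> f = f" "f \<otimes>\<^bsub>TC\<^esub> ident TC \<one>\<^bsub>TC\<^esub> = f"
    using mtens_unit[OF m(1)] mtens_unit[OF m(2)] m(3)
    by (simp_all add: TC_simps)
qed

end

section \<open>Duals of modules\<close>

sublocale hopf_monad \<subseteq> left_autonomous_category C L
  by unfold_locales (rule left_duals)

context hopf_monad begin

lemma antipode_arr [simp]:
  assumes "X \<in> obj C"
  shows "sl X \<in> arr C" "src C (sl X) = omap T (dual L (omap T X))" "trg C (sl X) = dual L X"
  using left_antipode assms by (auto simp: left_antipode_def in_hom)

lemma antipode_natural:
  "f \<in> arr C \<Longrightarrow> sl (src C f) \<cdot> amap T (ltr C L (amap T f)) = ltr C L f \<cdot> sl (trg C f)"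
  using left_antipode by (auto simp: left_antipode_def in_hom)

lemma antipode_ev:
  "X \<in> obj C \<Longrightarrow> T0 T \<cdot> amap T (ev L X) \<cdot> amap T (ltr C L (eta T X) \<otimes> ident C X)
    = ev L (omap T X) \<cdot> ((sl (omap T X) \<cdot> amap T (ltr C L (mu T X))) \<otimes> ident C (omap T X)) \<cdot> T2 T
        (dual L (omap T X)) X"
  using left_antipode by (auto simp: left_antipode_def)

lemma antipode_coev:
  "X \<in> obj C \<Longrightarrow> (eta T X \<otimes> ident C (dual L X)) \<cdot> coev L X \<cdot> T0 T
    = (mu T X \<otimes> sl X) \<cdot> T2 T (omap T X) (dual L (omap T X)) \<cdot> amap T (coev L (omap T X))"
  using left_antipode by (auto simp: left_antipode_def)

definition dual_action :: "'o \<times> 'a \<Rightarrow> 'a" where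
  "dual_action m = sl (fst m) \<cdot> amap T (ltr C L (snd m))"

lemma dual_action_arr [simp]:
  assumes "m \<in> modules C T"
  shows "dual_action m \<in> arr C" "src C (dual_action m) = omap T (dual L (fst m))"
    "trg C (dual_action m) = dual L (fst m)"
  using assms by (simp_all add: dual_action_def)

text \<open>The first antipode axiom is precomposed with the transpose of the action r. On one side
  the unit law r eta = id cancels it; on the other, r mu = r T(r) and naturality of
  \<open>sl\<close> at r turn \<open>sl (omap T (fst m))\<close> into the dual action. The outcome
  is linearity of the evaluation.\<close>

lemma dual_action_ev:
  assumes m [simp]: "m \<in> modules C T"
  shows "ev L (fst m) \<cdot> (dual_action m \<otimes> snd m) \<cdot> T2 T (dual L (fst m)) (fst m)
      = T0 T \<cdot> amap T (ev L (fst m))"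
proof -
  let ?M = "fst m" and ?r = "snd m"
  let ?A = "dual L ?M"
  have 1: "sl (omap T ?M) \<cdot> amap T (ltr C L (mu T ?M)) \<cdot> amap T (ltr C L ?r)
      = ltr C L ?r \<cdot> dual_action m"
  proof -
    have "amap T (ltr C L (mu T ?M)) \<cdot> amap T (ltr C L ?r) = amap T (ltr C L (?r \<cdot> mu T ?M))"
      by (simp add: ltr_cmp T.functor_cmp)
    also have "\<dots> = amap T (ltr C L (amap T ?r)) \<cdot> amap T (ltr C L ?r)"
      by (simp add: ltr_cmp T.functor_cmp flip: module_laws)
    also have "sl (omap T ?M) \<cdot> \<dots> = (sl (omap T ?M) \<cdot> amap T (ltr C L (amap T ?r)))
        \<cdot> amap T (ltr C L ?r)"
      by simp
    also have "\<dots> = ltr C L ?r \<cdot> dual_action m"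
      using antipode_natural[of ?r] by (simp add: dual_action_def)
    finally show ?thesis .
  qed
  have "amap T (ltr C L (eta T ?M) \<otimes> ident C ?M) \<cdot> amap T (ltr C L ?r \<otimes> ident C ?M)
      = amap T ((ltr C L (eta T ?M) \<cdot> ltr C L ?r) \<otimes> ident C ?M)"
    by (simp add: fuse flip: T.functor_cmp)
  also have "ltr C L (eta T ?M) \<cdot> ltr C L ?r = ident C ?A"
    by (simp add: module_laws flip: ltr_cmp)
  finally have 2: "amap T (ltr C L (eta T ?M) \<otimes> ident C ?M) \<cdot> amap T (ltr C L ?r \<otimes> ident C ?M)
      = ident C (omap T (?A \<boxtimes> ?M))"
    by simp
  have "T0 T \<cdot> amap T (ev L ?M) = T0 T \<cdot> amap T (ev L ?M)
      \<cdot> (amap T (ltr C L (eta T ?M) \<otimes> ident C ?M) \<cdot> amap T (ltr C L ?r \<otimes> ident C ?M))"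
    unfolding 2 by simp
  also have "\<dots> = (T0 T \<cdot> amap T (ev L ?M) \<cdot> amap T (ltr C L (eta T ?M) \<otimes> ident C ?M))
      \<cdot> amap T (ltr C L ?r \<otimes> ident C ?M)"
    by simp
  also have "\<dots> = (ev L (omap T ?M) \<cdot> ((sl (omap T ?M) \<cdot> amap T (ltr C L (mu T ?M))) \<otimes> ident C
      (omap T ?M)) \<cdot> T2 T (dual L (omap T ?M)) ?M) \<cdot> amap T (ltr C L ?r \<otimes> ident C ?M)"
    by (subst antipode_ev) simp_all
  also have "\<dots> = ev L (omap T ?M) \<cdot> ((sl (omap T ?M) \<cdot> amap T (ltr C L (mu T ?M))) \<otimes> ident C
      (omap T ?M)) \<cdot> (T2 T (dual L (omap T ?M)) ?M \<cdot> amap T (ltr C L ?r \<otimes> ident C ?M))"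
    by simp
  also have "T2 T (dual L (omap T ?M)) ?M \<cdot> amap T (ltr C L ?r \<otimes> ident C ?M)
      = (amap T (ltr C L ?r) \<otimes> ident C (omap T ?M)) \<cdot> T2 T ?A ?M"
    using T.H2_nat[of "ltr C L ?r" "ident C ?M"] by simp
  also have "ev L (omap T ?M) \<cdot> ((sl (omap T ?M) \<cdot> amap T (ltr C L (mu T ?M))) \<otimes> ident C
      (omap T ?M)) \<cdot> \<dots>
     = (ev L (omap T ?M) \<cdot> ((ltr C L ?r \<cdot> dual_action m) \<otimes> ident C (omap T ?M))) \<cdot> T2 T ?A ?M"
    by (simp add: fuses 1)
  also have "\<dots> = ev L ?M \<cdot> (dual_action m \<otimes> ?r) \<cdot> T2 T ?A ?M"
    using ev_ltr_cmp[of ?r "omap T ?M" "dual_action m"] by simp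
  finally show ?thesis ..
qed

text \<open>The transpose of the action r, moved through the coevaluation by
  \<open>coev_ltr\<close>, produces r T(r) = r mu. The second antipode axiom then applies, and r eta
  = id removes the remaining unit.\<close>

lemma dual_action_coev:
  assumes m [simp]: "m \<in> modules C T"
  shows "(snd m \<otimes> dual_action m) \<cdot> T2 T (fst m) (dual L (fst m)) \<cdot> amap T (coev L (fst m))
      = coev L (fst m) \<cdot> T0 T"
proof -
  let ?M = "fst m" and ?r = "snd m"
  let ?A = "dual L ?M" and ?TM = "omap T ?M"
  let ?B = "dual L ?TM"
  have "(?r \<otimes> dual_action m) \<cdot> T2 T ?M ?A \<cdot> amap T (coev L ?M)
      = (?r \<otimes> sl ?M) \<cdot> ((ident C ?TM \<otimes> amap T (ltr C L ?r)) \<cdot> T2 T ?M ?A) \<cdot> amap T (coev L ?M)"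
    by (simp add: fuses dual_action_def)
  also have "(ident C ?TM \<otimes> amap T (ltr C L ?r)) \<cdot> T2 T ?M ?A
      = T2 T ?M ?B \<cdot> amap T (ident C ?M \<otimes> ltr C L ?r)"
    using T.H2_nat[of "ident C ?M" "ltr C L ?r"] by simp
  also have "(?r \<otimes> sl ?M) \<cdot> \<dots> \<cdot> amap T (coev L ?M) = (?r \<otimes> sl ?M) \<cdot> T2 T ?M ?B
      \<cdot> amap T ((ident C ?M \<otimes> ltr C L ?r) \<cdot> coev L ?M)"
    by (simp add: T.functor_cmp)
  also have "(ident C ?M \<otimes> ltr C L ?r) \<cdot> coev L ?M = (?r \<otimes> ident C ?B) \<cdot> coev L ?TM"
    by (rule coev_ltr[symmetric]) simp_all
  also have "(?r \<otimes> sl ?M) \<cdot> T2 T ?M ?B \<cdot> amap T \<dots> = (?r \<otimes> sl ?M) \<cdot> (T2 T ?M ?B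
      \<cdot> amap T (?r \<otimes> ident C ?B)) \<cdot> amap T (coev L ?TM)"
    by (simp add: T.functor_cmp)
  also have "T2 T ?M ?B \<cdot> amap T (?r \<otimes> ident C ?B) = (amap T ?r \<otimes> ident C (omap T ?B))
      \<cdot> T2 T ?TM ?B"
    using T.H2_nat[of ?r "ident C ?B"] by simp
  also have "(?r \<otimes> sl ?M) \<cdot> \<dots> \<cdot> amap T (coev L ?TM) = ((?r \<cdot> amap T ?r) \<otimes> sl ?M) \<cdot> T2 T ?TM ?B
      \<cdot> amap T (coev L ?TM)"
    by (simp add: fuses)
  also have "\<dots> = (?r \<otimes> ident C ?A) \<cdot> ((mu T ?M \<otimes> sl ?M) \<cdot> T2 T ?TM ?B \<cdot> amap T (coev L ?TM))"
    by (simp add: fuses module_laws)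
  also have "\<dots> = (?r \<otimes> ident C ?A) \<cdot> ((eta T ?M \<otimes> ident C ?A) \<cdot> coev L ?M \<cdot> T0 T)"
    by (subst antipode_coev) simp_all
  also have "\<dots> = coev L ?M \<cdot> T0 T"
    by (simp add: fuses module_laws)
  finally show ?thesis .
qed

text \<open>Both sides of the associativity law for the dual action d are candidates for the dual of
  one and the same arrow r mu = r T(r) out of the square of \<open>T\<close>. The arrow d mu
  respects evaluation because \<open>mu T\<close> is comonoidal, and d T(d) respects coevaluation
  because coevaluation is linear. Uniqueness for the square identifies them.\<close>

lemma dual_module:
  assumes m [simp]: "m \<in> modules C T"
  shows "(dual L (fst m), dual_action m) \<in> modules C T"
proof (rule modulesI; simp)
  let ?M = "fst m" and ?r = "snd m" and ?d = "dual_action m"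
  let ?A = "dual L ?M" and ?TM = "omap T ?M"
  show "?d \<cdot> eta T ?A = ident C ?A"
  proof (rule ev_inj[of ?M])
    \<comment> \<open>The identity of \<open>fst m\<close> is replaced by r eta, so that both
      factors carry a unit and \<open>T2_eta\<close> applies.\<close>
    have "ev L ?M \<cdot> ((?d \<cdot> eta T ?A) \<otimes> ident C ?M) = ev L ?M \<cdot> ((?d \<cdot> eta T ?A) \<otimes> (?r \<cdot> eta T ?M))"
      by (simp add: module_laws)
    also have "\<dots> = (ev L ?M \<cdot> (?d \<otimes> ?r) \<cdot> T2 T ?A ?M) \<cdot> eta T (?A \<boxtimes> ?M)"
      by (simp add: T2_eta fuse)
    also have "\<dots> = (T0 T \<cdot> amap T (ev L ?M)) \<cdot> eta T (?A \<boxtimes> ?M)"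
      by (subst dual_action_ev) simp_all
    also have "\<dots> = T0 T \<cdot> (eta T \<one> \<cdot> ev L ?M)"
      using eta_natural[of "ev L ?M"] by simp
    also have "\<dots> = (T0 T \<cdot> eta T \<one>) \<cdot> ev L ?M" by simp
    finally show "ev L ?M \<cdot> ((?d \<cdot> eta T ?A) \<otimes> ident C ?M) = ev L ?M \<cdot> (ident C ?A \<otimes> ident C ?M)"
      by (simp add: T0_eta)
  qed simp_all
  interpret TT: comonoidal_functor C "comp_functor T T"
      "\<lambda>X Y. T2 T (omap T X) (omap T Y) \<cdot> amap T (T2 T X Y)"
    "T0 T \<cdot> amap T (T0 T)"
    by (rule comonoidal_square)
  have [simp]: "omap (comp_functor T T) X = omap T (omap T X)" "amap (comp_functor T T) f
      = amap T (amap T f)" for X f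
    by (simp_all add: comp_functor_def)
  have "?d \<cdot> mu T ?A = ?d \<cdot> amap T ?d"
  proof (rule TT.dual_action_unique[OF duals, of ?M "?r \<cdot> mu T ?M"])
    have "ev L ?M \<cdot> ((?d \<cdot> mu T ?A) \<otimes> (?r \<cdot> mu T ?M)) \<cdot> T2 T (omap T ?A) (omap T ?M)
        \<cdot> amap T (T2 T ?A ?M)
       = ev L ?M \<cdot> (?d \<otimes> ?r) \<cdot> ((mu T ?A \<otimes> mu T ?M) \<cdot> T2 T (omap T ?A) (omap T ?M) \<cdot> amap T (T2 T ?A
           ?M))"
      by (simp add: fuses)
    also have "\<dots> = ev L ?M \<cdot> (?d \<otimes> ?r) \<cdot> (T2 T ?A ?M \<cdot> mu T (?A \<boxtimes> ?M))"
      by (simp only: T2_mu dual_simps module_simps m)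
    also have "\<dots> = (ev L ?M \<cdot> (?d \<otimes> ?r) \<cdot> T2 T ?A ?M) \<cdot> mu T (?A \<boxtimes> ?M)"
      by simp
    also have "\<dots> = T0 T \<cdot> (amap T (ev L ?M) \<cdot> mu T (?A \<boxtimes> ?M))"
      by (simp add: dual_action_ev)
    also have "\<dots> = T0 T \<cdot> (mu T \<one> \<cdot> amap T (amap T (ev L ?M)))"
      using mu_natural[of "ev L ?M"] by simp
    also have "\<dots> = (T0 T \<cdot> mu T \<one>) \<cdot> amap T (amap T (ev L ?M))" by simp
    also have "\<dots> = T0 T \<cdot> amap T (T0 T) \<cdot> amap T (amap T (ev L ?M))"
      by (simp add: T0_mu)
    finally show "ev L ?M \<cdot> ((?d \<cdot> mu T ?A) \<otimes> (?r \<cdot> mu T ?M)) \<cdot> T2 T (omap T ?A) (omap T ?M)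
        \<cdot> amap T (T2 T ?A ?M)
       = (T0 T \<cdot> amap T (T0 T)) \<cdot> amap (comp_functor T T) (ev L ?M)"
      by simp
    \<comment> \<open>Rewriting r mu as r T(r) allows linearity of the coevaluation to be used
      twice, the first time under \<open>amap T\<close>.\<close>
    have "((?r \<cdot> mu T ?M) \<otimes> (?d \<cdot> amap T ?d)) \<cdot> (T2 T ?TM (omap T ?A) \<cdot> amap T (T2 T ?M ?A))
        \<cdot> amap T (amap T (coev L ?M))
       = (?r \<otimes> ?d) \<cdot> ((amap T ?r \<otimes> amap T ?d) \<cdot> T2 T ?TM (omap T ?A)) \<cdot> amap T (T2 T ?M ?A \<cdot> amap T
           (coev L ?M))"
      by (simp add: fuses T.functor_cmp module_laws)
    also have "(amap T ?r \<otimes> amap T ?d) \<cdot> T2 T ?TM (omap T ?A) = T2 T ?M ?A \<cdot> amap T (?r \<otimes> ?d)"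
      using T.H2_nat[of ?r ?d] by simp
    also have "(?r \<otimes> ?d) \<cdot> \<dots> \<cdot> amap T (T2 T ?M ?A \<cdot> amap T (coev L ?M))
       = (?r \<otimes> ?d) \<cdot> T2 T ?M ?A \<cdot> amap T ((?r \<otimes> ?d) \<cdot> T2 T ?M ?A \<cdot> amap T (coev L ?M))"
      by (simp add: T.functor_cmp)
    also have "\<dots> = (?r \<otimes> ?d) \<cdot> T2 T ?M ?A \<cdot> amap T (coev L ?M \<cdot> T0 T)"
      by (simp only: dual_action_coev[OF m])
    also have "\<dots> = ((?r \<otimes> ?d) \<cdot> T2 T ?M ?A \<cdot> amap T (coev L ?M)) \<cdot> amap T (T0 T)"
      by (simp add: T.functor_cmp)
    also have "\<dots> = coev L ?M \<cdot> T0 T \<cdot> amap T (T0 T)"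
      by (subst dual_action_coev) simp_all
    finally show "((?r \<cdot> mu T ?M) \<otimes> (?d \<cdot> amap T ?d)) \<cdot> (T2 T ?TM (omap T ?A) \<cdot> amap T (T2 T ?M ?A))
        \<cdot> amap (comp_functor T T) (coev L ?M)
       = coev L ?M \<cdot> (T0 T \<cdot> amap T (T0 T))"
      by simp
  qed simp_all
  then show "?d \<cdot> amap T ?d = ?d \<cdot> mu T ?A" ..
qed

definition module_duals :: "('o \<times> 'a, ('o \<times> 'a) \<times> 'a \<times> ('o \<times> 'a)) dual_data" where
  "module_duals = (let d = (\<lambda>m. (dual L (fst m), dual_action m)) in
     \<lparr>dual = d, ev = (\<lambda>m. (mtens (d m) m, ev L (fst m), (\<one>, T0 T))),
      coev = (\<lambda>m. ((\<one>, T0 T), coev L (fst m), mtens m (d m)))\<rparr>)"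

lemma module_duals_simps:
  "dual module_duals m = (dual L (fst m), dual_action m)"
  "ev module_duals m = (mtens (dual L (fst m), dual_action m) m, ev L (fst m), (\<one>, T0 T))"
  "coev module_duals m = ((\<one>, T0 T), coev L (fst m), mtens m (dual L (fst m), dual_action m))"
  by (simp_all add: module_duals_def Let_def)

sublocale TC: strict_monoidal_category TC
  by (rule strict_monoidal_TC)

text \<open>The zigzag identities are those of \<open>C\<close>. The antipode enters through
  \<open>dual_module\<close> and the linearity of evaluation and coevaluation; strict associativity
  makes the stored source and target modules agree.\<close>

lemma left_duals_TC: "left_duals TC module_duals"
  unfolding left_duals_def
proof (intro ballI conjI)
  fix m assume "m \<in> obj TC"
  then have m [simp]: "m \<in> modules C T" by (simp add: TC_simps)
  let ?d = "(dual L (fst m), dual_action m)"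
  have [simp]: "?d \<in> modules C T" by (rule dual_module) simp
  show "dual module_duals m \<in> obj TC" by (simp add: module_duals_simps TC_simps)
  have "mtens ?d m \<in> modules C T" by (rule mtens_module) simp_all
  moreover have "mtens m ?d \<in> modules C T" by (rule mtens_module) simp_all
  ultimately show "ev module_duals m \<in> hom TC (dual module_duals m \<boxtimes>\<^bsub>TC\<^esub> m) \<one>\<^bsub>TC\<^esub>"
    "coev module_duals m \<in> hom TC \<one>\<^bsub>TC\<^esub> (m \<boxtimes>\<^bsub>TC\<^esub> dual module_duals m)"
    by (simp_all add: module_duals_simps TC_simps hom_TC module_arrows_iff unit_module
        dual_action_ev dual_action_coev)
  have "mtens (mtens m ?d) m = mtens m (mtens ?d m)" "mtens (mtens ?d m) ?d = mtens ?d (mtens m ?d)"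
    by (rule mtens_assoc; simp)+
  with mtens_unit[of m] mtens_unit[of ?d]
  show "(ident TC m \<otimes>\<^bsub>TC\<^esub> ev module_duals m) \<cdot>\<^bsub>TC\<^esub> (coev module_duals m \<otimes>\<^bsub>TC\<^esub> ident TC m)
      = ident TC m"
    "(ev module_duals m \<otimes>\<^bsub>TC\<^esub> ident TC (dual module_duals m))
        \<cdot>\<^bsub>TC\<^esub> (ident TC (dual module_duals m) \<otimes>\<^bsub>TC\<^esub> coev module_duals m)
       = ident TC (dual module_duals m)"
    by (simp_all add: module_duals_simps TC_simps)
qed

sublocale TC: left_autonomous_category TC module_duals
  by unfold_locales (rule left_duals_TC)

end

section \<open>The square of the antipode\<close>

context left_autonomous_category begin

text \<open>
  The inverse of a monoidal transformation at \<open>X\<close> is the transpose of its component at the dual of \<open>X\<close>.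
\<close>

lemma dual_inverse:
  assumes [simp]: "X \<in> obj C"
    and [simp]: "\<alpha> \<in> arr C" "src C \<alpha> = X" "trg C \<alpha> = X"
    and [simp]: "\<alpha>' \<in> arr C" "src C \<alpha>' = dual L X" "trg C \<alpha>' = dual L X"
    and e: "ev L X \<cdot> (\<alpha>' \<otimes> \<alpha>) = ev L X" and c: "(\<alpha> \<otimes> \<alpha>') \<cdot> coev L X = coev L X"
  defines "\<beta> \<equiv> (ident C X \<otimes> ev L X) \<cdot> (ident C X \<otimes> \<alpha>' \<otimes> ident C X) \<cdot> (coev L X \<otimes> ident C X)"
  shows "\<alpha> \<cdot> \<beta> = ident C X" "\<beta> \<cdot> \<alpha> = ident C X"
proof -
  let ?A = "dual L X"
  have "\<alpha> \<cdot> \<beta> = (\<alpha> \<cdot> (ident C X \<otimes> ev L X)) \<cdot> (ident C X \<otimes> \<alpha>' \<otimes> ident C X) \<cdot> (coev L X \<otimes> ident C X)"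
    by (simp add: \<beta>_def)
  also have "\<alpha> \<cdot> (ident C X \<otimes> ev L X) = (ident C X \<otimes> ev L X) \<cdot> (\<alpha> \<otimes> ident C ?A \<otimes> ident C X)"
    using scalar_slide(1)[of \<alpha> "ev L X"] fuse[of \<alpha> "ident C X" "ident C ?A \<otimes> ident C X"
        "ev L X"] by simp
  also have "\<dots> \<cdot> (ident C X \<otimes> \<alpha>' \<otimes> ident C X) \<cdot> (coev L X \<otimes> ident C X)
      = (ident C X \<otimes> ev L X) \<cdot> (((\<alpha> \<otimes> \<alpha>') \<otimes> ident C X) \<cdot> (coev L X \<otimes> ident C X))"
    by (simp add: fuses)
  also have "((\<alpha> \<otimes> \<alpha>') \<otimes> ident C X) \<cdot> (coev L X \<otimes> ident C X) = coev L X \<otimes> ident C X"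
    by (subst fuse) (simp_all add: c del: tensa_assoc)
  finally show "\<alpha> \<cdot> \<beta> = ident C X" by simp
  have "\<beta> \<cdot> \<alpha> = (ident C X \<otimes> ev L X) \<cdot> (ident C X \<otimes> \<alpha>' \<otimes> ident C X) \<cdot> ((coev L X \<otimes> ident C X) \<cdot> \<alpha>)"
    by (simp add: \<beta>_def)
  also have "(coev L X \<otimes> ident C X) \<cdot> \<alpha> = (ident C X \<otimes> ident C ?A \<otimes> \<alpha>) \<cdot> (coev L X \<otimes> ident C X)"
    using coscalar_slide(2)[of \<alpha> "coev L X"] fuse[of "coev L X" "ident C X \<otimes> ident C ?A"
        "ident C X" \<alpha>] by simp
  also have "(ident C X \<otimes> ev L X) \<cdot> (ident C X \<otimes> \<alpha>' \<otimes> ident C X) \<cdot> \<dots>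
      = (ident C X \<otimes> (ev L X \<cdot> (\<alpha>' \<otimes> \<alpha>))) \<cdot> (coev L X \<otimes> ident C X)"
    by (simp add: fuses)
  also have "\<dots> = ident C X" by (simp add: e)
  finally show "\<beta> \<cdot> \<alpha> = ident C X" .
qed

lemma pivotal_inv_arr:
  assumes \<psi>: "pivotal \<psi>" and X: "X \<in> obj C"
  shows "inv_arr C (\<psi> X) \<in> arr C" "src C (inv_arr C (\<psi> X)) = dual L (dual L X)"
    "trg C (inv_arr C (\<psi> X)) = X"
    "inv_arr C (\<psi> X) \<cdot> \<psi> X = ident C X" "\<psi> X \<cdot> inv_arr C (\<psi> X) = ident C (dual L (dual L X))"
proof -
  obtain \<beta> where b: "\<beta> \<in> arr C" "src C \<beta> = dual L (dual L X)" "trg C \<beta> = X"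
    "\<beta> \<cdot> \<psi> X = ident C X" "\<psi> X \<cdot> \<beta> = ident C (dual L (dual L X))"
    using pivotal_inverse[OF \<psi> X] .
  have "inv_arr C (\<psi> X) = \<beta>"
    using b tev_arr[where \<psi>=\<psi>, OF X pivotalD(1)[OF \<psi> X]] by (intro inv_arr_eqI) simp_all
  with b show "inv_arr C (\<psi> X) \<in> arr C" "src C (inv_arr C (\<psi> X)) = dual L (dual L X)"
    "trg C (inv_arr C (\<psi> X)) = X"
    "inv_arr C (\<psi> X) \<cdot> \<psi> X = ident C X" "\<psi> X \<cdot> inv_arr C (\<psi> X) = ident C (dual L (dual L X))"
    by simp_all
qed

lemma pivotal_cancel:
  assumes \<psi>: "pivotal \<psi>" and X: "X \<in> obj C" and f: "f \<in> arr C" "trg C f = X" and g: "g \<in> arr C"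
      "trg C g = X"
  shows "\<psi> X \<cdot> f = \<psi> X \<cdot> g \<longleftrightarrow> f = g"
proof
  note [simp] = tev_arr[where \<psi>=\<psi>, OF X pivotalD(1)[OF \<psi> X]] pivotal_inv_arr[OF \<psi> X]
  assume "\<psi> X \<cdot> f = \<psi> X \<cdot> g"
  moreover have "inv_arr C (\<psi> X) \<cdot> (\<psi> X \<cdot> h) = h" if "h \<in> arr C" "trg C h = X" for h
    using that cmp_assoc'[of h "\<psi> X" "inv_arr C (\<psi> X)"] X by simp
  ultimately show "f = g" using f g by metis
qed simp

lemma tev_cancel:
  assumes \<psi>: "pivotal \<psi>" and X: "X \<in> obj C" and f: "f \<in> arr C" "trg C f = X" and g: "g \<in> arr C"
      "trg C g = X"
    and s: "src C f = src C g"
    and eq: "tev \<psi> X \<cdot> (f \<otimes> ident C (dual L X)) = tev \<psi> X \<cdot> (g \<otimes> ident C (dual L X))"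
  shows "f = g"
proof -
  note [simp] = tev_arr[where \<psi>=\<psi>, OF X pivotalD(1)[OF \<psi> X]] X f g
  have "ev L (dual L X) \<cdot> ((\<psi> X \<cdot> f) \<otimes> ident C (dual L X)) = ev L (dual L X) \<cdot> ((\<psi> X
      \<cdot> g) \<otimes> ident C (dual L X))"
    using eq by (simp add: tev_def fuse)
  then have "\<psi> X \<cdot> f = \<psi> X \<cdot> g"
    using s ev_inj[of "dual L X" "\<psi> X \<cdot> f" "\<psi> X \<cdot> g"] by simp
  then show ?thesis by (simp add: pivotal_cancel[OF \<psi>])
qed

text \<open>Twisting a pivotal pairing by endomorphisms keeps it multiplicative exactly if the
  endomorphisms are multiplicative. By multiplicativity of \<open>\<psi>\<close>, both sides are the
  pairing of \<open>X \<boxtimes> Y\<close> applied to \<open>\<gamma>\<close>, respectively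
  \<open>\<alpha> \<otimes> \<beta>\<close>, and \<open>ldual_mult\<close>; the latter is cancelled
  by its inverse.\<close>

lemma tev_mult_cancel:
  assumes \<psi>: "pivotal \<psi>" and [simp]: "X \<in> obj C" "Y \<in> obj C"
    and [simp]: "\<alpha> \<in> arr C" "src C \<alpha> = X" "trg C \<alpha> = X" "\<beta> \<in> arr C" "src C \<beta> = Y" "trg C \<beta> = Y"
      "\<gamma> \<in> arr C" "src C \<gamma> = X \<boxtimes> Y" "trg C \<gamma> = X \<boxtimes> Y"
  shows "(tev \<psi> (X \<boxtimes> Y) \<cdot> (\<gamma> \<otimes> ident C (dual L (X \<boxtimes> Y)))) \<cdot> (ident C (X \<boxtimes> Y) \<otimes> ldual_mult C L X Y)
      = (tev \<psi> X \<cdot> (\<alpha> \<otimes> ident C (dual L X))) \<cdot> (ident C X \<otimes> (tev \<psi> Y \<cdot> (\<beta> \<otimes> ident C (dual L Y))) \<otimes>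
          ident C (dual L X))
    \<longleftrightarrow> \<gamma> = \<alpha> \<otimes> \<beta>" (is "?l = ?r \<longleftrightarrow> _")
proof -
  note [simp] = tev_arr[where \<psi>=\<psi>, OF _ pivotalD(1)[OF \<psi>]]
  let ?A = "dual L X" and ?B = "dual L Y" and ?m = "ldual_mult C L X Y" and ?Z = "dual L (X \<boxtimes> Y)"
  obtain n where n [simp]: "n \<in> arr C" "src C n = dual L (X \<boxtimes> Y)" "trg C n = ?B \<boxtimes> ?A"
    and mn: "?m \<cdot> n = ident C (dual L (X \<boxtimes> Y))"
    using ldual_mult_inverse[of X Y] by auto
  have l: "?l = tev \<psi> (X \<boxtimes> Y) \<cdot> (\<gamma> \<otimes> ?m)"
    using fuse[of "ident C (X \<boxtimes> Y)" \<gamma> ?m "ident C ?Z"] by simp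
  have "?r = tev \<psi> X \<cdot> (\<alpha> \<otimes> (tev \<psi> Y \<cdot> (\<beta> \<otimes> ident C ?B)) \<otimes> ident C ?A)"
    by (simp add: fuse)
  also have "\<alpha> \<otimes> (tev \<psi> Y \<cdot> (\<beta> \<otimes> ident C ?B)) \<otimes> ident C ?A
      = (ident C X \<otimes> tev \<psi> Y \<otimes> ident C ?A) \<cdot> (\<alpha> \<otimes> \<beta> \<otimes> ident C ?B \<otimes> ident C ?A)"
    using fuse[of "\<beta> \<otimes> ident C ?B" "tev \<psi> Y" "ident C ?A" "ident C ?A"]
      fuse[of \<alpha> "ident C X" "\<beta> \<otimes> ident C ?B \<otimes> ident C ?A" "tev \<psi> Y \<otimes> ident C ?A"] by simp
  also have "tev \<psi> X \<cdot> \<dots> = (tev \<psi> X \<cdot> (ident C X \<otimes> tev \<psi> Y \<otimes> ident C ?A))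
      \<cdot> (\<alpha> \<otimes> \<beta> \<otimes> ident C ?B \<otimes> ident C ?A)"
    by simp
  also have "\<dots> = (tev \<psi> (X \<boxtimes> Y) \<cdot> (ident C (X \<boxtimes> Y) \<otimes> ?m)) \<cdot> (\<alpha> \<otimes> \<beta> \<otimes> ident C ?B \<otimes> ident C ?A)"
    by (subst pivotalD(3)[OF \<psi>]) simp_all
  also have "\<dots> = tev \<psi> (X \<boxtimes> Y) \<cdot> ((\<alpha> \<otimes> \<beta>) \<otimes> ?m)"
    using fuse[of "\<alpha> \<otimes> \<beta>" "ident C (X \<boxtimes> Y)" "ident C ?B \<otimes> ident C ?A" ?m] by simp
  finally have r: "?r = tev \<psi> (X \<boxtimes> Y) \<cdot> ((\<alpha> \<otimes> \<beta>) \<otimes> ?m)" .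
  show ?thesis
  proof
    assume "?l = ?r"
    then have eq: "tev \<psi> (X \<boxtimes> Y) \<cdot> (\<gamma> \<otimes> ?m) = tev \<psi> (X \<boxtimes> Y) \<cdot> ((\<alpha> \<otimes> \<beta>) \<otimes> ?m)" unfolding l r .
    have k: "tev \<psi> (X \<boxtimes> Y) \<cdot> (\<delta> \<otimes> ident C ?Z) = (tev \<psi> (X \<boxtimes> Y) \<cdot> (\<delta> \<otimes> ?m)) \<cdot> (ident C (X \<boxtimes> Y) \<otimes> n)"
      if "\<delta> \<in> arr C" "src C \<delta> = X \<boxtimes> Y" "trg C \<delta> = X \<boxtimes> Y" for \<delta>
      using that fuse[of "ident C (X \<boxtimes> Y)" \<delta> n ?m] mn by simp
    show "\<gamma> = \<alpha> \<otimes> \<beta>"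
    proof (rule tev_cancel[OF \<psi>, of "X \<boxtimes> Y"])
      show "tev \<psi> (X \<boxtimes> Y) \<cdot> (\<gamma> \<otimes> ident C ?Z) = tev \<psi> (X \<boxtimes> Y) \<cdot> ((\<alpha> \<otimes> \<beta>) \<otimes> ident C ?Z)"
        using k[of \<gamma>] k[of "\<alpha> \<otimes> \<beta>"] eq by simp
    qed simp_all
  next
    assume "\<gamma> = \<alpha> \<otimes> \<beta>"
    then show "?l = ?r" unfolding l r by (simp only:)
  qed
qed

lemma pivotal_natural:
  assumes \<psi>: "pivotal \<psi>" and f: "f \<in> arr C" "src C f = X" "trg C f = Y"
  shows "\<psi> Y \<cdot> f = ltr C L (ltr C L f) \<cdot> \<psi> X"
  using tev_natural_iff[of \<psi> f X Y, OF pivotalD(1)[OF \<psi>] f] pivotalD(2)[OF \<psi> f] by simp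

end

section \<open>The square of the antipode and actions on double duals\<close>

locale sovereign_hopf_monad = hopf_monad C L R T sl sr
  for C :: "('o, 'a) moncat" (structure) and L R T sl sr and \<phi> :: "'o \<Rightarrow> 'a" +
  assumes sovereign: "(L, \<phi>) \<in> sovereign_structures C"
begin

lemma pivotal_phi: "pivotal \<phi>"
  using sovereign by (simp add: sovereign_structures_iff)

lemmas phi_arr [simp] = tev_arr[where \<psi>=\<phi>, OF _ pivotalD(1)[OF pivotal_phi]]
lemmas phi_inv [simp] = pivotal_inv_arr[OF pivotal_phi]
lemmas phi_natural = pivotal_natural[OF pivotal_phi]
lemmas phi_cancel = pivotal_cancel[OF pivotal_phi]

abbreviation S2 where "S2 \<equiv> antipode_square C L \<phi> T sl"

lemma S2_arr [simp]:
  assumes "X \<in> obj C"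
  shows "S2 X \<in> arr C" "src C (S2 X) = omap T X" "trg C (S2 X) = omap T X"
  using assms by (simp_all add: antipode_square_def)

lemma phi_S2:
  assumes "X \<in> obj C"
  shows "\<phi> (omap T X) \<cdot> S2 X = sl (dual L (omap T X)) \<cdot> amap T (ltr C L (sl X)) \<cdot> amap T (\<phi> X)"
proof -
  let ?k = "sl (dual L (omap T X)) \<cdot> amap T (ltr C L (sl X)) \<cdot> amap T (\<phi> X)"
  have "\<phi> (omap T X) \<cdot> S2 X = (\<phi> (omap T X) \<cdot> inv_arr C (\<phi> (omap T X))) \<cdot> ?k"
    using assms by (simp add: antipode_square_def del: phi_inv(5))
  then show ?thesis using assms by simp
qed

text \<open>Contravariant naturality of \<open>sl\<close> is used twice: transposed at
  \<open>f\<close>, then at \<open>ltr C L (amap T f)\<close>. Naturality of \<open>\<phi>\<close>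
  brings the double transposes back to \<open>f\<close> and \<open>amap T f\<close>.\<close>

lemma S2_natural:
  assumes f [simp]: "f \<in> arr C" "src C f = X" "trg C f = Y"
  shows "S2 Y \<cdot> amap T f = amap T f \<cdot> S2 X"
proof -
  have [simp]: "X \<in> obj C" "Y \<in> obj C" using obj_src_trg[OF f(1)] by simp_all
  let ?TX = "omap T X" and ?TY = "omap T Y"
  have 1: "ltr C L (sl Y) \<cdot> ltr C L (ltr C L f) = ltr C L (amap T (ltr C L (amap T f)))
      \<cdot> ltr C L (sl X)"
    using antipode_natural[of f] by (simp flip: ltr_cmp)
  have 2: "sl (dual L ?TY) \<cdot> amap T (ltr C L (amap T (ltr C L (amap T f))))
      = ltr C L (ltr C L (amap T f)) \<cdot> sl (dual L ?TX)"
    using antipode_natural[of "ltr C L (amap T f)"] by simp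
  have "\<phi> ?TY \<cdot> (S2 Y \<cdot> amap T f) = (\<phi> ?TY \<cdot> S2 Y) \<cdot> amap T f" by simp
  also have "\<dots> = sl (dual L ?TY) \<cdot> amap T (ltr C L (sl Y)) \<cdot> amap T (\<phi> Y \<cdot> f)"
    by (simp add: phi_S2 T.functor_cmp)
  also have "\<dots> = sl (dual L ?TY) \<cdot> amap T (ltr C L (sl Y) \<cdot> ltr C L (ltr C L f)) \<cdot> amap T (\<phi> X)"
    by (simp add: phi_natural[of f X Y] T.functor_cmp)
  also have "\<dots> = (sl (dual L ?TY) \<cdot> amap T (ltr C L (amap T (ltr C L (amap T f)))))
      \<cdot> amap T (ltr C L (sl X)) \<cdot> amap T (\<phi> X)"
    by (simp add: 1 T.functor_cmp)
  also have "\<dots> = ltr C L (ltr C L (amap T f)) \<cdot> (\<phi> ?TX \<cdot> S2 X)"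
    by (simp add: 2 phi_S2)
  also have "\<dots> = (ltr C L (ltr C L (amap T f)) \<cdot> \<phi> ?TX) \<cdot> S2 X" by simp
  also have "\<dots> = (\<phi> ?TY \<cdot> amap T f) \<cdot> S2 X"
    using phi_natural[of "amap T f" ?TX ?TY] by simp
  finally show ?thesis
    using phi_cancel[of ?TY "S2 Y \<cdot> amap T f" "amap T f \<cdot> S2 X"] by simp
qed

text \<open>Naturality of \<open>sl\<close> at the transposed action r pulls the double transpose of
  r out to the left. What remains is \<open>\<phi>\<close> after the square of the antipode, and
  naturality of \<open>\<phi>\<close> at r turns the double transpose into r.\<close>

lemma double_dual_action_phi:
  assumes m [simp]: "m \<in> modules C T"
  shows "dual_action (dual L (fst m), dual_action m) \<cdot> amap T (\<phi> (fst m))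
      = \<phi> (fst m) \<cdot> snd m \<cdot> S2 (fst m)"
proof -
  let ?M = "fst m" and ?r = "snd m"
  let ?A = "dual L ?M" and ?TM = "omap T ?M"
  have 1: "sl ?A \<cdot> amap T (ltr C L (amap T (ltr C L ?r))) = ltr C L (ltr C L ?r) \<cdot> sl (dual L ?TM)"
    using antipode_natural[of "ltr C L ?r"] by simp
  have "dual_action (?A, dual_action m) \<cdot> amap T (\<phi> ?M)
     = (sl ?A \<cdot> amap T (ltr C L (amap T (ltr C L ?r)))) \<cdot> amap T (ltr C L (sl ?M)) \<cdot> amap T (\<phi> ?M)"
    by (simp add: dual_action_def ltr_cmp T.functor_cmp)
  also have "\<dots> = ltr C L (ltr C L ?r) \<cdot> (\<phi> ?TM \<cdot> S2 ?M)"
    by (simp add: 1 phi_S2)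
  also have "\<dots> = (ltr C L (ltr C L ?r) \<cdot> \<phi> ?TM) \<cdot> S2 ?M" by simp
  also have "\<dots> = (\<phi> ?M \<cdot> ?r) \<cdot> S2 ?M"
    using phi_natural[of ?r ?TM ?M] by simp
  finally show ?thesis by simp
qed

lemma linear_phi_iff:
  assumes m [simp]: "m \<in> modules C T" and [simp]: "\<alpha> \<in> arr C" "src C \<alpha> = fst m" "trg C \<alpha> = fst m"
  defines "d \<equiv> dual module_duals"
  shows "(m, \<phi> (fst m) \<cdot> \<alpha>, d (d m)) \<in> module_arrows C T \<longleftrightarrow> \<alpha> \<cdot> snd m
      = snd m \<cdot> S2 (fst m) \<cdot> amap T \<alpha>"
proof -
  let ?M = "fst m" and ?r = "snd m"
  let ?A = "dual L ?M"
  have d: "(?A, dual_action m) \<in> modules C T" by (rule dual_module) simp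
  have "dual_action (?A, dual_action m) \<cdot> amap T (\<phi> ?M \<cdot> \<alpha>) = (dual_action (?A, dual_action m)
      \<cdot> amap T (\<phi> ?M)) \<cdot> amap T \<alpha>"
    using dual_action_arr[OF d] by (simp add: T.functor_cmp)
  also have "\<dots> = \<phi> ?M \<cdot> (?r \<cdot> S2 ?M \<cdot> amap T \<alpha>)"
    by (simp add: double_dual_action_phi)
  finally have 1: "dual_action (?A, dual_action m) \<cdot> amap T (\<phi> ?M \<cdot> \<alpha>)
      = \<phi> ?M \<cdot> (?r \<cdot> S2 ?M \<cdot> amap T \<alpha>)" .
  show ?thesis
    using dual_module[OF d] phi_cancel[of ?M "\<alpha> \<cdot> ?r" "?r \<cdot> S2 ?M \<cdot> amap T \<alpha>"]
    by (simp add: module_arrows_iff d_def module_duals_simps 1)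
qed

end

section \<open>Grouplike elements\<close>

context hopf_monad begin

lemma nat_eta_iff:
  "nat_trans C C id_functor T g \<longleftrightarrow> g \<in> extensional (obj C) \<and>
    (\<forall>X \<in> obj C. g X \<in> arr C \<and> src C (g X) = X \<and> trg C (g X) = omap T X) \<and>
    (\<forall>f \<in> arr C. g (trg C f) \<cdot> f = amap T f \<cdot> g (src C f))"
  by (auto simp: nat_trans_def id_functor_def in_hom)

abbreviation free_module where "free_module X \<equiv> (omap T X, mu T X)"

lemma free_module [simp]: "X \<in> obj C \<Longrightarrow> free_module X \<in> modules C T"
  by (rule modulesI) (simp_all add: mu_laws)

text \<open>This and the next lemmas collect the linear arrows at which endomorphisms of the
  forgetful functor are tested. \<open>free_arrow\<close>, \<open>T2_arrow\<close> and
  \<open>T0_arrow\<close> give naturality and grouplikeness of the element,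
  \<open>action_arrow\<close> recovers values on all modules from free ones, and
  \<open>mu_arrow\<close>, \<open>ev_arrow\<close> and \<open>coev_arrow\<close> serve the
  inverse.\<close>

lemma free_arrow:
    "f \<in> arr C \<Longrightarrow> (free_module (src C f), amap T f, free_module (trg C f)) \<in> module_arrows C T"
  by (simp add: module_arrows_iff mu_natural)

lemma mu_arrow: "X \<in> obj C \<Longrightarrow> (free_module (omap T X), mu T X, free_module X) \<in> module_arrows C T"
  by (simp add: module_arrows_iff mu_laws)

lemma action_arrow: "m \<in> modules C T \<Longrightarrow> (free_module (fst m), snd m, m) \<in> module_arrows C T"
  by (simp add: module_arrows_iff module_laws)

lemma T2_arrow:
  "\<lbrakk>X \<in> obj C; Y \<in> obj C\<rbrakk> \<Longrightarrow> (free_module (X \<boxtimes> Y), T2 T X Y, mtens (free_module X)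
      (free_module Y)) \<in> module_arrows C T"
  using mtens_module[of "free_module X" "free_module Y"] by (simp add: module_arrows_iff T2_mu)

lemma T0_arrow: "(free_module \<one>, T0 T, (\<one>, T0 T)) \<in> module_arrows C T"
  by (simp add: module_arrows_iff T0_mu unit_module)

lemma ev_arrow: "m \<in> modules C T \<Longrightarrow> (mtens (dual L (fst m), dual_action m) m, ev L (fst m),
    (\<one>, T0 T)) \<in> module_arrows C T"
  using mtens_module[OF dual_module, of m m] by (simp add: module_arrows_iff unit_module
      dual_action_ev)

lemma coev_arrow: "m \<in> modules C T
    \<Longrightarrow> ((\<one>, T0 T), coev L (fst m), mtens m (dual L (fst m), dual_action m)) \<in> module_arrows C T"
  using mtens_module[OF _ dual_module, of m m] by (simp add: module_arrows_iff unit_module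
      dual_action_coev)

end

section \<open>Inversion and conjugation by grouplike elements\<close>

locale grouplike_element = hopf_monad C L R T sl sr
  for C :: "('o, 'a) moncat" (structure) and L R T sl sr and g :: "'o \<Rightarrow> 'a" +
  assumes grouplike: "g \<in> grouplike_elements C T"
begin

lemma g_nat_trans: "nat_trans C C id_functor T g"
  using grouplike by (simp add: grouplike_elements_def)

lemma g_arr [simp]:
  assumes "X \<in> obj C"
  shows "g X \<in> arr C" "src C (g X) = X" "trg C (g X) = omap T X"
  using g_nat_trans assms by (simp_all add: nat_eta_iff)

lemma g_natural: "f \<in> arr C \<Longrightarrow> g (trg C f) \<cdot> f = amap T f \<cdot> g (src C f)"
  using g_nat_trans by (simp add: nat_eta_iff)

lemma g_tensor: "\<lbrakk>X \<in> obj C; Y \<in> obj C\<rbrakk> \<Longrightarrow> T2 T X Y \<cdot> g (X \<boxtimes> Y) = g X \<otimes> g Y"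
  using grouplike by (simp add: grouplike_elements_def)

lemma g_unit: "T0 T \<cdot> g \<one> = ident C \<one>"
  using grouplike by (simp add: grouplike_elements_def)

definition act :: "'o \<times> 'a \<Rightarrow> 'a" where
  "act m = snd m \<cdot> g (fst m)"

lemma act_arr [simp]:
  assumes "m \<in> modules C T"
  shows "act m \<in> arr C" "src C (act m) = fst m" "trg C (act m) = fst m"
  using assms by (simp_all add: act_def)

lemma act_natural:
  assumes f: "(m, f, n) \<in> module_arrows C T"
  shows "f \<cdot> act m = act n \<cdot> f"
proof -
  have [simp]: "m \<in> modules C T" "n \<in> modules C T" "f \<in> arr C" "src C f = fst m" "trg C f = fst n"
    and l: "f \<cdot> snd m = snd n \<cdot> amap T f"
    using f by (auto simp: module_arrows_iff)
  have "f \<cdot> act m = (f \<cdot> snd m) \<cdot> g (fst m)" by (simp add: act_def)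
  also have "\<dots> = snd n \<cdot> (amap T f \<cdot> g (fst m))" by (simp add: l)
  also have "amap T f \<cdot> g (fst m) = g (fst n) \<cdot> f" using g_natural[of f] by simp
  finally show ?thesis by (simp add: act_def)
qed

lemma act_mtens:
  assumes [simp]: "m \<in> modules C T" "n \<in> modules C T"
  shows "act (mtens m n) = act m \<otimes> act n"
  by (simp add: act_def g_tensor fuse)

lemma act_unit: "act (\<one>, T0 T) = ident C \<one>"
  by (simp add: act_def g_unit)

definition act_inv :: "'o \<times> 'a \<Rightarrow> 'a" where
  "act_inv m = (ident C (fst m) \<otimes> ev L (fst m))
     \<cdot> (ident C (fst m) \<otimes> act (dual L (fst m), dual_action m) \<otimes> ident C (fst m))
     \<cdot> (coev L (fst m) \<otimes> ident C (fst m))"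

text \<open>The action of \<open>g\<close> is natural for linear arrows and monoidal, so it
  preserves the evaluation and coevaluation of \<open>m\<close>. These are the hypotheses of
  \<open>dual_inverse\<close>, with the action on the dual module as second arrow.\<close>

lemma act_inv:
  assumes m [simp]: "m \<in> modules C T"
  shows "act_inv m \<in> arr C" "src C (act_inv m) = fst m" "trg C (act_inv m) = fst m"
    "act m \<cdot> act_inv m = ident C (fst m)" "act_inv m \<cdot> act m = ident C (fst m)"
proof -
  let ?d = "(dual L (fst m), dual_action m)"
  note d [simp] = dual_module[OF m]
  have [simp]: "act ?d \<in> arr C" "src C (act ?d) = dual L (fst m)" "trg C (act ?d) = dual L (fst m)"
    using act_arr[OF d] by simp_all
  show "act_inv m \<in> arr C" "src C (act_inv m) = fst m" "trg C (act_inv m) = fst m"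
    by (simp_all add: act_inv_def)
  have "ev L (fst m) \<cdot> (act ?d \<otimes> act m) = ev L (fst m)"
    using act_natural[OF ev_arrow[OF m]] act_mtens[OF d m] by (simp add: act_unit)
  moreover have "(act m \<otimes> act ?d) \<cdot> coev L (fst m) = coev L (fst m)"
    using act_natural[OF coev_arrow[OF m]] act_mtens[OF m d] by (simp add: act_unit)
  ultimately show "act m \<cdot> act_inv m = ident C (fst m)" "act_inv m \<cdot> act m = ident C (fst m)"
    unfolding act_inv_def by (intro dual_inverse; simp)+
qed

lemma act_inv_natural:
  assumes f: "(m, f, n) \<in> module_arrows C T"
  shows "f \<cdot> act_inv m = act_inv n \<cdot> f"
proof -
  have m [simp]: "m \<in> modules C T" and n [simp]: "n \<in> modules C T"
    and [simp]: "f \<in> arr C" "src C f = fst m" "trg C f = fst n"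
    using f by (auto simp: module_arrows_iff)
  note [simp] = act_inv(1-3)
  have "f \<cdot> act_inv m = (act_inv n \<cdot> act n) \<cdot> f \<cdot> act_inv m" by (simp add: act_inv(5) del:
      cmp_assoc')
  also have "\<dots> = act_inv n \<cdot> (act n \<cdot> f) \<cdot> act_inv m" by simp
  also have "act n \<cdot> f = f \<cdot> act m" by (rule act_natural[OF f, symmetric])
  also have "act_inv n \<cdot> (f \<cdot> act m) \<cdot> act_inv m = act_inv n \<cdot> f \<cdot> (act m \<cdot> act_inv m)" by simp
  also have "\<dots> = act_inv n \<cdot> f" by (simp add: act_inv(4))
  finally show ?thesis .
qed

text \<open>The element that acts by \<open>act_inv\<close>, read off at the units of free
  modules.\<close>

definition g_inv :: "'o \<Rightarrow> 'a" where
  "g_inv = (\<lambda>X \<in> obj C. act_inv (free_module X) \<cdot> eta T X)"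

lemma g_inv_arr [simp]:
  assumes "X \<in> obj C"
  shows "g_inv X \<in> arr C" "src C (g_inv X) = X" "trg C (g_inv X) = omap T X"
  using assms act_inv(1-3)[of "free_module X"] by (simp_all add: g_inv_def)

lemma mu_act_eta:
  assumes "X \<in> obj C"
  shows "act (free_module X) \<cdot> eta T X = g X"
proof -
  have "act (free_module X) \<cdot> eta T X = mu T X \<cdot> (g (omap T X) \<cdot> eta T X)"
    using assms by (simp add: act_def)
  also have "g (omap T X) \<cdot> eta T X = amap T (eta T X) \<cdot> g X"
    using g_natural[of "eta T X"] assms by simp
  also have "mu T X \<cdot> \<dots> = (mu T X \<cdot> amap T (eta T X)) \<cdot> g X" using assms by simp
  also have "\<dots> = g X" using assms by (simp add: mu_laws)
  finally show ?thesis .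
qed

lemma g_inv_nat_trans: "nat_trans C C id_functor T g_inv"
  unfolding nat_eta_iff
proof (intro conjI ballI)
  fix f assume f [simp]: "f \<in> arr C"
  note [simp] = act_inv(1-3)[of "free_module (src C f)"] act_inv(1-3)[of "free_module (trg C f)"]
  have "g_inv (trg C f) \<cdot> f = act_inv (free_module (trg C f)) \<cdot> (eta T (trg C f) \<cdot> f)"
    by (simp add: g_inv_def)
  also have "\<dots> = (act_inv (free_module (trg C f)) \<cdot> amap T f) \<cdot> eta T (src C f)"
    by (simp add: eta_natural)
  also have "\<dots> = (amap T f \<cdot> act_inv (free_module (src C f))) \<cdot> eta T (src C f)"
    by (simp only: act_inv_natural[OF free_arrow[OF f]])
  finally show "g_inv (trg C f) \<cdot> f = amap T f \<cdot> g_inv (src C f)"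
    by (simp add: g_inv_def)
qed (simp_all, simp add: g_inv_def)

lemma conv_g_inv:
  assumes X [simp]: "X \<in> obj C"
  shows "mu T X \<cdot> g (omap T X) \<cdot> g_inv X = eta T X"
    "mu T X \<cdot> g_inv (omap T X) \<cdot> g X = eta T X"
proof -
  note [simp] = act_inv(1-3)[of "free_module X"] act_inv(1-3)[of "free_module (omap T X)"]
  have "mu T X \<cdot> g (omap T X) \<cdot> g_inv X = (act (free_module X) \<cdot> act_inv (free_module X)) \<cdot> eta T X"
    by (simp add: g_inv_def act_def)
  then show "mu T X \<cdot> g (omap T X) \<cdot> g_inv X = eta T X" by (simp add: act_inv)
  \<comment> \<open>Here the inverse lives on the free module over \<open>omap T X\<close>;
    linearity of \<open>mu T X\<close> carries it to the free module over \<open>X\<close>.\<close>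
  have "mu T X \<cdot> g_inv (omap T X) \<cdot> g X = (mu T X \<cdot> act_inv (free_module (omap T X)))
      \<cdot> eta T (omap T X) \<cdot> g X"
    by (simp add: g_inv_def)
  also have "\<dots> = (act_inv (free_module X) \<cdot> mu T X) \<cdot> eta T (omap T X) \<cdot> g X"
    by (simp only: act_inv_natural[OF mu_arrow[OF X]])
  also have "\<dots> = act_inv (free_module X) \<cdot> (mu T X \<cdot> eta T (omap T X)) \<cdot> g X" by simp
  also have "\<dots> = act_inv (free_module X) \<cdot> (act (free_module X) \<cdot> eta T X)"
    by (simp add: mu_laws mu_act_eta)
  also have "\<dots> = (act_inv (free_module X) \<cdot> act (free_module X)) \<cdot> eta T X"
    using act_arr[of "free_module X"] by simp
  finally show "mu T X \<cdot> g_inv (omap T X) \<cdot> g X = eta T X"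
    by (simp add: act_inv)
qed

lemma conv_inv_g: "conv_inv C T g = g_inv"
  unfolding conv_inv_def
proof (rule the_equality)
  have e: "eta T \<in> extensional (obj C)" using monad by (simp add: is_monad_def nat_trans_def)
  have "conv C T g g_inv = eta T" "conv C T g_inv g = eta T"
    by (rule extensionalityI[OF _ e]; simp add: conv_def conv_g_inv)+
  with g_inv_nat_trans show "nat_trans C C id_functor T g_inv \<and> conv C T g g_inv
      = eta T \<and> conv C T g_inv g = eta T"
    by simp
next
  fix b assume b: "nat_trans C C id_functor T b \<and> conv C T g b = eta T \<and> conv C T b g = eta T"
  show "b = g_inv"
  proof (rule extensionalityI[of _ "obj C"])
    fix X assume X [simp]: "X \<in> obj C"
    have bX [simp]: "b X \<in> arr C" "src C (b X) = X" "trg C (b X) = omap T X" using b by (simp_all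
        add: nat_eta_iff)
    have gb: "mu T X \<cdot> g (omap T X) \<cdot> b X = eta T X"
    proof -
      have "conv C T g b X = eta T X" using b by simp
      then show ?thesis by (simp add: conv_def)
    qed
    note [simp] = act_inv(1-3)[of "free_module X"] act_arr[of "free_module X"]
    have "b X = (act_inv (free_module X) \<cdot> act (free_module X)) \<cdot> b X" by (simp add: act_inv(5))
    also have "\<dots> = act_inv (free_module X) \<cdot> act (free_module X) \<cdot> b X" by simp
    also have "act (free_module X) \<cdot> b X = eta T X" using gb by (simp add: act_def)
    finally show "b X = g_inv X" by (simp add: g_inv_def)
  qed (use b in \<open>simp_all add: nat_trans_def g_inv_def\<close>)
qed

lemma ad_apply:
  assumes "X \<in> obj C"
  shows "ad C T g X = mu T X \<cdot> g (omap T X) \<cdot> mu T X \<cdot> amap T (g_inv X)"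
  using assms by (simp add: ad_def left_mult_def right_mult_def conv_inv_g)

text \<open>The middle term is \<open>?P\<close>, which reads g x = s(x) g with the products taken
  by \<open>mu T\<close>. It is equivalent to the module condition, through the arrows out of free
  modules, and to s(x) = g x g^-1, by multiplying with the convolution inverse of
  \<open>g\<close>.\<close>

lemma eq_ad_iff:
  assumes s: "\<And>X. X \<in> obj C \<Longrightarrow> s X \<in> arr C \<and> src C (s X) = omap T X \<and> trg C (s X) = omap T X"
    and nat: "\<And>f. f \<in> arr C \<Longrightarrow> s (trg C f) \<cdot> amap T f = amap T f \<cdot> s (src C f)"
    and ext: "s \<in> extensional (obj C)"
  shows "s = ad C T g \<longleftrightarrow>
    (\<forall>m \<in> modules C T. act m \<cdot> snd m = snd m \<cdot> s (fst m) \<cdot> amap T (act m))"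
proof -
  have [simp]: "s X \<in> arr C" "src C (s X) = omap T X" "trg C (s X) = omap T X" if "X \<in> obj C" for X
    using s[OF that] by auto
  let ?P = "\<forall>X \<in> obj C. mu T X \<cdot> g (omap T X) = mu T X \<cdot> s (omap T X) \<cdot> amap T (g X)"
  have l: "act m \<cdot> snd m = snd m \<cdot> mu T (fst m) \<cdot> g (omap T (fst m))" if [simp]:
      "m \<in> modules C T" for m
  proof -
    have "act m \<cdot> snd m = snd m \<cdot> (g (fst m) \<cdot> snd m)" by (simp add: act_def)
    also have "g (fst m) \<cdot> snd m = amap T (snd m) \<cdot> g (omap T (fst m))"
      using g_natural[of "snd m"] by simp
    also have "snd m \<cdot> \<dots> = (snd m \<cdot> amap T (snd m)) \<cdot> g (omap T (fst m))" by simp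
    also have "\<dots> = (snd m \<cdot> mu T (fst m)) \<cdot> g (omap T (fst m))" by (simp only: module_laws(1)[OF
        that])
    finally show ?thesis by simp
  qed
  have r: "snd m \<cdot> s (fst m) \<cdot> amap T (act m) = snd m \<cdot> mu T (fst m) \<cdot> s (omap T (fst m))
      \<cdot> amap T (g (fst m))"
    if [simp]: "m \<in> modules C T" for m
  proof -
    have "snd m \<cdot> s (fst m) \<cdot> amap T (act m) = snd m \<cdot> (s (fst m) \<cdot> amap T (snd m))
        \<cdot> amap T (g (fst m))"
      by (simp add: act_def T.functor_cmp)
    also have "s (fst m) \<cdot> amap T (snd m) = amap T (snd m) \<cdot> s (omap T (fst m))"
      using nat[of "snd m"] by simp
    also have "snd m \<cdot> \<dots> \<cdot> amap T (g (fst m)) = (snd m \<cdot> amap T (snd m)) \<cdot> s (omap T (fst m))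
        \<cdot> amap T (g (fst m))" by simp
    also have "\<dots> = (snd m \<cdot> mu T (fst m)) \<cdot> s (omap T (fst m)) \<cdot> amap T (g (fst m))" by (simp only:
        module_laws(1)[OF that])
    finally show ?thesis by simp
  qed
  have 1: "(\<forall>m \<in> modules C T. act m \<cdot> snd m = snd m \<cdot> s (fst m) \<cdot> amap T (act m)) \<longleftrightarrow> ?P"
  proof
    assume P: ?P
    show "\<forall>m \<in> modules C T. act m \<cdot> snd m = snd m \<cdot> s (fst m) \<cdot> amap T (act m)"
    proof
      fix m assume m: "m \<in> modules C T"
      show "act m \<cdot> snd m = snd m \<cdot> s (fst m) \<cdot> amap T (act m)"
        unfolding l[OF m] r[OF m] using P m by simp
    qed
  next
    assume A: "\<forall>m \<in> modules C T. act m \<cdot> snd m = snd m \<cdot> s (fst m) \<cdot> amap T (act m)"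
    show ?P
    proof
      fix X assume X [simp]: "X \<in> obj C"
      have a [simp]: "act (free_module X) \<in> arr C" "src C (act (free_module X)) = omap T X"
          "trg C (act (free_module X)) = omap T X"
        using act_arr[of "free_module X"] by simp_all
      have A': "act (free_module X) \<cdot> mu T X = mu T X \<cdot> s (omap T X) \<cdot> amap T (act (free_module X))"
        using A[rule_format, of "free_module X"] by simp
      \<comment> \<open>Precomposition with \<open>amap T (eta T X)\<close> extracts
        \<open>g X\<close> from the action on the free module.\<close>
      have "mu T X \<cdot> g (omap T X) = act (free_module X) \<cdot> (mu T X \<cdot> amap T (eta T X))"
        by (simp add: mu_laws act_def)
      also have "\<dots> = (act (free_module X) \<cdot> mu T X) \<cdot> amap T (eta T X)" by simp
      also have "\<dots> = mu T X \<cdot> s (omap T X) \<cdot> amap T (act (free_module X) \<cdot> eta T X)"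
        unfolding A' by (simp add: T.functor_cmp)
      also have "\<dots> = mu T X \<cdot> s (omap T X) \<cdot> amap T (g X)"
        by (simp add: mu_act_eta)
      finally show "mu T X \<cdot> g (omap T X) = mu T X \<cdot> s (omap T X) \<cdot> amap T (g X)" .
    qed
  qed
  \<comment> \<open>The formula is rearranged so that it contains the left-hand side of
    \<open>?P\<close> at \<open>omap T X\<close>.\<close>
  have ad: "ad C T g X = mu T X \<cdot> (mu T (omap T X) \<cdot> g (omap T (omap T X))) \<cdot> amap T (g_inv X)"
      if X [simp]: "X \<in> obj C" for X
  proof -
    have "ad C T g X = mu T X \<cdot> (g (omap T X) \<cdot> mu T X) \<cdot> amap T (g_inv X)" by (simp add: ad_apply)
    also have "g (omap T X) \<cdot> mu T X = amap T (mu T X) \<cdot> g (omap T (omap T X))"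
      using g_natural[of "mu T X"] by simp
    also have "mu T X \<cdot> \<dots> \<cdot> amap T (g_inv X) = (mu T X \<cdot> amap T (mu T X)) \<cdot> g (omap T (omap T X))
        \<cdot> amap T (g_inv X)" by simp
    finally show ?thesis by (simp add: mu_laws)
  qed
  have 2: "s = ad C T g" if P: ?P
  proof (rule extensionalityI[OF ext])
    show "ad C T g \<in> extensional (obj C)" by (simp add: ad_def)
    fix X assume X [simp]: "X \<in> obj C"
    let ?T = "omap T X"
    have "mu T ?T \<cdot> g (omap T ?T) = mu T ?T \<cdot> s (omap T ?T) \<cdot> amap T (g ?T)"
      using P by simp
    then have "ad C T g X = (mu T X \<cdot> mu T ?T) \<cdot> s (omap T ?T) \<cdot> amap T (g ?T \<cdot> g_inv X)"
      by (simp add: ad T.functor_cmp)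
    also have "\<dots> = (mu T X \<cdot> amap T (mu T X)) \<cdot> s (omap T ?T) \<cdot> amap T (g ?T \<cdot> g_inv X)"
      by (simp only: mu_laws(1)[OF X])
    also have "\<dots> = mu T X \<cdot> (amap T (mu T X) \<cdot> s (omap T ?T)) \<cdot> amap T (g ?T \<cdot> g_inv X)"
      by simp
    also have "amap T (mu T X) \<cdot> s (omap T ?T) = s ?T \<cdot> amap T (mu T X)"
      using nat[of "mu T X"] by simp
    also have "mu T X \<cdot> (s ?T \<cdot> amap T (mu T X)) \<cdot> amap T (g ?T \<cdot> g_inv X)
        = mu T X \<cdot> s ?T \<cdot> amap T (mu T X \<cdot> g ?T \<cdot> g_inv X)"
      by (simp add: T.functor_cmp)
    also have "\<dots> = mu T X \<cdot> (s ?T \<cdot> amap T (eta T X))"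
      by (simp add: conv_g_inv)
    also have "s ?T \<cdot> amap T (eta T X) = amap T (eta T X) \<cdot> s X"
      using nat[of "eta T X"] by simp
    also have "mu T X \<cdot> \<dots> = (mu T X \<cdot> amap T (eta T X)) \<cdot> s X" by simp
    also have "\<dots> = s X" by (simp add: mu_laws)
    finally show "s X = ad C T g X" ..
  qed
  have 3: ?P if S: "s = ad C T g"
  proof
    fix X assume X [simp]: "X \<in> obj C"
    let ?T = "omap T X"
    have "mu T X \<cdot> s ?T \<cdot> amap T (g X) = (mu T X \<cdot> mu T ?T) \<cdot> g (omap T ?T) \<cdot> mu T ?T
        \<cdot> amap T (g_inv ?T) \<cdot> amap T (g X)"
      by (simp add: S ad_apply)
    also have "\<dots> = (mu T X \<cdot> amap T (mu T X)) \<cdot> g (omap T ?T) \<cdot> mu T ?T \<cdot> amap T (g_inv ?T)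
        \<cdot> amap T (g X)"
      by (simp only: mu_laws(1)[OF X])
    also have "\<dots> = mu T X \<cdot> (amap T (mu T X) \<cdot> g (omap T ?T)) \<cdot> mu T ?T \<cdot> amap T (g_inv ?T)
        \<cdot> amap T (g X)"
      by simp
    also have "amap T (mu T X) \<cdot> g (omap T ?T) = g ?T \<cdot> mu T X"
      using g_natural[of "mu T X"] by simp
    also have "mu T X \<cdot> (g ?T \<cdot> mu T X) \<cdot> mu T ?T \<cdot> amap T (g_inv ?T) \<cdot> amap T (g X)
      = mu T X \<cdot> g ?T \<cdot> (mu T X \<cdot> mu T ?T) \<cdot> amap T (g_inv ?T) \<cdot> amap T (g X)" by simp
    also have "\<dots> = mu T X \<cdot> g ?T \<cdot> (mu T X \<cdot> amap T (mu T X)) \<cdot> amap T (g_inv ?T) \<cdot> amap T (g X)"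
      by (simp only: mu_laws(1)[OF X])
    also have "\<dots> = mu T X \<cdot> g ?T \<cdot> mu T X \<cdot> amap T (mu T X \<cdot> g_inv ?T \<cdot> g X)"
      by (simp add: T.functor_cmp)
    also have "\<dots> = mu T X \<cdot> g ?T"
      by (simp add: conv_g_inv mu_laws)
    finally show "mu T X \<cdot> g ?T = mu T X \<cdot> s ?T \<cdot> amap T (g X)" ..
  qed
  show ?thesis using 1 2 3 by blast
qed

end

section \<open>Sovereign elements\<close>

context sovereign_hopf_monad begin

abbreviation mdual where "mdual m \<equiv> (dual L (fst m), dual_action m)"

text \<open>The duality constructions in modules have those of \<open>C\<close> as underlying
  arrows. Only the stored endpoints need work, and they match because units are strict.\<close>

lemma ltr_TC:
  assumes "(m, f, n) \<in> module_arrows C T"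
  shows "ltr TC module_duals (m, f, n) = (mdual n, ltr C L f, mdual m)"
proof -
  have m: "m \<in> modules C T" and n: "n \<in> modules C T" and f: "src C f = fst m" "trg C f = fst n"
    using assms by (auto simp: module_arrows_iff)
  show ?thesis
    using mtens_unit[OF dual_module[OF m]] mtens_unit[OF dual_module[OF n]]
    by (simp add: ltr_def Let_def TC_simps module_duals_simps f)
qed

lemma ldual_mult_TC:
  assumes m: "m \<in> modules C T" and n: "n \<in> modules C T"
  shows "ldual_mult TC module_duals m n = (mtens (mdual n) (mdual m), ldual_mult C L (fst m)
      (fst n), mdual (mtens m n))"
  using mtens_unit[OF mtens_module[OF dual_module[OF n] dual_module[OF m]]]
    mtens_unit[OF dual_module[OF mtens_module[OF m n]]]
  by (simp add: ldual_mult_def TC_simps module_duals_simps)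

lemma tev_TC:
  assumes "\<Phi> m = (m, u, mdual (mdual m))"
  shows "TC.tev \<Phi> m = (mtens m (mdual m), ev L (dual L (fst m)) \<cdot> (u \<otimes> ident C (dual L (fst m))),
      (\<one>, T0 T))"
  using assms by (simp add: TC.tev_def TC_simps module_duals_simps)

text \<open>Since \<open>\<phi>\<close> is itself natural, monoidal and invertible, it cancels from
  every clause. Typing of \<open>\<Phi>\<close> in modules becomes the twisted linearity of
  \<open>a\<close>; the other clauses say that \<open>a\<close> is a monoidal endomorphism of the
  forgetful functor.\<close>

lemma pivotal_TC_iff:
  assumes a: "\<And>m. m \<in> modules C T \<Longrightarrow> a m \<in> arr C \<and> src C (a m) = fst m \<and> trg C (a m) = fst m"
    and \<Phi>: "\<And>m. m \<in> modules C T \<Longrightarrow> \<Phi> m = (m, \<phi> (fst m) \<cdot> a m, mdual (mdual m))"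
  shows "TC.pivotal \<Phi> \<longleftrightarrow>
     (\<forall>m \<in> modules C T. a m \<cdot> snd m = snd m \<cdot> S2 (fst m) \<cdot> amap T (a m)) \<and>
     (\<forall>m f n. (m, f, n) \<in> module_arrows C T \<longrightarrow> f \<cdot> a m = a n \<cdot> f) \<and>
     (\<forall>m \<in> modules C T. \<forall>n \<in> modules C T. a (mtens m n) = a m \<otimes> a n) \<and>
     a (\<one>, T0 T) = ident C \<one>"
proof -
  have [simp]: "a m \<in> arr C" "src C (a m) = fst m" "trg C (a m) = fst m" if "m \<in> modules C T" for m
    using a[OF that] by auto
  have [simp]: "mdual m \<in> modules C T" if "m \<in> modules C T" for m
    using that by (rule dual_module)
  have 1: "(\<forall>m \<in> obj TC. \<Phi> m \<in> hom TC m (dual module_duals (dual module_duals m))) \<longleftrightarrow>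
     (\<forall>m \<in> modules C T. a m \<cdot> snd m = snd m \<cdot> S2 (fst m) \<cdot> amap T (a m))"
    using linear_phi_iff by (simp add: TC_simps(1) hom_TC \<Phi> module_duals_simps)
  \<comment> \<open>Well-typedness \<open>h\<close>, the clause treated in \<open>1\<close>, is
    assumed because the passage between pairings and naturality squares requires it.\<close>
  have 2: "(\<forall>f \<in> arr TC. TC.tev \<Phi> (trg TC f) \<cdot>\<^bsub>TC\<^esub> (f \<otimes>\<^bsub>TC\<^esub> ident TC (dual module_duals (trg TC f)))
        = TC.tev \<Phi> (src TC f) \<cdot>\<^bsub>TC\<^esub> (ident TC (src TC f) \<otimes>\<^bsub>TC\<^esub> ltr TC module_duals f)) \<longleftrightarrow>
     (\<forall>m f n. (m, f, n) \<in> module_arrows C T \<longrightarrow> f \<cdot> a m = a n \<cdot> f)"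
    if h: "\<forall>m \<in> obj TC. \<Phi> m \<in> hom TC m (dual module_duals (dual module_duals m))"
  proof -
    have "TC.tev \<Phi> n \<cdot>\<^bsub>TC\<^esub> ((m, f, n) \<otimes>\<^bsub>TC\<^esub> ident TC (dual module_duals n))
        = TC.tev \<Phi> m \<cdot>\<^bsub>TC\<^esub> (ident TC m \<otimes>\<^bsub>TC\<^esub> ltr TC module_duals (m, f, n)) \<longleftrightarrow> f \<cdot> a m = a n \<cdot> f"
      if f: "(m, f, n) \<in> module_arrows C T" for m f n
    proof -
      have m [simp]: "m \<in> modules C T" "n \<in> modules C T" and [simp]: "f \<in> arr C" "src C f = fst m"
          "trg C f = fst n"
        using f by (auto simp: module_arrows_iff)
      have ltr: "(mdual n, ltr C L f, mdual m) \<in> module_arrows C T"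
        using TC.ltr_arr[of "(m, f, n)"] f by (simp add: TC_simps ltr_TC)
      \<comment> \<open>The clause is turned back into a naturality square, where the double
        transpose can be moved across \<open>\<phi>\<close> and cancelled.\<close>
      have "TC.tev \<Phi> n \<cdot>\<^bsub>TC\<^esub> ((m, f, n) \<otimes>\<^bsub>TC\<^esub> ident TC (dual module_duals n))
        = TC.tev \<Phi> m \<cdot>\<^bsub>TC\<^esub> (ident TC m \<otimes>\<^bsub>TC\<^esub> ltr TC module_duals (m, f, n)) \<longleftrightarrow>
        \<Phi> n \<cdot>\<^bsub>TC\<^esub> (m, f, n) = ltr TC module_duals (ltr TC module_duals (m, f, n)) \<cdot>\<^bsub>TC\<^esub> \<Phi> m"
        using h f by (intro TC.tev_natural_iff[symmetric]) (simp_all add: TC_simps)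
      also have "\<dots> \<longleftrightarrow> \<phi> (fst n) \<cdot> a n \<cdot> f = (ltr C L (ltr C L f) \<cdot> \<phi> (fst m)) \<cdot> a m"
        by (simp add: ltr_TC[OF f] ltr_TC[OF ltr] \<Phi> TC_simps)
      also have "ltr C L (ltr C L f) \<cdot> \<phi> (fst m) = \<phi> (fst n) \<cdot> f"
        by (rule phi_natural[symmetric]) simp_all
      also have "\<phi> (fst n) \<cdot> a n \<cdot> f = (\<phi> (fst n) \<cdot> f) \<cdot> a m \<longleftrightarrow> f \<cdot> a m = a n \<cdot> f"
        using phi_cancel[of "fst n" "a n \<cdot> f" "f \<cdot> a m"] by auto
      finally show ?thesis .
    qed
    moreover have q: "(\<forall>f \<in> arr TC. P f) \<longleftrightarrow> (\<forall>m f n. (m, f, n) \<in> module_arrows C T \<longrightarrow> P (m, f, n))"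
        for P
      by (auto simp: TC_simps(2))
    ultimately show ?thesis
      unfolding q TC_simps(3,4) fst_conv snd_conv by blast
  qed
  have t: "TC.tev \<Phi> m = (mtens m (mdual m), tev \<phi> (fst m) \<cdot> (a m \<otimes> ident C (dual L (fst m))),
      (\<one>, T0 T))"
    if "m \<in> modules C T" for m
    using tev_TC[of \<Phi> m, OF \<Phi>[OF that]] that by (simp add: tev_def fuse)
  have 3: "(\<forall>m \<in> obj TC. \<forall>n \<in> obj TC.
       TC.tev \<Phi> (m \<boxtimes>\<^bsub>TC\<^esub> n) \<cdot>\<^bsub>TC\<^esub> (ident TC (m \<boxtimes>\<^bsub>TC\<^esub> n) \<otimes>\<^bsub>TC\<^esub> ldual_mult TC module_duals m n)
        = TC.tev \<Phi> m \<cdot>\<^bsub>TC\<^esub> (ident TC m \<otimes>\<^bsub>TC\<^esub> TC.tev \<Phi> n \<otimes>\<^bsub>TC\<^esub> ident TC (dual module_duals m))) \<longleftrightarrow>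
     (\<forall>m \<in> modules C T. \<forall>n \<in> modules C T. a (mtens m n) = a m \<otimes> a n)"
  proof -
    have "TC.tev \<Phi> (m \<boxtimes>\<^bsub>TC\<^esub> n) \<cdot>\<^bsub>TC\<^esub> (ident TC (m \<boxtimes>\<^bsub>TC\<^esub> n) \<otimes>\<^bsub>TC\<^esub> ldual_mult TC module_duals m n)
        = TC.tev \<Phi> m \<cdot>\<^bsub>TC\<^esub> (ident TC m \<otimes>\<^bsub>TC\<^esub> TC.tev \<Phi> n \<otimes>\<^bsub>TC\<^esub> ident TC (dual module_duals m))
        \<longleftrightarrow> a (mtens m n) = a m \<otimes> a n" if m [simp]: "m \<in> modules C T" and n [simp]: "n \<in>
            modules C T" for m n
    proof -
      have mn: "mtens m n \<in> modules C T" using m n by (rule mtens_module)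
      \<comment> \<open>Module arrows store their sources, so the equation of pairings includes an
        equality of source modules; it is settled here, leaving only the underlying arrows.\<close>
      have s: "mtens (mtens m n) (mtens (mdual n) (mdual m))
          = mtens m (mtens (mtens n (mdual n)) (mdual m))"
        using mtens_assoc[OF m n mtens_module[of "mdual n" "mdual m"]] mtens_assoc[of n "mdual n"
            "mdual m"]
        by (simp only: \<open>\<And>m. m \<in> modules C T \<Longrightarrow> mdual m \<in> modules C T\<close> m n)
      show ?thesis
        using s a[OF mn] tev_mult_cancel[OF pivotal_phi, of "fst m" "fst n" "a m" "a n"
            "a (mtens m n)"]
        by (simp only: TC_simps(5,7-9) t[OF m] t[OF n] t[OF mn] ldual_mult_TC[OF m n]
            module_duals_simps fst_conv snd_conv
            prod.inject module_simps m n a simp_thms)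
    qed
    then show ?thesis by (simp add: TC_simps(1))
  qed
  have 4: "TC.tev \<Phi> \<one>\<^bsub>TC\<^esub> = ev module_duals \<one>\<^bsub>TC\<^esub> \<longleftrightarrow> a (\<one>, T0 T) = ident C \<one>"
  proof -
    note u = unit_module
    have "TC.tev \<Phi> \<one>\<^bsub>TC\<^esub> = ev module_duals \<one>\<^bsub>TC\<^esub> \<longleftrightarrow> tev \<phi> \<one> \<cdot> (a (\<one>, T0 T) \<otimes> ident C (dual L \<one>))
        = ev L \<one>"
      using mtens_unit[OF dual_module[OF u]] by (simp add: TC_simps(6) t[OF u] module_duals_simps)
    also have "\<dots> \<longleftrightarrow> a (\<one>, T0 T) = ident C \<one>"
    proof
      assume "tev \<phi> \<one> \<cdot> (a (\<one>, T0 T) \<otimes> ident C (dual L \<one>)) = ev L \<one>"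
      then show "a (\<one>, T0 T) = ident C \<one>"
        using tev_cancel[OF pivotal_phi, of \<one> "a (\<one>, T0 T)" "ident C \<one>"] a[OF u]
        by (simp add: pivotalD(4)[OF pivotal_phi])
    qed (simp add: pivotalD(4)[OF pivotal_phi])
    finally show ?thesis .
  qed
  show ?thesis
    unfolding TC.pivotal_def using 1 2 3 4 by blast
qed

definition pivotal_of :: "('o \<Rightarrow> 'a) \<Rightarrow> 'o \<times> 'a \<Rightarrow> ('o \<times> 'a) \<times> 'a \<times> ('o \<times> 'a)" where
  "pivotal_of g = (\<lambda>m \<in> modules C T. (m, \<phi> (fst m) \<cdot> snd m \<cdot> g (fst m), mdual (mdual m)))"

lemma S2_extensional: "S2 \<in> extensional (obj C)"
  by (simp add: antipode_square_def)

text \<open>For a grouplike element the naturality and monoidality clauses of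
  \<open>pivotal_TC_iff\<close> hold automatically. Twisted linearity is the one condition left, and
  \<open>eq_ad_iff\<close> translates it.\<close>

lemma S2_eq_ad_iff:
  assumes "g \<in> grouplike_elements C T"
  shows "S2 = ad C T g \<longleftrightarrow> TC.pivotal (pivotal_of g)"
proof -
  interpret g: grouplike_element C L R T sl sr g by unfold_locales fact
  have "TC.pivotal (pivotal_of g) \<longleftrightarrow>
     (\<forall>m \<in> modules C T. g.act m \<cdot> snd m = snd m \<cdot> S2 (fst m) \<cdot> amap T (g.act m)) \<and>
     (\<forall>m f n. (m, f, n) \<in> module_arrows C T \<longrightarrow> f \<cdot> g.act m = g.act n \<cdot> f) \<and>
     (\<forall>m \<in> modules C T. \<forall>n \<in> modules C T. g.act (mtens m n) = g.act m \<otimes> g.act n) \<and>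
     g.act (\<one>, T0 T) = ident C \<one>"
    by (rule pivotal_TC_iff) (simp_all add: pivotal_of_def, simp add: g.act_def)
  also have "\<dots> \<longleftrightarrow> (\<forall>m \<in> modules C T. g.act m \<cdot> snd m = snd m \<cdot> S2 (fst m) \<cdot> amap T (g.act m))"
    using g.act_natural g.act_mtens g.act_unit by blast
  also have "\<dots> \<longleftrightarrow> S2 = ad C T g"
    by (rule g.eq_ad_iff[symmetric]) (simp_all add: S2_natural S2_extensional)
  finally show ?thesis by simp
qed

text \<open>On a free module the action of the element, evaluated at the unit of the monad, returns
  the element itself.\<close>

lemma pivotal_of_inj:
  assumes g: "g \<in> grouplike_elements C T" and h: "h \<in> grouplike_elements C T" and eq: "pivotal_of g
      = pivotal_of h"
  shows "g = h"
proof -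
  interpret g: grouplike_element C L R T sl sr g by unfold_locales fact
  interpret h: grouplike_element C L R T sl sr h by unfold_locales fact
  show ?thesis
  proof (rule extensionalityI[of _ "obj C"])
    fix X assume X [simp]: "X \<in> obj C"
    note [simp] = g.act_arr[of "free_module X"] h.act_arr[of "free_module X"]
    have "\<phi> (omap T X) \<cdot> g.act (free_module X) = \<phi> (omap T X) \<cdot> h.act (free_module X)"
      using fun_cong[OF eq, of "free_module X"] by (simp add: pivotal_of_def g.act_def h.act_def)
    then have "g.act (free_module X) = h.act (free_module X)"
      by (simp add: phi_cancel)
    then show "g X = h X"
      using g.mu_act_eta[OF X] h.mu_act_eta[OF X] by simp
  qed (use g.g_nat_trans h.g_nat_trans in \<open>simp_all add: nat_eta_iff\<close>)
qed

lemma pivotal_of_surj: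
  assumes ext: "\<Phi> \<in> extensional (obj TC)" and p: "TC.pivotal \<Phi>"
  obtains g where "g \<in> grouplike_elements C T" "pivotal_of g = \<Phi>"
proof -
  define a where "a m = inv_arr C (\<phi> (fst m)) \<cdot> fst (snd (\<Phi> m))" for m
  have \<Phi>: "\<Phi> m \<in> module_arrows C T \<and> fst (\<Phi> m) = m \<and> snd (snd (\<Phi> m)) = mdual (mdual m)" if
      "m \<in> modules C T" for m
    using TC.pivotalD(1)[OF p, of m] that by (simp add: hom_TC TC_simps(1) module_duals_simps)
  have u [simp]: "fst (snd (\<Phi> m)) \<in> arr C" "src C (fst (snd (\<Phi> m))) = fst m"
      "trg C (fst (snd (\<Phi> m))) = dual L (dual L (fst m))"
    if "m \<in> modules C T" for m
  proof -
    have "(m, fst (snd (\<Phi> m)), mdual (mdual m)) \<in> module_arrows C T"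
      using \<Phi>[OF that] by (cases "\<Phi> m") auto
    then show "fst (snd (\<Phi> m)) \<in> arr C" "src C (fst (snd (\<Phi> m))) = fst m" "trg C (fst (snd (\<Phi> m)))
        = dual L (dual L (fst m))"
      by (auto simp: module_arrows_iff)
  qed
  have a [simp]: "a m \<in> arr C" "src C (a m) = fst m" "trg C (a m) = fst m" if
      "m \<in> modules C T" for m
    using that by (simp_all add: a_def)
  have \<Phi>a: "\<Phi> m = (m, \<phi> (fst m) \<cdot> a m, mdual (mdual m))" if m: "m \<in> modules C T" for m
  proof -
    have "\<phi> (fst m) \<cdot> a m = (\<phi> (fst m) \<cdot> inv_arr C (\<phi> (fst m))) \<cdot> fst (snd (\<Phi> m))"
      using m by (simp add: a_def del: phi_inv(5))
    also have "\<dots> = fst (snd (\<Phi> m))" using m by simp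
    finally show ?thesis using \<Phi>[OF m] by (cases "\<Phi> m") simp
  qed
  have "(\<forall>m f n. (m, f, n) \<in> module_arrows C T \<longrightarrow> f \<cdot> a m = a n \<cdot> f) \<and>
     (\<forall>m \<in> modules C T. \<forall>n \<in> modules C T. a (mtens m n) = a m \<otimes> a n) \<and> a (\<one>, T0 T) = ident C \<one>"
    using p pivotal_TC_iff[of a \<Phi>] a \<Phi>a by blast
  then have nat: "\<And>m f n. (m, f, n) \<in> module_arrows C T \<Longrightarrow> f \<cdot> a m = a n \<cdot> f"
    and ten: "\<And>m n. \<lbrakk>m \<in> modules C T; n \<in> modules C T\<rbrakk> \<Longrightarrow> a (mtens m n) = a m \<otimes> a n"
    and unit: "a (\<one>, T0 T) = ident C \<one>"
    by blast+
  \<comment> \<open>The universal element of the endomorphism \<open>a\<close>: its value on free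
    modules, restricted along the unit.\<close>
  define g where "g = (\<lambda>X \<in> obj C. a (free_module X) \<cdot> eta T X)"
  have af [simp]: "a (free_module X) \<in> arr C" "src C (a (free_module X)) = omap T X"
      "trg C (a (free_module X)) = omap T X"
    if "X \<in> obj C" for X
    using a[of "free_module X"] that by simp_all
  have g: "g \<in> grouplike_elements C T"
    unfolding grouplike_elements_def mem_Collect_eq nat_eta_iff
  proof (intro conjI ballI)
    show "g \<in> extensional (obj C)" by (simp add: g_def)
    fix X assume "X \<in> obj C"
    then show "g X \<in> arr C" "src C (g X) = X" "trg C (g X) = omap T X" by (simp_all add: g_def)
  next
    fix f assume f [simp]: "f \<in> arr C"
    have "g (trg C f) \<cdot> f = a (free_module (trg C f)) \<cdot> (eta T (trg C f) \<cdot> f)" by (simp add: g_def)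
    also have "\<dots> = (a (free_module (trg C f)) \<cdot> amap T f) \<cdot> eta T (src C f)" by (simp add:
        eta_natural)
    also have "\<dots> = (amap T f \<cdot> a (free_module (src C f))) \<cdot> eta T (src C f)"
      by (simp only: nat[OF free_arrow[OF f]])
    finally show "g (trg C f) \<cdot> f = amap T f \<cdot> g (src C f)" by (simp add: g_def)
  next
    fix X Y assume X [simp]: "X \<in> obj C" and Y [simp]: "Y \<in> obj C"
    have "T2 T X Y \<cdot> g (X \<boxtimes> Y) = (T2 T X Y \<cdot> a (free_module (X \<boxtimes> Y))) \<cdot> eta T (X \<boxtimes> Y)"
      by (simp add: g_def)
    also have "\<dots> = (a (mtens (free_module X) (free_module Y)) \<cdot> T2 T X Y) \<cdot> eta T (X \<boxtimes> Y)"
      by (simp only: nat[OF T2_arrow[OF X Y]])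
    also have "a (mtens (free_module X) (free_module Y)) = a (free_module X) \<otimes> a (free_module Y)"
      by (rule ten) simp_all
    finally show "T2 T X Y \<cdot> g (X \<boxtimes> Y) = g X \<otimes> g Y"
      by (simp add: T2_eta g_def fuse)
  next
    have "T0 T \<cdot> g \<one> = (T0 T \<cdot> a (free_module \<one>)) \<cdot> eta T \<one>" by (simp add: g_def)
    also have "\<dots> = (a (\<one>, T0 T) \<cdot> T0 T) \<cdot> eta T \<one>" by (simp only: nat[OF T0_arrow])
    finally show "T0 T \<cdot> g \<one> = ident C \<one>" by (simp add: unit T0_eta)
  qed
  moreover have "pivotal_of g = \<Phi>"
  proof (rule extensionalityI[of _ "modules C T"])
    show "\<Phi> \<in> extensional (modules C T)" using ext by (simp add: TC_simps(1))
    fix m assume m [simp]: "m \<in> modules C T"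
    \<comment> \<open>The action of \<open>m\<close> is a linear arrow from the free module on
      \<open>fst m\<close>, so naturality of \<open>a\<close> expresses \<open>a m\<close> through
      its value there.\<close>
    have "snd m \<cdot> g (fst m) = (snd m \<cdot> a (free_module (fst m))) \<cdot> eta T (fst m)" by (simp add:
        g_def)
    also have "\<dots> = (a m \<cdot> snd m) \<cdot> eta T (fst m)" by (simp only: nat[OF action_arrow[OF m]])
    also have "\<dots> = a m" by (simp add: module_laws)
    finally show "pivotal_of g m = \<Phi> m" by (simp add: pivotal_of_def \<Phi>a)
  qed (simp add: pivotal_of_def)
  ultimately show thesis by (rule that)
qed

lemma bij_betw_pivotal_of:
  "bij_betw pivotal_of (sovereign_elements C L \<phi> T sl) {\<Phi> \<in> extensional (obj TC). TC.pivotal \<Phi>}"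
proof (rule bij_betw_imageI)
  show "inj_on pivotal_of (sovereign_elements C L \<phi> T sl)"
    using pivotal_of_inj by (intro inj_onI) (simp add: sovereign_elements_def)
  have "pivotal_of g \<in> extensional (obj TC)" for g by (simp add: pivotal_of_def TC_simps(1))
  then show "pivotal_of ` sovereign_elements C L \<phi> T sl = {\<Phi> \<in> extensional (obj TC). TC.pivotal \<Phi>}"
    using S2_eq_ad_iff pivotal_of_surj
    by (auto simp: sovereign_elements_def image_iff) metis
qed

end

theorem proposition7p6:
  fixes C :: "('o, 'a) moncat"
    and \<Sigma> :: "(('o, 'a) dual_data \<times> ('o \<Rightarrow> 'a)) set"
    and L R :: "('o, 'a) dual_data"
    and \<phi> :: "'o \<Rightarrow> 'a"
    and T :: "('o, 'a) bimonad_data"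
    and sl sr :: "'o \<Rightarrow> 'a"
  assumes "sovereign_category C \<Sigma>"
    and "(L, \<phi>) \<in> \<Sigma>"
    and "hopf_monad C L R T sl sr"
  shows "\<exists>F. bij_betw F (sovereign_elements C L \<phi> T sl)
    (sovereign_structures (module_category C T) // sovereign_equiv (module_category C T))"
proof -
  have "(L, \<phi>) \<in> sovereign_structures C"
    using sovereign_category.sovereign_class[OF assms(1)] assms(2)
    by (auto simp: quotient_def sovereign_equiv_def)
  then interpret sovereign_hopf_monad C L R T sl sr \<phi>
    using assms(3) by (simp add: sovereign_hopf_monad_def sovereign_hopf_monad_axioms_def)
  \<comment> \<open>The bijection sends \<open>G\<close> to the class of \<open>pivotal_of G\<close>
    on the duals \<open>module_duals\<close>.\<close>
  show ?thesis
    using bij_betw_trans[OF bij_betw_pivotal_of TC.bij_betw_sovereign_classes] by blast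
qed

end
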